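(* Let $\Phi$ be a monotone, differentiable, real-valued functional on the space of symmetric $m\times m$ matrices, and let $\xi^*$ be any design minimizing the functional $\Phi(D(\xi))$ over the set $\Xi$. Then the inequality $$\varphi(x,\xi^* )\le b(x,\xi^* )$$ holds for all $x\in\mathcal X$, where $$\varphi(x,\xi)=f^T(x)D(\xi)C(\xi)M^{-1}(\xi)f(x),\qquad b(x,\xi)=\operatorname{tr}\bigl(C(\xi)M^{-1}(\xi)B(\xi,\xi_x)M^{-1}(\xi)\bigr).$$ Moreover, there is equality for $\xi^*$-almost all $x$, that is, $\xi^*(\mathcal A)=0$, where $\mathcal A=\{x\in\mathcal X:\ \varphi(x,\xi^* )<b(x,\xi^* )\}$ is the set of $x\in\mathcal X$ at which the inequality is strict.
   Context: Consider the linear regression model $y(x)=\theta^Tf(x)+\varepsilon(x)$, $x\in\mathcal X$, where $\mathcal X\subset\mathbb R^d$ is compact, $f=(f_1,\dots,f_m)^T$ has linearly independent continuous components with $f(x)\ne 0$ for all $x\in\mathcal X$, $\theta\in\mathbb R^m$ is unknown, and the error $\varepsilon$ has mean zero and covariance kernel $K$. The kernel $K$ is symmetric, continuous at all points $(u,v)\in\mathcal X\times\mathcal X$ except possibly at the diagonal points $(u,u)$, satisfies $K(u,v)\neq 0$ for at least one pair $u\ne v$, and is positive definite: $\iint K(u,v)\,\nu(du)\,\nu(dv)\ge 0$ for every signed measure $\nu$ on $\mathcal X$. Kernels with singularities at the diagonal are allowed; in that case $K(u,v)=r(u-v)$ with $0\le r(t)<\infty$ for $t\ne0$, $r(0)=+\infty$,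 and $r$ is the pointwise limit of a monotonously increasing sequence of covariance functions $\sigma_N^2\rho_N$ with $0\le\sigma_N^2\rho_N(t)\le r(t)$ for all $t$ and $N$. A design is a probability measure on $\mathcal X$. For designs $\xi,\nu$ set $$M(\xi)=\int f(u)f^T(u)\,\xi(du),\quad B(\xi,\nu)=\iint K(u,v)f(u)f^T(v)\,\xi(du)\,\nu(dv),$$ $$D(\xi)=M^{-1}(\xi)B(\xi,\xi)M^{-1}(\xi),$$ provided that the corresponding integrals exist. $\Xi$ is the set of designs $\xi$ for which the matrices $B(\xi,\xi)$ and $M^{-1}(\xi)$ are well defined. $\xi_x$ denotes the probability measure concentrated at the point $x$, so that $B(\xi,\xi_x)=\int K(u,x)f(u)\,\xi(du)\,f^T(x)$. Monotone means: $A\ge B$ (Loewner ordering) implies $\Phi(A)\ge\Phi(B)$. Differentiable means that the matrix of derivatives $\partial\Phi(D)/\partial D=(\partial\Phi(D)/\partial D_{ij})_{i,j=1,\dots,m}$ exists, where $D$ is any symmetric nonnegative definite $m\times m$ matrix; and $C(\xi)=\partial\Phi(D)/\partial D\big|_{D=D(\xi)}$.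
   Formalization: For kernels infinite on the diagonal, φ≤b is claimed only at x where B(ξ*,ξ_x) exists and x is a limit of finite-energy designs with potentials dominated by that of ξ_x, and ν-a.e. for every design ν with B(ν,ν) well defined; differentiable means Fréchet differentiable. *)

theory Defs
  imports "HOL-Probability.Probability"
begin

section \<open>Integrals of extended real functions\<close>

text \<open>
  Kernels take values in \<^typ>\<open>ereal\<close>, since a singular kernel equals \<open>\<infinity>\<close> on the diagonal.
  An integral counts as well defined when it exists as a finite number.
\<close>

definition ext_integrable :: "'a measure \<Rightarrow> ('a \<Rightarrow> ereal) \<Rightarrow> bool" where
  "ext_integrable M h \<longleftrightarrow>
     h \<in> borel_measurable M \<and> (\<integral>\<^sup>+ z. e2ennreal \<bar>h z\<bar> \<partial>M) < \<infinity>"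

definition ext_integral :: "'a measure \<Rightarrow> ('a \<Rightarrow> ereal) \<Rightarrow> real" where
  "ext_integral M h = (\<integral> z. real_of_ereal (h z) \<partial>M)"


section \<open>Covariance kernels\<close>

definition double_integrable ::
  "('a \<Rightarrow> 'a \<Rightarrow> ereal) \<Rightarrow> 'a measure \<Rightarrow> 'a measure \<Rightarrow> bool" where
  "double_integrable K \<mu> \<nu> \<longleftrightarrow> ext_integrable (\<mu> \<Otimes>\<^sub>M \<nu>) (\<lambda>(u, v). K u v)"

definition double_integral ::
  "('a \<Rightarrow> 'a \<Rightarrow> ereal) \<Rightarrow> 'a measure \<Rightarrow> 'a measure \<Rightarrow> real" where
  "double_integral K \<mu> \<nu> = ext_integral (\<mu> \<Otimes>\<^sub>M \<nu>) (\<lambda>(u, v). K u v)"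

text \<open>
  A finite signed Borel measure on \<open>X\<close> is a difference \<open>\<mu> - \<nu>\<close> of two finite Borel measures;
  the double integral of \<open>K\<close> against it is expanded bilinearly. The inequality is required
  only where this integral is a finite number.
\<close>

definition finite_borel_on :: "(real ^ 'd) set \<Rightarrow> (real ^ 'd) measure \<Rightarrow> bool" where
  "finite_borel_on X \<mu> \<longleftrightarrow> finite_measure \<mu> \<and> sets \<mu> = sets (restrict_space borel X)"

definition kernel_pos_def ::
  "(real ^ 'd) set \<Rightarrow> (real ^ 'd \<Rightarrow> real ^ 'd \<Rightarrow> ereal) \<Rightarrow> bool" where
  "kernel_pos_def X K \<longleftrightarrow>
     (\<forall>\<mu> \<nu>. finite_borel_on X \<mu> \<and> finite_borel_on X \<nu> \<and>
        double_integrable K \<mu> \<mu> \<and> double_integrable K \<mu> \<nu> \<and>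
        double_integrable K \<nu> \<mu> \<and> double_integrable K \<nu> \<nu> \<longrightarrow>
        double_integral K \<mu> \<mu> - double_integral K \<mu> \<nu>
          - double_integral K \<nu> \<mu> + double_integral K \<nu> \<nu> \<ge> 0)"

definition basic_kernel ::
  "(real ^ 'd) set \<Rightarrow> (real ^ 'd \<Rightarrow> real ^ 'd \<Rightarrow> ereal) \<Rightarrow> bool" where
  "basic_kernel X K \<longleftrightarrow>
     (\<forall>u\<in>X. \<forall>v\<in>X. K u v = K v u) \<and>
     (\<forall>u\<in>X. \<forall>v\<in>X. u \<noteq> v \<longrightarrow> \<bar>K u v\<bar> \<noteq> \<infinity>) \<and>
     (\<forall>u\<in>X. \<forall>v\<in>X. u \<noteq> v \<longrightarrow>
        continuous (at (u, v) within X \<times> X) (\<lambda>(s, t). K s t)) \<and>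
     kernel_pos_def X K"

definition finite_kernel ::
  "(real ^ 'd) set \<Rightarrow> (real ^ 'd \<Rightarrow> real ^ 'd \<Rightarrow> ereal) \<Rightarrow> bool" where
  "finite_kernel X K \<longleftrightarrow> (\<forall>u\<in>X. \<forall>v\<in>X. \<bar>K u v\<bar> \<noteq> \<infinity>)"

text \<open>
  Only the values of \<open>r\<close> on \<open>{u - v | u v. u \<in> X \<and> v \<in> X}\<close> matter. The function \<open>c N\<close> is the
  stationary covariance function \<open>\<sigma>\<^sub>N\<^sup>2 \<rho>\<^sub>N\<close>.
\<close>

definition singular_kernel ::
  "(real ^ 'd) set \<Rightarrow> (real ^ 'd \<Rightarrow> real ^ 'd \<Rightarrow> ereal) \<Rightarrow> bool" where
  "singular_kernel X K \<longleftrightarrow>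
     (\<exists>(r :: real ^ 'd \<Rightarrow> ereal) (c :: nat \<Rightarrow> real ^ 'd \<Rightarrow> real).
        (\<forall>u\<in>X. \<forall>v\<in>X. K u v = r (u - v)) \<and>
        r 0 = \<infinity> \<and>
        (\<forall>N. basic_kernel X (\<lambda>u v. ereal (c N (u - v)))) \<and>
        (\<forall>t\<in>{u - v | u v. u \<in> X \<and> v \<in> X}.
           (t \<noteq> 0 \<longrightarrow> 0 \<le> r t \<and> r t < \<infinity>) \<and>
           (\<forall>N. 0 \<le> c N t \<and> ereal (c N t) \<le> r t) \<and>
           incseq (\<lambda>N. c N t) \<and>
           (\<lambda>N. ereal (c N t)) \<longlonglongrightarrow> r t))"

definition covariance_kernel ::
  "(real ^ 'd) set \<Rightarrow> (real ^ 'd \<Rightarrow> real ^ 'd \<Rightarrow> ereal) \<Rightarrow> bool" where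
  "covariance_kernel X K \<longleftrightarrow>
     basic_kernel X K \<and>
     (\<exists>u\<in>X. \<exists>v\<in>X. u \<noteq> v \<and> K u v \<noteq> 0) \<and>
     (finite_kernel X K \<or> singular_kernel X K)"


section \<open>Regression functions and designs\<close>

definition regression_functions ::
  "(real ^ 'd) set \<Rightarrow> (real ^ 'd \<Rightarrow> real ^ 'm) \<Rightarrow> bool" where
  "regression_functions X f \<longleftrightarrow>
     (\<forall>i. continuous_on X (\<lambda>x. f x $ i)) \<and>
     (\<forall>a :: real ^ 'm. (\<forall>x\<in>X. (\<Sum>i\<in>UNIV. a $ i * f x $ i) = 0) \<longrightarrow> a = 0) \<and>
     (\<forall>x\<in>X. f x \<noteq> 0)"

definition designs :: "(real ^ 'd) set \<Rightarrow> (real ^ 'd) measure set" where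
  "designs X = {\<xi>. prob_space \<xi> \<and> sets \<xi> = sets (restrict_space borel X)}"

definition point_design :: "(real ^ 'd) set \<Rightarrow> real ^ 'd \<Rightarrow> (real ^ 'd) measure" where
  "point_design X x = return (restrict_space borel X) x"

definition M_mat :: "('a \<Rightarrow> real ^ 'm) \<Rightarrow> 'a measure \<Rightarrow> real ^ 'm ^ 'm" where
  "M_mat f \<xi> = (\<chi> i j. \<integral> u. f u $ i * f u $ j \<partial>\<xi>)"

definition M_exists :: "('a \<Rightarrow> real ^ 'm) \<Rightarrow> 'a measure \<Rightarrow> bool" where
  "M_exists f \<xi> \<longleftrightarrow> (\<forall>i j. integrable \<xi> (\<lambda>u. f u $ i * f u $ j))"

definition B_mat ::
  "('a \<Rightarrow> 'a \<Rightarrow> ereal) \<Rightarrow> ('a \<Rightarrow> real ^ 'm) \<Rightarrow> 'a measure \<Rightarrow> 'a measure \<Rightarrow> real ^ 'm ^ 'm" where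
  "B_mat K f \<xi> \<nu> =
     (\<chi> i j. double_integral (\<lambda>u v. K u v * ereal (f u $ i * f v $ j)) \<xi> \<nu>)"

definition B_exists ::
  "('a \<Rightarrow> 'a \<Rightarrow> ereal) \<Rightarrow> ('a \<Rightarrow> real ^ 'm) \<Rightarrow> 'a measure \<Rightarrow> 'a measure \<Rightarrow> bool" where
  "B_exists K f \<xi> \<nu> \<longleftrightarrow>
     (\<forall>i j. double_integrable (\<lambda>u v. K u v * ereal (f u $ i * f v $ j)) \<xi> \<nu>)"

definition D_mat ::
  "('a \<Rightarrow> 'a \<Rightarrow> ereal) \<Rightarrow> ('a \<Rightarrow> real ^ 'm) \<Rightarrow> 'a measure \<Rightarrow> real ^ 'm ^ 'm" where
  "D_mat K f \<xi> = matrix_inv (M_mat f \<xi>) ** B_mat K f \<xi> \<xi> ** matrix_inv (M_mat f \<xi>)"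

text \<open>The set \<open>\<Xi>\<close> of admissible designs.\<close>

definition Xi_set ::
  "(real ^ 'd) set \<Rightarrow> (real ^ 'd \<Rightarrow> real ^ 'd \<Rightarrow> ereal) \<Rightarrow> (real ^ 'd \<Rightarrow> real ^ 'm)
     \<Rightarrow> (real ^ 'd) measure set" where
  "Xi_set X K f =
     {\<xi> \<in> designs X. B_exists K f \<xi> \<xi> \<and> M_exists f \<xi> \<and> invertible (M_mat f \<xi>)}"


section \<open>Optimality criteria\<close>

definition sym_mats :: "(real ^ 'm ^ 'm) set" where
  "sym_mats = {A. transpose A = A}"

definition nonneg_def :: "real ^ 'm ^ 'm \<Rightarrow> bool" where
  "nonneg_def A \<longleftrightarrow> A \<in> sym_mats \<and> (\<forall>z. 0 \<le> z \<bullet> (A *v z))"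

definition loewner_mono :: "(real ^ 'm ^ 'm \<Rightarrow> real) \<Rightarrow> bool" where
  "loewner_mono \<Phi> \<longleftrightarrow>
     (\<forall>A\<in>sym_mats. \<forall>B\<in>sym_mats. nonneg_def (A - B) \<longrightarrow> \<Phi> B \<le> \<Phi> A)"

text \<open>
  The matrix of derivatives of \<open>\<Phi>\<close> at \<open>D\<close>, for \<open>\<Phi>\<close> a function on symmetric matrices, is the
  symmetric matrix \<open>C\<close> that represents the Frechet derivative as \<open>H \<mapsto> tr (C H)\<close>. This is the
  convention in which the entries \<open>D\<^sub>i\<^sub>j\<close> and \<open>D\<^sub>j\<^sub>i\<close> count as separate arguments, so that
  off-diagonal entries are not doubled.
\<close>

definition has_matrix_derivative ::
  "(real ^ 'm ^ 'm \<Rightarrow> real) \<Rightarrow> real ^ 'm ^ 'm \<Rightarrow> real ^ 'm ^ 'm \<Rightarrow> bool" where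
  "has_matrix_derivative \<Phi> C D \<longleftrightarrow>
     C \<in> sym_mats \<and> (\<Phi> has_derivative (\<lambda>H. trace (C ** H))) (at D within sym_mats)"

definition matrix_differentiable :: "(real ^ 'm ^ 'm \<Rightarrow> real) \<Rightarrow> bool" where
  "matrix_differentiable \<Phi> \<longleftrightarrow> (\<forall>D. nonneg_def D \<longrightarrow> (\<exists>C. has_matrix_derivative \<Phi> C D))"

definition matrix_derivative ::
  "(real ^ 'm ^ 'm \<Rightarrow> real) \<Rightarrow> real ^ 'm ^ 'm \<Rightarrow> real ^ 'm ^ 'm" where
  "matrix_derivative \<Phi> D = (THE C. has_matrix_derivative \<Phi> C D)"

definition C_mat ::
  "(real ^ 'm ^ 'm \<Rightarrow> real) \<Rightarrow> ('a \<Rightarrow> 'a \<Rightarrow> ereal) \<Rightarrow> ('a \<Rightarrow> real ^ 'm) \<Rightarrow> 'a measure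
     \<Rightarrow> real ^ 'm ^ 'm" where
  "C_mat \<Phi> K f \<xi> = matrix_derivative \<Phi> (D_mat K f \<xi>)"

definition phi_fun ::
  "(real ^ 'm ^ 'm \<Rightarrow> real) \<Rightarrow> ('a \<Rightarrow> 'a \<Rightarrow> ereal) \<Rightarrow> ('a \<Rightarrow> real ^ 'm) \<Rightarrow> 'a \<Rightarrow> 'a measure
     \<Rightarrow> real" where
  "phi_fun \<Phi> K f x \<xi> =
     f x \<bullet> ((D_mat K f \<xi> ** C_mat \<Phi> K f \<xi> ** matrix_inv (M_mat f \<xi>)) *v f x)"

definition b_fun ::
  "(real ^ 'd) set \<Rightarrow> (real ^ 'm ^ 'm \<Rightarrow> real) \<Rightarrow> (real ^ 'd \<Rightarrow> real ^ 'd \<Rightarrow> ereal)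
     \<Rightarrow> (real ^ 'd \<Rightarrow> real ^ 'm) \<Rightarrow> real ^ 'd \<Rightarrow> (real ^ 'd) measure \<Rightarrow> real" where
  "b_fun X \<Phi> K f x \<xi> =
     trace (C_mat \<Phi> K f \<xi> ** matrix_inv (M_mat f \<xi>) ** B_mat K f \<xi> (point_design X x)
              ** matrix_inv (M_mat f \<xi>))"


section \<open>Points approachable by designs of finite energy\<close>

text \<open>
  For a singular kernel no point design is admissible, and \<open>\<phi> \<le> b\<close> can fail at single points
  of \<open>X\<close>: take \<open>K u v = \<bar>u - v\<bar> powr (-1/2)\<close> on \<open>X = {0..1} \<union> {2}\<close> with \<open>f = 1\<close> and \<open>\<Phi>\<close> the
  identity. Designs of finite energy do not charge the point \<open>2\<close>, so the optimal design \<open>\<xi>\<close> is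
  the equilibrium measure of \<open>{0..1}\<close>; its energy \<open>\<phi> 2 \<xi>\<close> is greater than \<open>1\<close>, whereas its
  potential \<open>b 2 \<xi>\<close> at \<open>2\<close> is less than \<open>1\<close>.

  The following condition on \<open>X\<close>, \<open>K\<close> and \<open>x\<close> excludes such points. It says that \<open>x\<close> is the limit
  of designs of finite energy whose potentials are dominated by that of the point design at \<open>x\<close>
  (for a Riesz kernel on an interval, use the uniform distributions near \<open>x\<close>).
\<close>

definition approachable ::
  "(real ^ 'd) set \<Rightarrow> (real ^ 'd \<Rightarrow> real ^ 'd \<Rightarrow> ereal) \<Rightarrow> real ^ 'd \<Rightarrow> bool" where
  "approachable X K x \<longleftrightarrow>
     (\<exists>(\<nu> :: nat \<Rightarrow> (real ^ 'd) measure) (c :: real). \<forall>n.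
        \<nu> n \<in> designs X \<and> double_integrable K (\<nu> n) (\<nu> n) \<and>
        (AE v in \<nu> n. dist v x \<le> 1 / real (Suc n)) \<and>
        (\<forall>u\<in>X. (\<integral>\<^sup>+ v. e2ennreal \<bar>K u v\<bar> \<partial>\<nu> n) \<le> ennreal c * (1 + e2ennreal \<bar>K u x\<bar>)))"

end

theory Submission
  imports Defs
begin

text \<open>
  For an optimal design \<open>\<xi>\<close> and an admissible competitor \<open>\<nu>\<close>, the criterion along the segment
  \<open>(1 - t) \<xi> + t \<nu>\<close> has a nonnegative right derivative at \<open>t = 0\<close>. Computed by the chain rule,
  this derivative is twice the difference of the \<open>\<nu>\<close>-integrals of \<open>b\<close> and \<open>\<phi>\<close>. For a finite kernel \<open>\<nu>\<close> may
  be a point design, which gives \<open>\<phi> \<le> b\<close> at each point. For a singular kernel \<open>\<nu>\<close> is either a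
  normalized restriction of a design of finite energy to the set where \<open>b < \<phi>\<close>, or runs through
  designs that contract to an approachable point. Since \<open>\<phi>\<close> and \<open>b\<close> have the same
  \<open>\<xi>\<close>-integral, the inequality is an equality \<open>\<xi>\<close>-almost everywhere.
\<close>

section \<open>Mixtures of probability measures\<close>

text \<open>The obstacle is the mixed terms. The energy of a mixture of \<open>\<xi>\<close> and
  \<open>\<nu>\<close> is a quadratic polynomial in the weight only if the mutual energy of
  \<open>\<xi>\<close> and \<open>\<nu>\<close> is finite, and \<open>kernel_pos_def\<close> is
  silent about measures whose energy integrals do not exist. A Cauchy-Schwarz argument for
  \<open>K\<close> itself would therefore be circular. Finiteness comes from truncation, in two
  forms: for a finite kernel the weight on the measure is cut off where \<open>K u x\<close> is
  large; for a singular kernel \<open>K\<close> is replaced by the bounded kernels that increase to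
  it. In both cases the bound is independent of the truncation level, and monotone convergence
  removes the truncation. At an approachable point the mutual energy is read off from the domination
  of potentials instead. A lower bound for the norm of \<open>f\<close> on the compact set
  \<open>X\<close> turns existence of the matrix B into finiteness of the scalar energy of
  \<open>K\<close>, so questions of existence are settled for \<open>K\<close> alone. The factor two
  in the directional derivative comes from symmetry: the derivative of D along the segment has the
  form \<open>Y + transpose Y\<close>, and the gradient is a symmetric matrix.\<close>

lemma integral_linear_of_nn_integral:
  fixes g :: "'a \<Rightarrow> real"
  assumes sets: "sets M = sets P" "sets N = sets P" and ab: "0 \<le> a" "0 \<le> b"
    and nn: "\<And>h. h \<in> borel_measurable P \<Longrightarrow>
      (\<integral>\<^sup>+ x. h x \<partial>P) = ennreal a * (\<integral>\<^sup>+ x. h x \<partial>M) + ennreal b * (\<integral>\<^sup>+ x. h x \<partial>N)"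
    and g: "integrable M g" "integrable N g"
  shows "integrable P g" "(\<integral>x. g x \<partial>P) = a * (\<integral>x. g x \<partial>M) + b * (\<integral>x. g x \<partial>N)"
proof -
  have [measurable]: "g \<in> borel_measurable P"
    using borel_measurable_integrable[OF g(1)] measurable_cong_sets[OF sets(1) refl] by auto
  have fin: "(\<integral>\<^sup>+ x. ennreal (s * g x) \<partial>Q) < \<infinity>" if "\<bar>s\<bar> = 1" "integrable Q g" for s Q
  proof -
    have "integrable Q (\<lambda>x. s * g x)" using that by simp
    then have "(\<integral>\<^sup>+ x. ennreal (s * g x) \<partial>Q) \<noteq> \<infinity>" by (auto simp only: real_integrable_def)
    then show ?thesis by (simp add: less_top)
  qed
  have nfin: "(\<integral>\<^sup>+ x. ennreal (norm (g x)) \<partial>Q) < \<infinity>" if "integrable Q g" for Q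
    using that unfolding integrable_iff_bounded by simp
  show i: "integrable P g"
    unfolding integrable_iff_bounded
    using nfin[OF g(1)] nfin[OF g(2)]
    by (subst nn) (auto simp: ennreal_mult_less_top)
  \<comment> \<open>The cases \<open>s = 1\<close> and \<open>s = -1\<close> are the positive and
    negative parts of \<open>g\<close>, whose difference is the Bochner integral; both are finite,
    so \<open>enn2real\<close> respects the sum.\<close>
  have eq: "enn2real (\<integral>\<^sup>+ x. ennreal (s * g x) \<partial>P) =
      a * enn2real (\<integral>\<^sup>+ x. ennreal (s * g x) \<partial>M) + b * enn2real (\<integral>\<^sup>+ x. ennreal (s * g x) \<partial>N)"
    if "\<bar>s\<bar> = 1" for s
    using fin[OF that g(1)] fin[OF that g(2)] ab
    by (subst nn) (auto simp: enn2real_plus enn2real_mult ennreal_mult_less_top)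
  show "(\<integral>x. g x \<partial>P) = a * (\<integral>x. g x \<partial>M) + b * (\<integral>x. g x \<partial>N)"
    using eq[of 1] eq[of "-1"]
    by (simp add: real_lebesgue_integral_def[OF i] real_lebesgue_integral_def[OF g(1)]
        real_lebesgue_integral_def[OF g(2)] algebra_simps)
qed

text \<open>The convex combination with weight \<open>a\<close> on the second measure, written as a
  bind over a coin flip: measurability, total mass and the integration rule then come from the Giry
  monad.\<close>

definition mixture :: "real \<Rightarrow> 'a measure \<Rightarrow> 'a measure \<Rightarrow> 'a measure" where
  "mixture a M N = measure_pmf (bernoulli_pmf a) \<bind> (\<lambda>b. if b then N else M)"

context
  fixes M N :: "'a measure" and a :: real
  assumes probs: "prob_space M" "prob_space N" and sets_eq: "sets N = sets M"
    and a: "0 \<le> a" "a \<le> 1"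
begin

lemma mixture_kernel: "(\<lambda>b. if b then N else M) \<in> measurable (measure_pmf (bernoulli_pmf a)) (subprob_algebra M)"
proof -
  interpret M: prob_space M by fact
  interpret N: prob_space N by fact
  show ?thesis
    using sets_eq M.subprob_space_axioms N.subprob_space_axioms
    by (auto simp: space_subprob_algebra)
qed

lemma sets_mixture: "sets (mixture a M N) = sets M"
  unfolding mixture_def by (rule sets_bind) (auto simp: sets_eq)

lemma prob_space_mixture: "prob_space (mixture a M N)"
  unfolding mixture_def
  by (rule prob_space.prob_space_bind[OF prob_space_measure_pmf _ mixture_kernel])
     (use probs in auto)

lemma nn_integral_mixture:
  assumes "h \<in> borel_measurable M"
  shows "(\<integral>\<^sup>+ x. h x \<partial>mixture a M N) = ennreal (1 - a) * (\<integral>\<^sup>+ x. h x \<partial>M) + ennreal a * (\<integral>\<^sup>+ x. h x \<partial>N)"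
  unfolding mixture_def using a
  by (subst nn_integral_bind[OF assms mixture_kernel]) (simp add: mult.commute add.commute)

lemma integral_mixture:
  fixes g :: "'a \<Rightarrow> real"
  assumes "integrable M g" "integrable N g"
  shows "integrable (mixture a M N) g"
    "(\<integral>x. g x \<partial>mixture a M N) = (1 - a) * (\<integral>x. g x \<partial>M) + a * (\<integral>x. g x \<partial>N)"
  by (rule integral_linear_of_nn_integral[where a = "1 - a" and b = a, OF _ _ _ _ _ assms];
      use a in \<open>simp add: sets_mixture sets_eq nn_integral_mixture measurable_cong_sets[OF sets_mixture refl]\<close>)+

text \<open>Tonelli with the \<open>L\<close>-integral innermost leaves a function of one variable
  to integrate against the mixture. In the mirrored lemma below the mixture is the inner
  measure.\<close>

lemma nn_integral_mixture_left:
  assumes L: "sigma_finite_measure L" and h: "h \<in> borel_measurable (M \<Otimes>\<^sub>M L)"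
  shows "(\<integral>\<^sup>+ z. h z \<partial>(mixture a M N \<Otimes>\<^sub>M L)) =
    ennreal (1 - a) * (\<integral>\<^sup>+ z. h z \<partial>(M \<Otimes>\<^sub>M L)) + ennreal a * (\<integral>\<^sup>+ z. h z \<partial>(N \<Otimes>\<^sub>M L))"
proof -
  interpret sigma_finite_measure L by fact
  have s: "sets (mixture a M N \<Otimes>\<^sub>M L) = sets (M \<Otimes>\<^sub>M L)" "sets (N \<Otimes>\<^sub>M L) = sets (M \<Otimes>\<^sub>M L)"
    by (auto intro!: sets_pair_measure_cong simp: sets_mixture sets_eq)
  have h': "h \<in> borel_measurable (mixture a M N \<Otimes>\<^sub>M L)" "h \<in> borel_measurable (N \<Otimes>\<^sub>M L)"
    using h measurable_cong_sets[OF s(1) refl] measurable_cong_sets[OF s(2) refl] by auto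
  show ?thesis
    using h by (simp flip: nn_integral_fst add: h' nn_integral_mixture borel_measurable_nn_integral_fst)
qed

lemma nn_integral_mixture_right:
  assumes h: "h \<in> borel_measurable (L \<Otimes>\<^sub>M M)"
  shows "(\<integral>\<^sup>+ z. h z \<partial>(L \<Otimes>\<^sub>M mixture a M N)) =
    ennreal (1 - a) * (\<integral>\<^sup>+ z. h z \<partial>(L \<Otimes>\<^sub>M M)) + ennreal a * (\<integral>\<^sup>+ z. h z \<partial>(L \<Otimes>\<^sub>M N))"
proof -
  interpret M: prob_space M by fact
  interpret N: prob_space N by fact
  interpret P: prob_space "mixture a M N" by (rule prob_space_mixture)
  have s: "sets (L \<Otimes>\<^sub>M mixture a M N) = sets (L \<Otimes>\<^sub>M M)" "sets (L \<Otimes>\<^sub>M N) = sets (L \<Otimes>\<^sub>M M)"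
    by (auto intro!: sets_pair_measure_cong simp: sets_mixture sets_eq)
  have h': "h \<in> borel_measurable (L \<Otimes>\<^sub>M mixture a M N)" "h \<in> borel_measurable (L \<Otimes>\<^sub>M N)"
    using h measurable_cong_sets[OF s(1) refl] measurable_cong_sets[OF s(2) refl] by auto
  have *: "(\<lambda>y. h (x, y)) \<in> borel_measurable M" if "x \<in> space L" for x
    using measurable_Pair2[OF h that] .
  have "(\<integral>\<^sup>+ z. h z \<partial>(L \<Otimes>\<^sub>M mixture a M N)) = (\<integral>\<^sup>+ x. \<integral>\<^sup>+ y. h (x, y) \<partial>mixture a M N \<partial>L)"
    using h' by (simp add: P.nn_integral_fst)
  also have "\<dots> = (\<integral>\<^sup>+ x. ennreal (1 - a) * (\<integral>\<^sup>+ y. h (x, y) \<partial>M) + ennreal a * (\<integral>\<^sup>+ y. h (x, y) \<partial>N) \<partial>L)"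
    by (intro nn_integral_cong nn_integral_mixture *)
  also have "\<dots> = ennreal (1 - a) * (\<integral>\<^sup>+ x. \<integral>\<^sup>+ y. h (x, y) \<partial>M \<partial>L) + ennreal a * (\<integral>\<^sup>+ x. \<integral>\<^sup>+ y. h (x, y) \<partial>N \<partial>L)"
    using h h' by (simp add: nn_integral_add nn_integral_cmult M.borel_measurable_nn_integral_fst N.borel_measurable_nn_integral_fst)
  finally show ?thesis using h h' by (simp add: M.nn_integral_fst N.nn_integral_fst)
qed

lemma nn_integral_mixture_square:
  assumes h: "h \<in> borel_measurable (M \<Otimes>\<^sub>M M)"
  shows "(\<integral>\<^sup>+ z. h z \<partial>(mixture a M N \<Otimes>\<^sub>M mixture a M N)) =
      ennreal (1 - a) * (ennreal (1 - a) * (\<integral>\<^sup>+ z. h z \<partial>(M \<Otimes>\<^sub>M M)) + ennreal a * (\<integral>\<^sup>+ z. h z \<partial>(M \<Otimes>\<^sub>M N)))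
    + ennreal a * (ennreal (1 - a) * (\<integral>\<^sup>+ z. h z \<partial>(N \<Otimes>\<^sub>M M)) + ennreal a * (\<integral>\<^sup>+ z. h z \<partial>(N \<Otimes>\<^sub>M N)))"
proof -
  interpret P: prob_space "mixture a M N" by (rule prob_space_mixture)
  have s: "sets (M \<Otimes>\<^sub>M mixture a M N) = sets (M \<Otimes>\<^sub>M M)" "sets (N \<Otimes>\<^sub>M M) = sets (M \<Otimes>\<^sub>M M)"
    by (auto intro!: sets_pair_measure_cong simp: sets_mixture sets_eq)
  have h': "h \<in> borel_measurable (M \<Otimes>\<^sub>M mixture a M N)" "h \<in> borel_measurable (N \<Otimes>\<^sub>M M)"
    using h measurable_cong_sets[OF s(1) refl] measurable_cong_sets[OF s(2) refl] by auto
  show ?thesis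
    using h h' by (simp add: nn_integral_mixture_left[OF P.sigma_finite_measure] nn_integral_mixture_right)
qed

text \<open>The two mixed products stay separate because \<open>g\<close> need not be symmetric. The
  value is a quadratic polynomial in \<open>a\<close>; applied to the entries of B it gives the
  expansion along the segment between two designs.\<close>

lemma integral_mixture_square:
  fixes g :: "'a \<times> 'a \<Rightarrow> real"
  assumes g: "integrable (M \<Otimes>\<^sub>M M) g" "integrable (M \<Otimes>\<^sub>M N) g"
    "integrable (N \<Otimes>\<^sub>M M) g" "integrable (N \<Otimes>\<^sub>M N) g"
  shows "integrable (mixture a M N \<Otimes>\<^sub>M mixture a M N) g"
    "(\<integral>z. g z \<partial>(mixture a M N \<Otimes>\<^sub>M mixture a M N)) =
      (1 - a) * ((1 - a) * (\<integral>z. g z \<partial>(M \<Otimes>\<^sub>M M)) + a * (\<integral>z. g z \<partial>(M \<Otimes>\<^sub>M N)))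
      + a * ((1 - a) * (\<integral>z. g z \<partial>(N \<Otimes>\<^sub>M M)) + a * (\<integral>z. g z \<partial>(N \<Otimes>\<^sub>M N)))"
proof -
  interpret P: prob_space "mixture a M N" by (rule prob_space_mixture)
  have s: "sets (M \<Otimes>\<^sub>M mixture a M N) = sets (M \<Otimes>\<^sub>M M)" "sets (M \<Otimes>\<^sub>M N) = sets (M \<Otimes>\<^sub>M M)"
    "sets (N \<Otimes>\<^sub>M mixture a M N) = sets (N \<Otimes>\<^sub>M M)" "sets (N \<Otimes>\<^sub>M N) = sets (N \<Otimes>\<^sub>M M)"
    "sets (mixture a M N \<Otimes>\<^sub>M mixture a M N) = sets (M \<Otimes>\<^sub>M mixture a M N)"
    "sets (mixture a M N \<Otimes>\<^sub>M mixture a M N) = sets (N \<Otimes>\<^sub>M mixture a M N)"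
    by (auto intro!: sets_pair_measure_cong simp: sets_mixture sets_eq)
  note c = measurable_cong_sets[OF s(1) refl] measurable_cong_sets[OF s(3) refl]
     measurable_cong_sets[OF s(5) refl]
  have 1: "integrable (M \<Otimes>\<^sub>M mixture a M N) g"
    "(\<integral>z. g z \<partial>(M \<Otimes>\<^sub>M mixture a M N)) = (1 - a) * (\<integral>z. g z \<partial>(M \<Otimes>\<^sub>M M)) + a * (\<integral>z. g z \<partial>(M \<Otimes>\<^sub>M N))"
    by (rule integral_linear_of_nn_integral[where a = "1 - a" and b = a, OF _ _ _ _ _ g(1,2)];
      use a in \<open>simp add: s c nn_integral_mixture_right\<close>)+
  have "sets (N \<Otimes>\<^sub>M M) = sets (M \<Otimes>\<^sub>M M)" "sets (N \<Otimes>\<^sub>M M) = sets (N \<Otimes>\<^sub>M N)"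
    by (auto intro!: sets_pair_measure_cong simp: sets_eq)
  note c' = measurable_cong_sets[OF this(1) refl] measurable_cong_sets[OF this(2) refl]
  have 2: "integrable (N \<Otimes>\<^sub>M mixture a M N) g"
    "(\<integral>z. g z \<partial>(N \<Otimes>\<^sub>M mixture a M N)) = (1 - a) * (\<integral>z. g z \<partial>(N \<Otimes>\<^sub>M M)) + a * (\<integral>z. g z \<partial>(N \<Otimes>\<^sub>M N))"
    by (rule integral_linear_of_nn_integral[where a = "1 - a" and b = a, OF _ _ _ _ _ g(3,4)];
      use a in \<open>simp add: s c nn_integral_mixture_right\<close>)+
  have "integrable (mixture a M N \<Otimes>\<^sub>M mixture a M N) g \<and>
    (\<integral>z. g z \<partial>(mixture a M N \<Otimes>\<^sub>M mixture a M N)) =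
      (1 - a) * (\<integral>z. g z \<partial>(M \<Otimes>\<^sub>M mixture a M N)) + a * (\<integral>z. g z \<partial>(N \<Otimes>\<^sub>M mixture a M N))"
    by (rule conjI; rule integral_linear_of_nn_integral[where a = "1 - a" and b = a, OF _ _ _ _ _ 1(1) 2(1)];
      use a in \<open>simp add: s(5,6)[symmetric] c nn_integral_mixture_left[OF P.sigma_finite_measure]\<close>)+
  then show "integrable (mixture a M N \<Otimes>\<^sub>M mixture a M N) g"
    "(\<integral>z. g z \<partial>(mixture a M N \<Otimes>\<^sub>M mixture a M N)) =
      (1 - a) * ((1 - a) * (\<integral>z. g z \<partial>(M \<Otimes>\<^sub>M M)) + a * (\<integral>z. g z \<partial>(M \<Otimes>\<^sub>M N)))
      + a * ((1 - a) * (\<integral>z. g z \<partial>(N \<Otimes>\<^sub>M M)) + a * (\<integral>z. g z \<partial>(N \<Otimes>\<^sub>M N)))"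
    unfolding 1(2) 2(2) by auto
qed

end

text \<open>This identity reduces an integral against a product with a point mass to a single
  integral over \<open>u\<close> with the second argument fixed at \<open>x\<close>, the form in
  which B(\<xi>, \<xi>_x) is used.\<close>

lemma pair_return_right:
  assumes L: "prob_space L" and s: "sets L = sets M" and x: "x \<in> space M"
  shows "L \<Otimes>\<^sub>M return M x = distr L (M \<Otimes>\<^sub>M M) (\<lambda>u. (u, x))"
proof (rule measure_eqI)
  have ss: "sets (L \<Otimes>\<^sub>M return M x) = sets (M \<Otimes>\<^sub>M M)" 
    by (rule sets_pair_measure_cong[OF s sets_return])
  then show "sets (L \<Otimes>\<^sub>M return M x) = sets (distr L (M \<Otimes>\<^sub>M M) (\<lambda>u. (u, x)))"
    by (simp only: sets_distr)
  interpret R: prob_space "return M x" using x by (rule prob_space_return)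
  fix A assume A: "A \<in> sets (L \<Otimes>\<^sub>M return M x)"
  have pm: "(\<lambda>u. (u, x)) \<in> measurable L (M \<Otimes>\<^sub>M M)"
    using x by (intro measurable_Pair measurable_const measurable_ident_sets s)
  have A': "A \<in> sets (M \<Otimes>\<^sub>M M)" using A by (simp only: ss)
  have "emeasure (L \<Otimes>\<^sub>M return M x) A = (\<integral>\<^sup>+ u. emeasure (return M x) (Pair u -` A) \<partial>L)"
    using A by (rule R.emeasure_pair_measure_alt)
  also have "\<dots> = (\<integral>\<^sup>+ u. indicator ((\<lambda>u. (u, x)) -` A \<inter> space L) u \<partial>L)"
    by (intro nn_integral_cong) (simp add: emeasure_return[OF sets_Pair1[OF A']] indicator_def)
  also have "\<dots> = emeasure L ((\<lambda>u. (u, x)) -` A \<inter> space L)"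
    using pm A' by (intro nn_integral_indicator measurable_sets)
  also have "\<dots> = emeasure (distr L (M \<Otimes>\<^sub>M M) (\<lambda>u. (u, x))) A"
    using pm A' by (rule emeasure_distr[symmetric])
  finally show "emeasure (L \<Otimes>\<^sub>M return M x) A = emeasure (distr L (M \<Otimes>\<^sub>M M) (\<lambda>u. (u, x))) A" .
qed

section \<open>Integrability of extended real functions\<close>

lemma ext_integrable_imp_integrable:
  assumes "ext_integrable M h"
  shows "integrable M (\<lambda>z. real_of_ereal (h z))"
proof -
  \<comment> \<open>This holds at every point: \<open>real_of_ereal\<close> sends infinite values to
    0, so no exceptional set has to be removed.\<close>
  have "(\<integral>\<^sup>+ z. ennreal (norm (real_of_ereal (h z))) \<partial>M) \<le> (\<integral>\<^sup>+ z. e2ennreal \<bar>h z\<bar> \<partial>M)"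
  proof (rule nn_integral_mono)
    fix z show "ennreal (norm (real_of_ereal (h z))) \<le> e2ennreal \<bar>h z\<bar>"
      by (cases "h z") auto
  qed
  then show ?thesis
    using assms unfolding ext_integrable_def integrable_iff_bounded by (auto intro: le_less_trans)
qed

text \<open>For \<open>r = 0\<close> both sides vanish even if \<open>y\<close> is infinite, by the
  convention that infinity times zero is zero. A vanishing weight thus hides a singularity of the
  kernel.\<close>

lemma e2ennreal_abs_mult_ereal: "e2ennreal \<bar>y * ereal r\<bar> = e2ennreal \<bar>y\<bar> * ennreal \<bar>r\<bar>"
proof (cases "r = 0")
  case False
  show ?thesis
  proof (cases "\<bar>y\<bar> = \<infinity>")
    case True
    then have "\<bar>y * ereal r\<bar> = \<infinity>" using False by (cases y) auto
    then show ?thesis using True False by (simp add: ennreal_top_mult)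
  next
    case fin: False
    then show ?thesis by (cases y) (auto simp: abs_mult ennreal_mult)
  qed
qed (auto simp: zero_ereal_def[symmetric])

lemma ext_integrable_mult:
  assumes h: "ext_integrable M h" and g[measurable]: "g \<in> borel_measurable M"
    and c: "\<And>z. z \<in> space M \<Longrightarrow> \<bar>g z\<bar> \<le> c"
  shows "ext_integrable M (\<lambda>z. h z * ereal (g z))"
proof -
  have [measurable]: "h \<in> borel_measurable M" using h by (simp add: ext_integrable_def)
  have "(\<integral>\<^sup>+ z. e2ennreal \<bar>h z * ereal (g z)\<bar> \<partial>M) \<le> (\<integral>\<^sup>+ z. e2ennreal \<bar>h z\<bar> * ennreal c \<partial>M)"
    by (intro nn_integral_mono) (auto simp: e2ennreal_abs_mult_ereal intro!: mult_left_mono ennreal_leI c)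
  also have "\<dots> < \<infinity>"
    using h by (simp add: nn_integral_multc ext_integrable_def ennreal_mult_less_top)
  finally show ?thesis by (simp add: ext_integrable_def)
qed

section \<open>Derivatives of matrix functions\<close>

lemma matrix_inv_mult:
  fixes A :: "real ^ 'm ^ 'm"
  assumes "invertible A"
  shows "A ** matrix_inv A = mat 1" "matrix_inv A ** A = mat 1"
  using someI_ex[OF assms[unfolded invertible_def]] unfolding matrix_inv_def by auto

lemma transpose_matrix_inv:
  fixes A :: "real ^ 'm ^ 'm"
  assumes "invertible A" "transpose A = A"
  shows "transpose (matrix_inv A) = matrix_inv A"
proof -
  let ?G = "matrix_inv A"
  have "transpose ?G ** A = mat 1"
    using arg_cong[OF matrix_inv_mult(1)[OF assms(1)], of transpose]
    by (simp add: matrix_transpose_mul assms(2))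
  then have "transpose ?G = transpose ?G ** (A ** ?G)"
    by (simp add: matrix_inv_mult[OF assms(1)])
  also have "\<dots> = ?G"
    using \<open>transpose ?G ** A = mat 1\<close> by (simp add: matrix_mul_assoc)
  finally show ?thesis .
qed

lemma trace_transpose: "trace (transpose A) = trace A"
  by (simp add: trace_def transpose_def)

lemma transpose_add: "transpose (A + B) = transpose A + transpose (B :: real ^ 'm ^ 'n)"
  and transpose_diff: "transpose (A - B) = transpose A - transpose (B :: real ^ 'm ^ 'n)"
  and transpose_scaleR: "transpose (c *\<^sub>R B) = c *\<^sub>R transpose (B :: real ^ 'm ^ 'n)"
  by (simp_all add: transpose_def vec_eq_iff)

lemma bounded_bilinear_matrix_mult: "bounded_bilinear ((**) :: real^'m^'m \<Rightarrow> real^'m^'m \<Rightarrow> real^'m^'m)"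
  unfolding bilinear_conv_bounded_bilinear[symmetric]
  by (auto simp: bilinear_def matrix_matrix_mult_def vec_eq_iff sum.distrib sum_distrib_left algebra_simps
      intro!: linearI)

lemmas matrix_mult_simps =
  bounded_bilinear.add_left[OF bounded_bilinear_matrix_mult]
  bounded_bilinear.add_right[OF bounded_bilinear_matrix_mult]
  bounded_bilinear.diff_left[OF bounded_bilinear_matrix_mult]
  bounded_bilinear.diff_right[OF bounded_bilinear_matrix_mult]
  bounded_bilinear.minus_left[OF bounded_bilinear_matrix_mult]
  bounded_bilinear.minus_right[OF bounded_bilinear_matrix_mult]
  bounded_bilinear.scaleR_left[OF bounded_bilinear_matrix_mult]
  bounded_bilinear.scaleR_right[OF bounded_bilinear_matrix_mult]

lemma tendsto_det:
  fixes A :: "'a \<Rightarrow> real ^ 'm ^ 'm"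
  assumes "(A \<longlongrightarrow> L) F"
  shows "((\<lambda>x. det (A x)) \<longlongrightarrow> det L) F"
  unfolding det_def by (intro tendsto_intros assms)

text \<open>Column \<open>j\<close> of the inverse solves the linear system with right-hand side
  \<open>axis j 1\<close>. By Cramer's rule the entries are quotients of determinants, hence
  continuous where the determinant does not vanish.\<close>

lemma tendsto_matrix_inv:
  fixes A :: "'a \<Rightarrow> real ^ 'm ^ 'm"
  assumes A: "(A \<longlongrightarrow> L) F" and L: "invertible L"
  shows "((\<lambda>x. matrix_inv (A x)) \<longlongrightarrow> matrix_inv L) F"
proof -
  let ?R = "\<lambda>B :: real^'m^'m. \<chi> k j. det (\<chi> i l. if l = k then axis j 1 $ i else B $ i $ l) / det B"
  have inv: "matrix_inv B = ?R B" if "det B \<noteq> 0" for B :: "real^'m^'m"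
  proof -
    have "B *v (matrix_inv B *v axis j 1) = axis j 1" for j
      unfolding matrix_vector_mul_assoc matrix_inv_mult(1)[OF that[folded invertible_det_nz]]
      by (rule matrix_vector_mul_lid)
    then have "matrix_inv B *v axis j 1 = (\<chi> k. det (\<chi> i l. if l = k then axis j 1 $ i else B $ i $ l) / det B)" for j
      by (rule iffD1[OF cramer[OF that]])
    then have col: "column j (matrix_inv B) = (\<chi> k. det (\<chi> i l. if l = k then axis j 1 $ i else B $ i $ l) / det B)" for j
      unfolding matrix_vector_mult_basis .
    show ?thesis
    proof (intro vec_eq_iff[THEN iffD2] allI)
      fix k j
      have "matrix_inv B $ k $ j = column j (matrix_inv B) $ k"
        unfolding column_def vec_lambda_beta ..
      then show "matrix_inv B $ k $ j = ?R B $ k $ j"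
        unfolding col vec_lambda_beta .
    qed
  qed
  have d: "det L \<noteq> 0" using L by (simp add: invertible_det_nz)
  have "\<forall>\<^sub>F x in F. det (A x) \<noteq> 0"
    using tendsto_det[OF A] d by (rule tendsto_imp_eventually_ne)
  then have ev: "\<forall>\<^sub>F x in F. ?R (A x) = matrix_inv (A x)"
    by (rule eventually_mono) (rule inv[symmetric])
  have "((\<lambda>x. ?R (A x)) \<longlongrightarrow> ?R L) F"
  proof (intro vec_tendstoI)
    fix k j
    have "((\<lambda>x. \<chi> i l. if l = k then axis j 1 $ i else A x $ i $ l) \<longlongrightarrow>
        (\<chi> i l. if l = k then axis j 1 $ i else L $ i $ l)) F"
    proof (intro vec_tendstoI)
      fix i l
      have "((\<lambda>x. A x $ i $ l) \<longlongrightarrow> L $ i $ l) F" by (intro tendsto_vec_nth A)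
      then show "((\<lambda>x. (\<chi> i l. if l = k then axis j 1 $ i else A x $ i $ l) $ i $ l) \<longlongrightarrow>
        (\<chi> i l. if l = k then axis j 1 $ i else L $ i $ l) $ i $ l) F"
        by (cases "l = k") simp_all
    qed
    from tendsto_divide[OF tendsto_det[OF this] tendsto_det[OF A] d]
    show "((\<lambda>x. ?R (A x) $ k $ j) \<longlongrightarrow> ?R L $ k $ j) F"
      by (simp only: vec_lambda_beta)
  qed
  from Lim_transform_eventually[OF this ev] show ?thesis
    unfolding inv[OF d] .
qed

text \<open>The resolvent identity G(t) - G(0) = - t G(t) H G(0) makes the remainder of the
  difference quotient exactly (G(0) - G(t)) H G(0), which tends to 0 by continuity of the
  inverse.\<close>

lemma has_vector_derivative_matrix_inv_line:
  fixes M H :: "real ^ 'm ^ 'm"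
  assumes M: "invertible M"
  shows "((\<lambda>t. matrix_inv (M + t *\<^sub>R H)) has_vector_derivative
    - (matrix_inv M ** H ** matrix_inv M)) (at 0 within S)"
proof -
  let ?G = "\<lambda>t. matrix_inv (M + t *\<^sub>R H)"
  have lim: "((\<lambda>t. M + t *\<^sub>R H) \<longlongrightarrow> M) (at 0 within S)"
    by (rule tendsto_eq_intros refl | simp)+
  have G: "(?G \<longlongrightarrow> ?G 0) (at 0 within S)"
    using tendsto_matrix_inv[OF lim M] by simp
  have "((\<lambda>t. (?G 0 - ?G t) ** H ** ?G 0) \<longlongrightarrow> (?G 0 - ?G 0) ** H ** ?G 0) (at 0 within S)"
    by (intro bounded_bilinear.tendsto[OF bounded_bilinear_matrix_mult] tendsto_intros G)
  then have n: "((\<lambda>t. norm ((?G 0 - ?G t) ** H ** ?G 0)) \<longlongrightarrow> 0) (at 0 within S)"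
    by (intro tendsto_norm_zero) (simp add: bounded_bilinear.zero_left[OF bounded_bilinear_matrix_mult])
  have "\<forall>\<^sub>F t in at 0 within S. det (M + t *\<^sub>R H) \<noteq> 0"
    using tendsto_det[OF lim] M by (intro tendsto_imp_eventually_ne) (auto simp: invertible_det_nz)
  moreover have "\<forall>\<^sub>F t in at 0 within S. t \<noteq> 0" by (simp add: eventually_at_filter)
  ultimately have "\<forall>\<^sub>F t in at 0 within S. norm ((?G 0 - ?G t) ** H ** ?G 0) =
     norm ((1 / norm (t - 0)) *\<^sub>R (?G t - (?G 0 + (t - 0) *\<^sub>R - (matrix_inv M ** H ** matrix_inv M))))"
  proof eventually_elim
    case (elim t)
    have inv: "invertible (M + t *\<^sub>R H)" using elim(1) by (simp add: invertible_det_nz)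
    have "?G t = ?G t ** (M ** ?G 0)" using matrix_inv_mult(1)[OF M] by simp
    also have "\<dots> = ?G t ** (M + t *\<^sub>R H) ** ?G 0 - t *\<^sub>R (?G t ** H ** ?G 0)"
      by (simp add: matrix_mult_simps matrix_mul_assoc)
    also have "\<dots> = ?G 0 - t *\<^sub>R (?G t ** H ** ?G 0)"
      using matrix_inv_mult(2)[OF inv] by simp
    finally have e: "?G t = ?G 0 - t *\<^sub>R (?G t ** H ** ?G 0)" .
    have "?G t - ?G 0 = - (t *\<^sub>R (?G t ** H ** ?G 0))"
      by (subst e) simp
    then have "?G t - (?G 0 + t *\<^sub>R - (?G 0 ** H ** ?G 0)) = t *\<^sub>R ((?G 0 - ?G t) ** H ** ?G 0)"
      unfolding diff_diff_add[symmetric] by (simp add: matrix_mult_simps scaleR_diff_right)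
    then show ?case using elim(2) by simp
  qed
  with n have "((\<lambda>t. norm ((1 / norm (t - 0)) *\<^sub>R (?G t - (?G 0 + (t - 0) *\<^sub>R - (matrix_inv M ** H ** matrix_inv M))))) \<longlongrightarrow> 0) (at 0 within S)"
    by (rule Lim_transform_eventually)
  then show ?thesis
    unfolding has_vector_derivative_def has_derivative_within
    by (intro conjI bounded_linear_scaleR_left) (rule tendsto_norm_zero_cancel)
qed

text \<open>The product rule, grouped so that \<open>G ** B 0 ** G\<close> appears as a block; for a
  design this block is the matrix D.\<close>

lemma has_vector_derivative_sandwich:
  fixes M H B0 B1 :: "real ^ 'm ^ 'm"
  assumes M: "invertible M" and B: "(B has_vector_derivative B1) (at 0 within S)"
  defines "G \<equiv> matrix_inv M"
  shows "((\<lambda>t. matrix_inv (M + t *\<^sub>R H) ** B t ** matrix_inv (M + t *\<^sub>R H)) has_vector_derivative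
    G ** B1 ** G - G ** H ** (G ** B 0 ** G) - (G ** B 0 ** G) ** H ** G) (at 0 within S)"
proof -
  note G = has_vector_derivative_matrix_inv_line[OF M, of H S]
  note bb = bounded_bilinear.has_vector_derivative[OF bounded_bilinear_matrix_mult]
  show ?thesis
    by (rule has_vector_derivative_eq_rhs[OF bb[OF bb[OF G B] G]])
       (simp add: G_def matrix_mult_simps matrix_mul_assoc)
qed

text \<open>The derivative only sees symmetric directions. Since both candidates are symmetric,
  their difference \<open>H\<close> is itself such a direction, and testing with it gives trace(H^T
  H) = 0, a vanishing sum of squares. This justifies the definite description in
  \<open>matrix_derivative\<close>.\<close>

lemma has_matrix_derivative_unique:
  assumes C: "has_matrix_derivative \<Phi> C D" and C': "has_matrix_derivative \<Phi> C' D" and D: "D \<in> sym_mats"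
  shows "C = C'"
proof -
  define H where "H = C - C'"
  have H: "transpose H = H" using C C' by (simp add: H_def has_matrix_derivative_def sym_mats_def transpose_diff)
  have line: "((\<lambda>t. D + t *\<^sub>R H) has_vector_derivative H) (at 0 within UNIV)"
    by (auto intro!: derivative_eq_intros)
  have sub: "(\<lambda>t. D + t *\<^sub>R H) ` UNIV \<subseteq> sym_mats"
    using D H by (auto simp: sym_mats_def transpose_add transpose_scaleR)
  have *: "((\<Phi> \<circ> (\<lambda>t. D + t *\<^sub>R H)) has_vector_derivative trace (A ** H)) (at 0)"
    if "has_matrix_derivative \<Phi> A D" for A
  proof -
    have "(\<Phi> has_derivative (\<lambda>H. trace (A ** H))) (at (D + 0 *\<^sub>R H) within (\<lambda>t. D + t *\<^sub>R H) ` UNIV)"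
    proof -
      have "(\<Phi> has_derivative (\<lambda>H. trace (A ** H))) (at D within sym_mats)"
        using that by (simp add: has_matrix_derivative_def)
      from has_derivative_subset[OF this sub] show ?thesis by simp
    qed
    from vector_derivative_diff_chain_within[OF line this] show ?thesis .
  qed
  have "trace (C ** H) = trace (C' ** H)"
    by (rule vector_derivative_unique_at[OF *[OF C] *[OF C']])
  then have "trace (transpose H ** H) = 0"
    by (simp add: H) (simp add: H_def matrix_mult_simps trace_sub)
  then have "(\<Sum>i\<in>UNIV. \<Sum>k\<in>UNIV. (H $ k $ i)\<^sup>2) = 0"
    by (simp add: trace_def transpose_def matrix_matrix_mult_def power2_eq_square)
  then have "H $ k $ i = 0" for k i
    by (simp add: sum_nonneg_eq_0_iff sum_nonneg)
  then have "H = 0" by (simp add: vec_eq_iff)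
  then show ?thesis by (simp add: H_def)
qed

lemma has_matrix_derivative_matrix_derivative:
  assumes "matrix_differentiable \<Phi>" "nonneg_def D"
  shows "has_matrix_derivative \<Phi> (matrix_derivative \<Phi> D) D"
proof -
  obtain C where "has_matrix_derivative \<Phi> C D" using assms by (auto simp: matrix_differentiable_def)
  then show ?thesis
    unfolding matrix_derivative_def using assms(2)
    by (rule_tac theI[of _ C]) (auto intro: has_matrix_derivative_unique simp: nonneg_def_def)
qed

text \<open>The matrix core of the variational argument. \<open>M\<close>, \<open>N\<close>,
  \<open>B0\<close>, \<open>B01\<close>, \<open>B2\<close> stand for M(\<xi>), M(\<nu>),
  B(\<xi>,\<xi>), B(\<xi>,\<nu>), B(\<nu>,\<nu>). The curve \<open>p\<close> of D-matrices starts at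
  the minimizer, so its one-sided derivative \<open>L\<close> satisfies 0 \<le> trace(C L);
  \<open>B2\<close> enters only at order t^2.\<close>

lemma first_order_condition:
  fixes M N B0 B01 B2 :: "real ^ 'm ^ 'm"
  assumes C: "has_matrix_derivative \<Phi> C (matrix_inv M ** B0 ** matrix_inv M)"
    and M: "invertible M" "transpose M = M" and N: "transpose N = N"
    and B0: "transpose B0 = B0"  and B2: "transpose B2 = B2"
    and opt: "\<And>t. 0 \<le> t \<Longrightarrow> t \<le> 1 \<Longrightarrow> invertible (M + t *\<^sub>R (N - M)) \<Longrightarrow>
      \<Phi> (matrix_inv M ** B0 ** matrix_inv M) \<le>
      \<Phi> (matrix_inv (M + t *\<^sub>R (N - M)) **
         ((1 - t)\<^sup>2 *\<^sub>R B0 + (t * (1 - t)) *\<^sub>R (B01 + transpose B01) + t\<^sup>2 *\<^sub>R B2) **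
         matrix_inv (M + t *\<^sub>R (N - M)))"
  shows "trace ((matrix_inv M ** B0 ** matrix_inv M) ** C ** matrix_inv M ** N) \<le>
     trace (C ** matrix_inv M ** B01 ** matrix_inv M)"
proof -
  define G where "G = matrix_inv M"
  define D where "D = G ** B0 ** G"
  define H where "H = N - M"
  define B where "B = (\<lambda>t :: real. (1 - t)\<^sup>2 *\<^sub>R B0 + (t * (1 - t)) *\<^sub>R (B01 + transpose B01) + t\<^sup>2 *\<^sub>R B2)"
  define p where "p = (\<lambda>t. matrix_inv (M + t *\<^sub>R H) ** B t ** matrix_inv (M + t *\<^sub>R H))"
  define L where "L = G ** (B01 + transpose B01 - 2 *\<^sub>R B0) ** G - G ** H ** D - D ** H ** G"
  have GM: "G ** M = mat 1" "M ** G = mat 1" using matrix_inv_mult[OF M(1)] by (auto simp: G_def)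
  have Gt: "transpose G = G" unfolding G_def by (rule transpose_matrix_inv[OF M])
  have Dt: "transpose D = D" by (simp add: D_def matrix_transpose_mul Gt B0 matrix_mul_assoc)
  have Ct: "transpose C = C" using C by (simp add: has_matrix_derivative_def sym_mats_def)
  have lim: "((\<lambda>t. M + t *\<^sub>R H) \<longlongrightarrow> M) (at_right 0)"
    by (rule tendsto_eq_intros refl | simp)+
  have "\<forall>\<^sub>F t in at_right 0. det (M + t *\<^sub>R H) \<noteq> 0"
    using tendsto_det[OF lim] M by (intro tendsto_imp_eventually_ne) (auto simp: invertible_det_nz)
  then obtain e where e: "e > 0" "\<And>t. 0 < t \<Longrightarrow> t < e \<Longrightarrow> det (M + t *\<^sub>R H) \<noteq> 0"
    unfolding eventually_at_right_field by auto
  \<comment> \<open>\<open>e / 2\<close> stays strictly inside the range where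
    \<open>M + t *\<^sub>R H\<close> is invertible, and 1 is the largest admissible weight. The left
    end is 0 because only nonnegative weights give mixtures.\<close>
  define S where "S = {0..min (e / 2) 1}"
  have inv: "invertible (M + t *\<^sub>R H)" if "t \<in> S" for t
    using that e(2)[of t] M(1) by (cases "t = 0") (auto simp: S_def invertible_det_nz)
  have B': "(B has_vector_derivative (B01 + transpose B01 - 2 *\<^sub>R B0)) (at 0 within S)"
    unfolding B_def by (auto intro!: derivative_eq_intros simp: algebra_simps)
  have p': "(p has_vector_derivative L) (at 0 within S)"
    using has_vector_derivative_sandwich[OF M(1) B', of H] unfolding p_def L_def D_def G_def
    by (simp add: B_def)
  have p0: "p 0 = D" by (simp add: p_def D_def B_def G_def)
  have sym: "p ` S \<subseteq> sym_mats"
  proof (clarsimp simp: sym_mats_def)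
    fix t assume t: "t \<in> S"
    have "transpose (M + t *\<^sub>R H) = M + t *\<^sub>R H"
      by (simp add: H_def transpose_add transpose_scaleR transpose_diff M N)
    then have "transpose (matrix_inv (M + t *\<^sub>R H)) = matrix_inv (M + t *\<^sub>R H)"
      by (rule transpose_matrix_inv[OF inv[OF t]])
    moreover have "transpose (B t) = B t"
      by (simp add: B_def transpose_add transpose_scaleR B0 B2 add.commute)
    ultimately show "transpose (p t) = p t"
      by (simp add: p_def matrix_transpose_mul matrix_mul_assoc)
  qed
  have "(\<Phi> has_derivative (\<lambda>H. trace (C ** H))) (at (p 0) within p ` S)"
    using C sym has_derivative_subset unfolding has_matrix_derivative_def p0 D_def G_def by blast
  from vector_derivative_diff_chain_within[OF p' this]
  have "((\<Phi> \<circ> p) has_field_derivative trace (C ** L)) (at 0 within S)"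
    by (simp add: has_real_derivative_iff_has_vector_derivative)
  then have "((\<lambda>t. ((\<Phi> \<circ> p) t - (\<Phi> \<circ> p) 0) / (t - 0)) \<longlongrightarrow> trace (C ** L)) (at 0 within S)"
    by (simp add: has_field_derivative_iff)
  moreover have "\<forall>\<^sub>F t in at 0 within S. 0 \<le> ((\<Phi> \<circ> p) t - (\<Phi> \<circ> p) 0) / (t - 0)"
  proof -
    have "0 \<le> ((\<Phi> \<circ> p) t - (\<Phi> \<circ> p) 0) / (t - 0)" if t: "t \<in> S" for t
    proof -
      have "\<Phi> D \<le> \<Phi> (p t)"
        using opt[of t] inv[OF t] t unfolding p_def D_def G_def B_def H_def by (simp add: S_def)
      then show ?thesis using t p0 by (simp add: S_def)
    qed
    then show ?thesis by (simp add: eventually_at_filter)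
  qed
  moreover have "at 0 within S \<noteq> bot"
    using e(1) by (simp add: S_def at_within_Icc_at_right trivial_limit_at_right_real)
  ultimately have ge: "0 \<le> trace (C ** L)"
    by (rule tendsto_lowerbound)
  \<comment> \<open>Inserting \<open>H = N - M\<close> produces \<open>2 *\<^sub>R D\<close>, which
    cancels the term from \<open>- 2 *\<^sub>R B0\<close>. What remains of \<open>L\<close> is
    \<open>Y\<close> plus its transpose.\<close>
  define Y where "Y = G ** B01 ** G - D ** N ** G"
  have Yt: "transpose Y = G ** transpose B01 ** G - G ** N ** D"
    by (simp add: Y_def transpose_diff matrix_transpose_mul Gt Dt N matrix_mul_assoc)
  have "G ** H ** D = G ** N ** D - D" "D ** H ** G = D ** N ** G - D"
    using GM by (simp_all add: H_def matrix_mult_simps) (simp add: matrix_mul_assoc[symmetric])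
  note GHD = this
  have "L = Y + transpose Y"
    unfolding Yt unfolding L_def Y_def GHD matrix_mult_simps scaleR_2 D_def[symmetric] by simp
  moreover have "trace (C ** transpose Y) = trace (C ** Y)"
    using trace_transpose[of "C ** transpose Y"] trace_mul_sym[of Y C] by (simp add: matrix_transpose_mul Ct)
  ultimately have "0 \<le> trace (C ** Y)"
    using ge by (simp add: matrix_mult_simps trace_add)
  \<comment> \<open>The order of the factors is reversed, so a cyclic shift alone does not suffice:
    the product is first transposed, using that all four factors are symmetric.\<close>
  moreover have "trace (C ** (D ** N ** G)) = trace (D ** C ** G ** N)"
  proof -
    have "trace (C ** (D ** N ** G)) = trace (G ** N ** D ** C)"
      using trace_transpose[of "C ** (D ** N ** G)"]
      by (simp add: matrix_transpose_mul Ct Dt N Gt matrix_mul_assoc)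
    also have "\<dots> = trace (D ** C ** (G ** N))"
      using trace_mul_sym[of "G ** N" "D ** C"] by (simp add: matrix_mul_assoc)
    finally show ?thesis by (simp add: matrix_mul_assoc)
  qed
  ultimately show ?thesis
    unfolding Y_def matrix_mult_simps trace_sub matrix_mul_assoc D_def G_def by simp
qed

section \<open>Kernels and designs\<close>

lemma ext_integrable_bound:
  assumes "ext_integrable M h" "h' \<in> borel_measurable M"
    and "\<And>z. z \<in> space M \<Longrightarrow> e2ennreal \<bar>h' z\<bar> \<le> e2ennreal \<bar>h z\<bar>"
  shows "ext_integrable M h'"
proof -
  have "(\<integral>\<^sup>+ z. e2ennreal \<bar>h' z\<bar> \<partial>M) \<le> (\<integral>\<^sup>+ z. e2ennreal \<bar>h z\<bar> \<partial>M)"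
    by (rule nn_integral_mono[OF assms(3)])
  then show ?thesis using assms(1,2) by (auto simp: ext_integrable_def)
qed

text \<open>If the weights are bounded and the sum of their absolute values is at least
  \<open>\<delta>\<close>, then \<delta> |h| is at most the sum of the |h g_p|. With weights f_i(u)
  f_j(v) this compares existence of the matrix B with existence of the energy of
  \<open>K\<close>.\<close>

lemma ext_integrable_iff_weights:
  fixes g :: "'i \<Rightarrow> 'a \<Rightarrow> real"
  assumes h[measurable]: "h \<in> borel_measurable M" and g[measurable]: "\<And>p. g p \<in> borel_measurable M"
    and c: "\<And>p z. z \<in> space M \<Longrightarrow> \<bar>g p z\<bar> \<le> c"
    and d: "0 < \<delta>" "\<And>z. z \<in> space M \<Longrightarrow> \<delta> \<le> (\<Sum>p\<in>I. \<bar>g p z\<bar>)" and I: "finite I"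
  shows "ext_integrable M h \<longleftrightarrow> (\<forall>p\<in>I. ext_integrable M (\<lambda>z. h z * ereal (g p z)))"
proof
  assume "ext_integrable M h"
  then show "\<forall>p\<in>I. ext_integrable M (\<lambda>z. h z * ereal (g p z))"
    by (intro ballI ext_integrable_mult[where c = c] g c)
next
  assume *: "\<forall>p\<in>I. ext_integrable M (\<lambda>z. h z * ereal (g p z))"
  have "ennreal \<delta> * (\<integral>\<^sup>+ z. e2ennreal \<bar>h z\<bar> \<partial>M) = (\<integral>\<^sup>+ z. e2ennreal \<bar>h z\<bar> * ennreal \<delta> \<partial>M)"
    by (subst nn_integral_multc) (simp_all add: mult.commute)
  also have "\<dots> \<le> (\<integral>\<^sup>+ z. (\<Sum>p\<in>I. e2ennreal \<bar>h z * ereal (g p z)\<bar>) \<partial>M)"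
  proof (rule nn_integral_mono)
    fix z assume "z \<in> space M"
    then have "e2ennreal \<bar>h z\<bar> * ennreal \<delta> \<le> e2ennreal \<bar>h z\<bar> * ennreal (\<Sum>p\<in>I. \<bar>g p z\<bar>)"
      by (intro mult_left_mono ennreal_leI d) auto
    also have "\<dots> = (\<Sum>p\<in>I. e2ennreal \<bar>h z * ereal (g p z)\<bar>)"
      by (simp add: e2ennreal_abs_mult_ereal sum_distrib_left[symmetric] sum_ennreal)
    finally show "e2ennreal \<bar>h z\<bar> * ennreal \<delta> \<le> (\<Sum>p\<in>I. e2ennreal \<bar>h z * ereal (g p z)\<bar>)" .
  qed
  also have "\<dots> = (\<Sum>p\<in>I. \<integral>\<^sup>+ z. e2ennreal \<bar>h z * ereal (g p z)\<bar> \<partial>M)"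
    by (intro nn_integral_sum) measurable
  also have "\<dots> < \<infinity>"
    using * I by (auto simp: ext_integrable_def less_top[symmetric])
  finally have "(\<integral>\<^sup>+ z. e2ennreal \<bar>h z\<bar> \<partial>M) < \<infinity>"
    using d(1) by (auto simp: ennreal_mult_less_top)
  then show "ext_integrable M h" by (simp add: ext_integrable_def)
qed

text \<open>Multiplying each product once more by its weight and summing gives \<open>h\<close>
  times the sum of squares \<open>s\<close>, which is then divided out. The squares are nonnegative,
  so distributivity holds in \<open>ereal\<close> even where \<open>h\<close> is infinite.\<close>

lemma borel_measurable_of_weighted:
  fixes g :: "'i \<Rightarrow> 'a \<Rightarrow> real"
  assumes h: "\<And>p. p \<in> I \<Longrightarrow> (\<lambda>z. h z * ereal (g p z)) \<in> borel_measurable M"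
    and g[measurable]: "\<And>p. g p \<in> borel_measurable M"
    and d: "\<And>z. z \<in> space M \<Longrightarrow> \<exists>p\<in>I. g p z \<noteq> 0" and I: "finite I"
  shows "h \<in> borel_measurable M"
proof -
  define s where "s = (\<lambda>z. \<Sum>p\<in>I. (g p z)\<^sup>2)"
  have [measurable]: "s \<in> borel_measurable M" unfolding s_def by measurable
  have pos: "s z > 0" if "z \<in> space M" for z
    using d[OF that] I unfolding s_def by (auto intro!: sum_pos2)
  have "h z = (\<Sum>p\<in>I. (h z * ereal (g p z)) * ereal (g p z)) * ereal (1 / s z)" if "z \<in> space M" for z
  proof -
    have "(\<Sum>p\<in>I. (h z * ereal (g p z)) * ereal (g p z)) = (\<Sum>p\<in>I. h z * ereal ((g p z)\<^sup>2))"
      by (simp add: mult.assoc power2_eq_square)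
    also have "\<dots> = h z * ereal (s z)"
      by (simp add: s_def sum_ereal_right_distrib[symmetric])
    finally show ?thesis
      using pos[OF that] by (simp add: mult.assoc one_ereal_def[symmetric])
  qed
  moreover have "(\<lambda>z. (\<Sum>p\<in>I. (h z * ereal (g p z)) * ereal (g p z)) * ereal (1 / s z)) \<in> borel_measurable M"
    by (intro borel_measurable_ereal_times borel_measurable_ereal_sum h) measurable
  ultimately show ?thesis
    by (subst measurable_cong) auto
qed

section \<open>Designs as Borel probability measures on X\<close>

lemma sets_design: "\<xi> \<in> designs X \<Longrightarrow> sets \<xi> = sets (restrict_space borel X)"
  and prob_space_design: "\<xi> \<in> designs X \<Longrightarrow> prob_space \<xi>"
  by (auto simp: designs_def)

lemma space_design: "\<xi> \<in> designs X \<Longrightarrow> space \<xi> = X"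
  using sets_eq_imp_space_eq[OF sets_design, of \<xi> X] by (simp add: space_restrict_space)

lemma sets_pair_design:
  "\<mu> \<in> designs X \<Longrightarrow> \<nu> \<in> designs X \<Longrightarrow>
    sets (\<mu> \<Otimes>\<^sub>M \<nu>) = sets (restrict_space borel X \<Otimes>\<^sub>M restrict_space borel X)"
  by (intro sets_pair_measure_cong sets_design)

lemma measurable_design: "\<xi> \<in> designs X \<Longrightarrow> measurable \<xi> N = measurable (restrict_space borel X) N"
  by (intro measurable_cong_sets sets_design refl)

lemma measurable_pair_design:
  "\<mu> \<in> designs X \<Longrightarrow> \<nu> \<in> designs X \<Longrightarrow>
    measurable (\<mu> \<Otimes>\<^sub>M \<nu>) N = measurable (restrict_space borel X \<Otimes>\<^sub>M restrict_space borel X) N"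
  by (intro measurable_cong_sets sets_pair_design refl)

lemma space_pair_design: "\<mu> \<in> designs X \<Longrightarrow> \<nu> \<in> designs X \<Longrightarrow> space (\<mu> \<Otimes>\<^sub>M \<nu>) = X \<times> X"
  by (simp add: space_pair_measure space_design)

lemma pair_sigma_finite_design:
  "\<mu> \<in> designs X \<Longrightarrow> \<nu> \<in> designs X \<Longrightarrow> pair_sigma_finite \<mu> \<nu>"
  by (simp add: pair_sigma_finite_def prob_space_design prob_space_imp_sigma_finite)

lemma point_design_in: "x \<in> X \<Longrightarrow> point_design X x \<in> designs X"
  by (simp add: designs_def point_design_def prob_space_return space_restrict_space)

lemma mixture_in_designs:
  "\<mu> \<in> designs X \<Longrightarrow> \<nu> \<in> designs X \<Longrightarrow> 0 \<le> a \<Longrightarrow> a \<le> 1 \<Longrightarrow> mixture a \<mu> \<nu> \<in> designs X"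
  by (simp add: designs_def sets_mixture prob_space_mixture)

text \<open>Continuity off the diagonal does not control the map from \<open>u\<close> to
  \<open>K u u\<close>, so joint measurability is a separate condition here. In the main theorem it
  is extracted from the existence of B(\<xi>,\<xi>).\<close>

locale measurable_kernel =
  fixes X :: "(real ^ 'd) set" and K :: "real ^ 'd \<Rightarrow> real ^ 'd \<Rightarrow> ereal"
  assumes K_sym: "\<And>u v. u \<in> X \<Longrightarrow> v \<in> X \<Longrightarrow> K u v = K v u"
    and K_meas: "(\<lambda>(u, v). K u v) \<in> borel_measurable (restrict_space borel X \<Otimes>\<^sub>M restrict_space borel X)"
begin

lemma K_meas_design:
  "\<mu> \<in> designs X \<Longrightarrow> \<nu> \<in> designs X \<Longrightarrow> (\<lambda>(u, v). K u v) \<in> borel_measurable (\<mu> \<Otimes>\<^sub>M \<nu>)"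
  using K_meas by (simp add: measurable_pair_design)

lemma K_meas_section:
  "\<mu> \<in> designs X \<Longrightarrow> x \<in> X \<Longrightarrow> (\<lambda>u. K u x) \<in> borel_measurable \<mu>"
  using measurable_Pair1[OF K_meas, of x] by (simp add: measurable_design space_restrict_space)

lemma double_integrable_iff:
  assumes "\<mu> \<in> designs X" "\<nu> \<in> designs X"
  shows "double_integrable K \<mu> \<nu> \<longleftrightarrow> (\<integral>\<^sup>+ u. \<integral>\<^sup>+ v. e2ennreal \<bar>K u v\<bar> \<partial>\<nu> \<partial>\<mu>) < \<infinity>"
proof -
  interpret pair_sigma_finite \<mu> \<nu> using assms by (rule pair_sigma_finite_design)
  note [measurable] = K_meas_design[OF assms]
  have "(\<integral>\<^sup>+ u. \<integral>\<^sup>+ v. e2ennreal \<bar>K u v\<bar> \<partial>\<nu> \<partial>\<mu>) = (\<integral>\<^sup>+ z. e2ennreal \<bar>(\<lambda>(u, v). K u v) z\<bar> \<partial>(\<mu> \<Otimes>\<^sub>M \<nu>))"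
    by (subst M2.nn_integral_fst[symmetric]) auto
  then show ?thesis by (simp add: double_integrable_def ext_integrable_def)
qed

lemma double_integrable_commute:
  assumes "\<mu> \<in> designs X" "\<nu> \<in> designs X"
  shows "double_integrable K \<mu> \<nu> \<longleftrightarrow> double_integrable K \<nu> \<mu>"
proof -
  interpret pair_sigma_finite \<mu> \<nu> using assms by (rule pair_sigma_finite_design)
  note [measurable] = K_meas_design[OF assms]
  have "(\<integral>\<^sup>+ u. \<integral>\<^sup>+ v. e2ennreal \<bar>K u v\<bar> \<partial>\<nu> \<partial>\<mu>) = (\<integral>\<^sup>+ v. \<integral>\<^sup>+ u. e2ennreal \<bar>K u v\<bar> \<partial>\<mu> \<partial>\<nu>)"
    by (rule Fubini'[symmetric]) measurable
  also have "\<dots> = (\<integral>\<^sup>+ v. \<integral>\<^sup>+ u. e2ennreal \<bar>K v u\<bar> \<partial>\<mu> \<partial>\<nu>)"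
    by (intro nn_integral_cong) (simp add: K_sym space_design[OF assms(1)] space_design[OF assms(2)])
  finally show ?thesis by (simp add: double_integrable_iff assms)
qed

lemma double_integrable_mixture:
  assumes "\<mu> \<in> designs X" "\<nu> \<in> designs X" "0 \<le> a" "a \<le> 1"
    and "double_integrable K \<mu> \<mu>" "double_integrable K \<mu> \<nu>" "double_integrable K \<nu> \<nu>"
  shows "double_integrable K (mixture a \<mu> \<nu>) (mixture a \<mu> \<nu>)"
proof -
  have m: "(\<lambda>z. e2ennreal \<bar>(\<lambda>(u, v). K u v) z\<bar>) \<in> borel_measurable (\<mu> \<Otimes>\<^sub>M \<mu>)"
    using K_meas_design[OF assms(1,1)] by measurable
  have "double_integrable K \<nu> \<mu>" using double_integrable_commute assms by blast
  with assms(5-7) show ?thesis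
    unfolding double_integrable_def ext_integrable_def
    using nn_integral_mixture_square[OF prob_space_design[OF assms(1)] prob_space_design[OF assms(2)] _ assms(3,4) m]
      K_meas_design[OF mixture_in_designs mixture_in_designs, OF assms(1-4) assms(1-4)]
    by (simp add: sets_design[OF assms(1)] sets_design[OF assms(2)] ennreal_mult_less_top)
qed

text \<open>Moves bounded nonnegative weights from the integrand into the measures, which brings a
  weighted energy into the form that \<open>kernel_pos_def\<close> speaks about.\<close>

lemma double_density:
  fixes p q :: "real ^ 'd \<Rightarrow> real"
  assumes \<mu>: "\<mu> \<in> designs X" and \<nu>: "\<nu> \<in> designs X"
    and p: "p \<in> borel_measurable (restrict_space borel X)" "\<And>u. 0 \<le> p u" "\<And>u. u \<in> X \<Longrightarrow> p u \<le> c"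
    and q: "q \<in> borel_measurable (restrict_space borel X)" "\<And>u. 0 \<le> q u" "\<And>u. u \<in> X \<Longrightarrow> q u \<le> c"
    and i: "ext_integrable (\<mu> \<Otimes>\<^sub>M \<nu>) (\<lambda>(u, v). K u v * ereal (p u * q v))"
  shows "finite_borel_on X (density \<mu> p)"
    and "double_integrable K (density \<mu> p) (density \<nu> q)"
    and "double_integral K (density \<mu> p) (density \<nu> q) =
      (\<integral>(u, v). real_of_ereal (K u v) * (p u * q v) \<partial>(\<mu> \<Otimes>\<^sub>M \<nu>))"
proof -
  interpret pair_sigma_finite \<mu> \<nu> using \<mu> \<nu> by (rule pair_sigma_finite_design)
  have fin: "finite_measure (density \<eta> r)"
    if \<eta>: "\<eta> \<in> designs X" and r: "r \<in> borel_measurable (restrict_space borel X)"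
      "\<And>u. u \<in> X \<Longrightarrow> r u \<le> c" for r :: "real ^ 'd \<Rightarrow> real" and \<eta>
  proof
    interpret prob_space \<eta> using \<eta> by (rule prob_space_design)
    have [measurable]: "r \<in> borel_measurable \<eta>" using r \<eta> by (simp add: measurable_design)
    have "emeasure (density \<eta> r) (space (density \<eta> r)) = (\<integral>\<^sup>+ u. ennreal (r u) * indicator (space \<eta>) u \<partial>\<eta>)"
      by (simp add: emeasure_density)
    also have "\<dots> \<le> (\<integral>\<^sup>+ u. ennreal c \<partial>\<eta>)"
      by (intro nn_integral_mono) (auto simp: space_design[OF \<eta>] indicator_def intro!: ennreal_leI r)
    also have "\<dots> = ennreal c" by (simp add: emeasure_space_1)
    also have "\<dots> < \<infinity>" by simp
    finally show "emeasure (density \<eta> r) (space (density \<eta> r)) \<noteq> \<infinity>" by simp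
  qed
  show "finite_borel_on X (density \<mu> p)"
    using fin[OF \<mu> p(1,3)] by (simp add: finite_borel_on_def sets_design[OF \<mu>])
  have pm[measurable]: "p \<in> borel_measurable \<mu>" "q \<in> borel_measurable \<nu>"
    using p q \<mu> \<nu> by (simp_all add: measurable_design)
  note [measurable] = K_meas_design[OF \<mu> \<nu>]
  define w where "w = (\<lambda>z. p (fst z) * q (snd z))"
  have [measurable]: "w \<in> borel_measurable (\<mu> \<Otimes>\<^sub>M \<nu>)" unfolding w_def by measurable
  have "density \<mu> p \<Otimes>\<^sub>M density \<nu> q = density (\<mu> \<Otimes>\<^sub>M \<nu>) (\<lambda>(x, y). ennreal (p x) * ennreal (q y))"
    using finite_measure.axioms(1)[OF fin[OF \<nu> q(1,3)]] M2.sigma_finite_measure_axioms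
    by (intro pair_measure_density) auto
  then have pd: "density \<mu> p \<Otimes>\<^sub>M density \<nu> q = density (\<mu> \<Otimes>\<^sub>M \<nu>) (\<lambda>z. ennreal (w z))"
    by (simp add: w_def split_beta' ennreal_mult p(2) q(2))
  have w0: "0 \<le> w z" for z by (simp add: w_def p(2) q(2))
  have "(\<integral>\<^sup>+ z. e2ennreal \<bar>(\<lambda>(u, v). K u v) z\<bar> \<partial>(density \<mu> p \<Otimes>\<^sub>M density \<nu> q)) =
    (\<integral>\<^sup>+ z. ennreal (w z) * e2ennreal \<bar>(\<lambda>(u, v). K u v) z\<bar> \<partial>(\<mu> \<Otimes>\<^sub>M \<nu>))"
    unfolding pd by (intro nn_integral_density) measurable
  also have "\<dots> = (\<integral>\<^sup>+ z. e2ennreal \<bar>(\<lambda>(u, v). K u v * ereal (p u * q v)) z\<bar> \<partial>(\<mu> \<Otimes>\<^sub>M \<nu>))"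
    using w0 by (intro nn_integral_cong) (auto simp: e2ennreal_abs_mult_ereal w_def mult.commute p(2) q(2))
  also have "\<dots> < \<infinity>" using i by (simp add: ext_integrable_def)
  finally show "double_integrable K (density \<mu> p) (density \<nu> q)"
    by (simp add: double_integrable_def ext_integrable_def pd)
  have "double_integral K (density \<mu> p) (density \<nu> q) =
      (\<integral>z. w z *\<^sub>R real_of_ereal ((\<lambda>(u, v). K u v) z) \<partial>(\<mu> \<Otimes>\<^sub>M \<nu>))"
    unfolding double_integral_def ext_integral_def pd
    by (intro integral_density) (auto simp: w0)
  then show "double_integral K (density \<mu> p) (density \<nu> q) =
      (\<integral>(u, v). real_of_ereal (K u v) * (p u * q v) \<partial>(\<mu> \<Otimes>\<^sub>M \<nu>))"
    by (simp add: w_def split_beta' mult_ac)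
qed

text \<open>Positive definiteness for the signed measure with density \<open>g\<close>, split into
  the positive part \<open>p\<close> and the negative part \<open>n\<close>. Both are at most |g|,
  so integrability of \<open>K\<close> times the weights carries over to all four terms. Only the
  weighted kernel is required to be integrable, which is what allows a truncated \<open>g\<close>
  later.\<close>

lemma pos_def_weighted:
  fixes g :: "real ^ 'd \<Rightarrow> real"
  assumes pd: "kernel_pos_def X K" and \<eta>: "\<eta> \<in> designs X"
    and g: "g \<in> borel_measurable (restrict_space borel X)" "\<And>u. u \<in> X \<Longrightarrow> \<bar>g u\<bar> \<le> c"
    and i: "ext_integrable (\<eta> \<Otimes>\<^sub>M \<eta>) (\<lambda>(u, v). K u v * ereal (g u * g v))"
  shows "0 \<le> (\<integral>(u, v). real_of_ereal (K u v) * (g u * g v) \<partial>(\<eta> \<Otimes>\<^sub>M \<eta>))"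
proof -
  define p where "p = (\<lambda>u. max 0 (g u))"
  define n where "n = (\<lambda>u. max 0 (- g u))"
  note [measurable] = K_meas_design[OF \<eta> \<eta>]
  have [measurable]: "g \<in> borel_measurable \<eta>" using g \<eta> by (simp add: measurable_design)
  have pm[measurable]: "p \<in> borel_measurable (restrict_space borel X)" "n \<in> borel_measurable (restrict_space borel X)"
    "p \<in> borel_measurable \<eta>" "n \<in> borel_measurable \<eta>"
    using g(1) unfolding p_def n_def by (auto intro: borel_measurable_max)
  have nn: "0 \<le> p u" "0 \<le> n u" "p u \<le> \<bar>g u\<bar>" "n u \<le> \<bar>g u\<bar>" for u by (auto simp: p_def n_def)
  have b: "p u \<le> c" "n u \<le> c" if "u \<in> X" for u using nn[of u] g(2)[OF that] by auto
  have ei: "ext_integrable (\<eta> \<Otimes>\<^sub>M \<eta>) (\<lambda>(u, v). K u v * ereal (r u * s v))"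
    if [measurable]: "r \<in> borel_measurable \<eta>" "s \<in> borel_measurable \<eta>"
      and le: "\<And>u. 0 \<le> r u \<and> r u \<le> \<bar>g u\<bar>" "\<And>u. 0 \<le> s u \<and> s u \<le> \<bar>g u\<bar>" for r s
  proof (rule ext_integrable_bound[OF i])
    show "(\<lambda>(u, v). K u v * ereal (r u * s v)) \<in> borel_measurable (\<eta> \<Otimes>\<^sub>M \<eta>)" by measurable
    fix z
    have "\<bar>r u * s v\<bar> \<le> \<bar>g u * g v\<bar>" for u v
      using le[of u] le[of v] by (auto simp: abs_mult intro!: mult_mono)
    then show "e2ennreal \<bar>(\<lambda>(u, v). K u v * ereal (r u * s v)) z\<bar> \<le> e2ennreal \<bar>(\<lambda>(u, v). K u v * ereal (g u * g v)) z\<bar>"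
      by (auto simp: e2ennreal_abs_mult_ereal split: prod.split intro!: mult_left_mono ennreal_leI)
  qed
  have eis: "ext_integrable (\<eta> \<Otimes>\<^sub>M \<eta>) (\<lambda>(u, v). K u v * ereal (p u * p v))"
    "ext_integrable (\<eta> \<Otimes>\<^sub>M \<eta>) (\<lambda>(u, v). K u v * ereal (p u * n v))"
    "ext_integrable (\<eta> \<Otimes>\<^sub>M \<eta>) (\<lambda>(u, v). K u v * ereal (n u * p v))"
    "ext_integrable (\<eta> \<Otimes>\<^sub>M \<eta>) (\<lambda>(u, v). K u v * ereal (n u * n v))"
    by (intro ei conjI pm nn)+
  note d1 = double_density[OF \<eta> \<eta> pm(1) nn(1) b(1) pm(1) nn(1) b(1) eis(1)]
  note d2 = double_density[OF \<eta> \<eta> pm(1) nn(1) b(1) pm(2) nn(2) b(2) eis(2)]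
  note d3 = double_density[OF \<eta> \<eta> pm(2) nn(2) b(2) pm(1) nn(1) b(1) eis(3)]
  note d4 = double_density[OF \<eta> \<eta> pm(2) nn(2) b(2) pm(2) nn(2) b(2) eis(4)]
  have int: "integrable (\<eta> \<Otimes>\<^sub>M \<eta>) (\<lambda>(u, v). real_of_ereal (K u v) * (r u * s v))"
    if "ext_integrable (\<eta> \<Otimes>\<^sub>M \<eta>) (\<lambda>(u, v). K u v * ereal (r u * s v))" for r s
    using ext_integrable_imp_integrable[OF that] by (simp add: split_beta')
  note ints = eis[THEN int]
  have "0 \<le> double_integral K (density \<eta> p) (density \<eta> p) - double_integral K (density \<eta> p) (density \<eta> n)
    - double_integral K (density \<eta> n) (density \<eta> p) + double_integral K (density \<eta> n) (density \<eta> n)"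
    using pd d1 d2 d3 d4 unfolding kernel_pos_def_def by blast
  also have "\<dots> = (\<integral>z. (\<lambda>(u, v). real_of_ereal (K u v) * (p u * p v)) z - (\<lambda>(u, v). real_of_ereal (K u v) * (p u * n v)) z
     - (\<lambda>(u, v). real_of_ereal (K u v) * (n u * p v)) z + (\<lambda>(u, v). real_of_ereal (K u v) * (n u * n v)) z \<partial>(\<eta> \<Otimes>\<^sub>M \<eta>))"
    by (simp only: d1(3) d2(3) d3(3) d4(3) Bochner_Integration.integral_add Bochner_Integration.integral_diff ints
        Bochner_Integration.integrable_diff Bochner_Integration.integrable_add)
  also have "\<dots> = (\<integral>(u, v). real_of_ereal (K u v) * (g u * g v) \<partial>(\<eta> \<Otimes>\<^sub>M \<eta>))"
  proof (rule Bochner_Integration.integral_cong[OF refl])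
    fix z
    have g: "g = (\<lambda>u. p u - n u)" by (auto simp: p_def n_def)
    show "(\<lambda>(u, v). real_of_ereal (K u v) * (p u * p v)) z - (\<lambda>(u, v). real_of_ereal (K u v) * (p u * n v)) z
     - (\<lambda>(u, v). real_of_ereal (K u v) * (n u * p v)) z + (\<lambda>(u, v). real_of_ereal (K u v) * (n u * n v)) z
      = (\<lambda>(u, v). real_of_ereal (K u v) * (g u * g v)) z"
      unfolding g by (simp add: split_beta' algebra_simps)
  qed
  finally show ?thesis .
qed

end

section \<open>Information matrices\<close>

locale regression_kernel = measurable_kernel X K
  for X :: "(real ^ 'd) set" and K :: "real ^ 'd \<Rightarrow> real ^ 'd \<Rightarrow> ereal" +
  fixes f :: "real ^ 'd \<Rightarrow> real ^ 'm"
  assumes compact_X: "compact X"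
    and cont_f: "\<And>i. continuous_on X (\<lambda>x. f x $ i)"
    and f_nz: "\<And>x. x \<in> X \<Longrightarrow> f x \<noteq> 0"
begin

lemma f_meas: "(\<lambda>x. f x $ i) \<in> borel_measurable (restrict_space borel X)"
  by (rule borel_measurable_continuous_on_restrict[OF cont_f])

lemma f_meas_design: "\<xi> \<in> designs X \<Longrightarrow> (\<lambda>x. f x $ i) \<in> borel_measurable \<xi>"
  by (simp add: measurable_design f_meas)

lemma continuous_f: "continuous_on X f"
  using continuous_on_vec_lambda[of X "\<lambda>i x. f x $ i", OF cont_f] by simp

lemma f_bound:
  obtains c where "0 < c" "\<And>x i. x \<in> X \<Longrightarrow> \<bar>f x $ i\<bar> \<le> c"
proof -
  have "bounded (f ` X)"
    by (intro compact_imp_bounded compact_continuous_image continuous_f compact_X)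
  then obtain c where c: "0 < c" "\<And>y. y \<in> f ` X \<Longrightarrow> norm y \<le> c"
    using bounded_pos by metis
  then show ?thesis
    using that[of c] component_le_norm_cart order_trans by (metis imageI)
qed

text \<open>The quantitative form of f(x) \<noteq> 0: a continuous function without zeros on a
  compact set is bounded away from zero.\<close>

lemma f_lower:
  obtains d where "0 < d" "\<And>x. x \<in> X \<Longrightarrow> d \<le> norm (f x)"
proof (cases "X = {}")
  case True
  then show ?thesis using that[of 1] by simp
next
  case False
  have "continuous_on X (\<lambda>x. norm (f x))" by (intro continuous_intros continuous_f)
  then obtain y where "y \<in> X" "\<And>x. x \<in> X \<Longrightarrow> norm (f y) \<le> norm (f x)"
    using continuous_attains_inf[OF compact_X False] by metis
  then show ?thesis using that[of "norm (f y)"] f_nz[of y] by simp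
qed

text \<open>The weights f_i(u) f_j(v) are bounded by \<open>c * c\<close>, and the sum of their
  absolute values is the product of the l1 norms of f(u) and f(v), hence at least
  \<open>d * d\<close>. Existence of B thus depends on the energy of the kernel alone.\<close>

lemma B_exists_iff:
  assumes \<mu>: "\<mu> \<in> designs X" and \<nu>: "\<nu> \<in> designs X"
  shows "B_exists K f \<mu> \<nu> \<longleftrightarrow> double_integrable K \<mu> \<nu>"
proof -
  obtain c where c: "0 < c" "\<And>x i. x \<in> X \<Longrightarrow> \<bar>f x $ i\<bar> \<le> c" using f_bound by blast
  obtain d where d: "0 < d" "\<And>x. x \<in> X \<Longrightarrow> d \<le> norm (f x)" using f_lower by blast
  define g where "g = (\<lambda>(p :: 'm \<times> 'm) z. f (fst z) $ fst p * f (snd z) $ snd p)"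
  note [measurable] = f_meas_design[OF \<mu>] f_meas_design[OF \<nu>]
  have "double_integrable K \<mu> \<nu> \<longleftrightarrow>
    (\<forall>p\<in>UNIV. ext_integrable (\<mu> \<Otimes>\<^sub>M \<nu>) (\<lambda>z. (\<lambda>(u, v). K u v) z * ereal (g p z)))"
    unfolding double_integrable_def
  proof (rule ext_integrable_iff_weights[OF K_meas_design[OF \<mu> \<nu>]])
    show "g p \<in> borel_measurable (\<mu> \<Otimes>\<^sub>M \<nu>)" for p unfolding g_def by measurable
    show "\<bar>g p z\<bar> \<le> c * c" if "z \<in> space (\<mu> \<Otimes>\<^sub>M \<nu>)" for p z
      using that c unfolding space_pair_design[OF \<mu> \<nu>] g_def by (auto simp: abs_mult intro!: mult_mono)
    show "0 < d * d" using d by simp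
    show "d * d \<le> (\<Sum>p\<in>UNIV. \<bar>g p z\<bar>)" if "z \<in> space (\<mu> \<Otimes>\<^sub>M \<nu>)" for z
    proof -
      have z: "fst z \<in> X" "snd z \<in> X" using that unfolding space_pair_design[OF \<mu> \<nu>] by auto
      have l1: "d \<le> (\<Sum>i\<in>UNIV. \<bar>f x $ i\<bar>)" if "x \<in> X" for x
        using d(2)[OF that] norm_le_l1_cart[of "f x"] by linarith
      have "d * d \<le> (\<Sum>i\<in>UNIV. \<bar>f (fst z) $ i\<bar>) * (\<Sum>j\<in>UNIV. \<bar>f (snd z) $ j\<bar>)"
        using d(1) by (intro mult_mono l1 z sum_nonneg) auto
      also have "\<dots> = (\<Sum>p\<in>UNIV \<times> UNIV. \<bar>g p z\<bar>)"
        unfolding sum_product sum.cartesian_product g_def by (simp add: abs_mult split_beta')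
      finally show ?thesis by simp
    qed
  qed simp
  then show ?thesis
    by (simp add: B_exists_def double_integrable_def g_def split_beta')
qed

lemma kernel_weight_integrable:
  assumes \<mu>: "\<mu> \<in> designs X" and \<nu>: "\<nu> \<in> designs X" and K: "double_integrable K \<mu> \<nu>"
  shows "integrable (\<mu> \<Otimes>\<^sub>M \<nu>) (\<lambda>(u, v). real_of_ereal (K u v) * (f u $ i * f v $ j))"
proof -
  have "ext_integrable (\<mu> \<Otimes>\<^sub>M \<nu>) (\<lambda>(u, v). K u v * ereal (f u $ i * f v $ j))"
    using K B_exists_iff[OF \<mu> \<nu>] by (simp add: B_exists_def double_integrable_def)
  from ext_integrable_imp_integrable[OF this] show ?thesis by (simp add: split_beta')
qed

lemma B_mat_entry:
  "B_mat K f \<mu> \<nu> $ i $ j = (\<integral>(u, v). real_of_ereal (K u v) * (f u $ i * f v $ j) \<partial>(\<mu> \<Otimes>\<^sub>M \<nu>))"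
  by (simp add: B_mat_def double_integral_def ext_integral_def split_beta')

lemma B_mat_transpose:
  assumes \<mu>: "\<mu> \<in> designs X" and \<nu>: "\<nu> \<in> designs X"
  shows "B_mat K f \<nu> \<mu> = transpose (B_mat K f \<mu> \<nu>)"
proof -
  interpret pair_sigma_finite \<mu> \<nu> using \<mu> \<nu> by (rule pair_sigma_finite_design)
  note [measurable] = K_meas_design[OF \<mu> \<nu>] f_meas_design[OF \<mu>] f_meas_design[OF \<nu>]
  have "B_mat K f \<nu> \<mu> $ j $ i = B_mat K f \<mu> \<nu> $ i $ j" for i j
  proof -
    have "B_mat K f \<mu> \<nu> $ i $ j =
      (\<integral>(v, u). (\<lambda>(u, v). real_of_ereal (K u v) * (f u $ i * f v $ j)) (u, v) \<partial>(\<nu> \<Otimes>\<^sub>M \<mu>))"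
      unfolding B_mat_entry by (rule integral_product_swap[symmetric]) measurable
    also have "\<dots> = B_mat K f \<nu> \<mu> $ j $ i"
      unfolding B_mat_entry
      by (rule Bochner_Integration.integral_cong)
         (auto simp: space_pair_design[OF \<nu> \<mu>] K_sym mult.commute)
    finally show ?thesis by simp
  qed
  then show ?thesis by (simp add: transpose_def vec_eq_iff)
qed

lemma M_integrable:
  assumes \<xi>: "\<xi> \<in> designs X"
  shows "integrable \<xi> (\<lambda>u. f u $ i * f u $ j)"
proof -
  interpret prob_space \<xi> using \<xi> by (rule prob_space_design)
  obtain c where c: "0 < c" "\<And>x i. x \<in> X \<Longrightarrow> \<bar>f x $ i\<bar> \<le> c" using f_bound by blast
  note [measurable] = f_meas_design[OF \<xi>]
  show ?thesis
    by (rule integrable_const_bound[of _ "c * c"])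
       (auto simp: abs_mult space_design[OF \<xi>] intro!: AE_I2 mult_mono c order_less_imp_le[OF c(1)])
qed

lemma M_mat_transpose: "transpose (M_mat f \<xi>) = M_mat f \<xi>"
  by (simp add: M_mat_def transpose_def vec_eq_iff mult.commute)

lemma M_mat_mixture:
  assumes "\<mu> \<in> designs X" "\<nu> \<in> designs X" "0 \<le> a" "a \<le> 1"
  shows "M_mat f (mixture a \<mu> \<nu>) = M_mat f \<mu> + a *\<^sub>R (M_mat f \<nu> - M_mat f \<mu>)"
  using integral_mixture(2)[OF prob_space_design prob_space_design _ assms(3,4) M_integrable M_integrable,
      OF assms(1,2) _ assms(1,2)] sets_design[OF assms(1)] sets_design[OF assms(2)]
  by (simp add: M_mat_def vec_eq_iff algebra_simps)

lemma B_mat_mixture: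
  assumes "\<mu> \<in> designs X" "\<nu> \<in> designs X" "0 \<le> a" "a \<le> 1"
    and "double_integrable K \<mu> \<mu>" "double_integrable K \<mu> \<nu>" "double_integrable K \<nu> \<nu>"
  shows "B_mat K f (mixture a \<mu> \<nu>) (mixture a \<mu> \<nu>) = (1 - a)\<^sup>2 *\<^sub>R B_mat K f \<mu> \<mu>
    + (a * (1 - a)) *\<^sub>R (B_mat K f \<mu> \<nu> + transpose (B_mat K f \<mu> \<nu>)) + a\<^sup>2 *\<^sub>R B_mat K f \<nu> \<nu>"
proof -
  have d: "double_integrable K \<nu> \<mu>" using double_integrable_commute assms by blast
  have s: "sets \<nu> = sets \<mu>" using sets_design assms(1,2) by metis
  have "B_mat K f (mixture a \<mu> \<nu>) (mixture a \<mu> \<nu>) $ i $ j =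
      (1 - a) * ((1 - a) * B_mat K f \<mu> \<mu> $ i $ j + a * B_mat K f \<mu> \<nu> $ i $ j)
      + a * ((1 - a) * B_mat K f \<nu> \<mu> $ i $ j + a * B_mat K f \<nu> \<nu> $ i $ j)" for i j
    unfolding B_mat_entry
    by (rule integral_mixture_square(2)[OF prob_space_design[OF assms(1)] prob_space_design[OF assms(2)] s assms(3,4)];
        rule kernel_weight_integrable; fact assms d)
  then show ?thesis
    unfolding B_mat_transpose[OF assms(1,2), symmetric]
    by (simp add: vec_eq_iff power2_eq_square algebra_simps)
qed

text \<open>With \<open>g\<close> the scalar function z^T f, the quadratic form at \<open>z\<close>
  is the energy of the signed measure with density \<open>g\<close>.\<close>

lemma B_mat_nonneg:
  assumes pd: "kernel_pos_def X K" and \<xi>: "\<xi> \<in> designs X" and K: "double_integrable K \<xi> \<xi>"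
  shows "0 \<le> z \<bullet> (B_mat K f \<xi> \<xi> *v z)"
proof -
  obtain c where c: "0 < c" "\<And>x i. x \<in> X \<Longrightarrow> \<bar>f x $ i\<bar> \<le> c" using f_bound by blast
  define g where "g = (\<lambda>u. \<Sum>i\<in>UNIV. z $ i * f u $ i)"
  note fm[measurable] = f_meas
  have gm: "g \<in> borel_measurable (restrict_space borel X)" unfolding g_def by measurable
  define b where "b = (\<Sum>i\<in>UNIV. \<bar>z $ i\<bar> * c)"
  have gb: "\<bar>g u\<bar> \<le> b" if "u \<in> X" for u
    unfolding g_def b_def
    by (rule order_trans[OF sum_abs]) (auto simp: abs_mult intro!: sum_mono mult_left_mono c that)
  have "ext_integrable (\<xi> \<Otimes>\<^sub>M \<xi>) (\<lambda>w. (\<lambda>(u, v). K u v) w * ereal (g (fst w) * g (snd w)))"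
  proof (rule ext_integrable_mult)
    show "ext_integrable (\<xi> \<Otimes>\<^sub>M \<xi>) (\<lambda>(u, v). K u v)" using K by (simp add: double_integrable_def)
    have [measurable]: "g \<in> borel_measurable \<xi>" using gm by (simp add: measurable_design[OF \<xi>])
    show "(\<lambda>w. g (fst w) * g (snd w)) \<in> borel_measurable (\<xi> \<Otimes>\<^sub>M \<xi>)" by measurable
    show "\<bar>g (fst w) * g (snd w)\<bar> \<le> b * b" if "w \<in> space (\<xi> \<Otimes>\<^sub>M \<xi>)" for w
      using that gb unfolding space_pair_design[OF \<xi> \<xi>]
      by (auto simp: abs_mult b_def sum_nonneg order_less_imp_le[OF c(1)] intro!: mult_mono)
  qed
  then have "0 \<le> (\<integral>(u, v). real_of_ereal (K u v) * (g u * g v) \<partial>(\<xi> \<Otimes>\<^sub>M \<xi>))"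
    by (intro pos_def_weighted[OF pd \<xi> gm gb]) (auto simp: split_beta')
  also have "\<dots> = (\<integral>w. (\<Sum>p\<in>UNIV \<times> UNIV. (z $ fst p * z $ snd p) *
      (\<lambda>(u, v). real_of_ereal (K u v) * (f u $ fst p * f v $ snd p)) w) \<partial>(\<xi> \<Otimes>\<^sub>M \<xi>))"
  proof (rule Bochner_Integration.integral_cong[OF refl])
    fix w
    have gg: "g (fst w) * g (snd w) = (\<Sum>p\<in>UNIV \<times> UNIV. (z $ fst p * f (fst w) $ fst p) * (z $ snd p * f (snd w) $ snd p))"
      unfolding g_def sum_product sum.cartesian_product by (simp add: split_beta')
    show "(\<lambda>(u, v). real_of_ereal (K u v) * (g u * g v)) w = (\<Sum>p\<in>UNIV \<times> UNIV. (z $ fst p * z $ snd p) *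
      (\<lambda>(u, v). real_of_ereal (K u v) * (f u $ fst p * f v $ snd p)) w)"
      unfolding split_beta' gg sum_distrib_left by (rule sum.cong) (simp_all add: mult_ac)
  qed
  also have "\<dots> = (\<Sum>p\<in>UNIV \<times> UNIV. (z $ fst p * z $ snd p) * B_mat K f \<xi> \<xi> $ fst p $ snd p)"
    unfolding B_mat_entry
    by (subst Bochner_Integration.integral_sum) (auto intro!: kernel_weight_integrable[OF \<xi> \<xi> K])
  also have "\<dots> = (\<Sum>i\<in>UNIV. \<Sum>j\<in>UNIV. (z $ i * z $ j) * B_mat K f \<xi> \<xi> $ i $ j)"
    unfolding sum.cartesian_product by (simp add: split_beta')
  also have "\<dots> = z \<bullet> (B_mat K f \<xi> \<xi> *v z)"
    by (simp add: inner_vec_def matrix_vector_mult_def sum_distrib_left mult_ac)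
  finally show ?thesis .
qed

lemma Xi_set_iff:
  "\<xi> \<in> Xi_set X K f \<longleftrightarrow> \<xi> \<in> designs X \<and> double_integrable K \<xi> \<xi> \<and> invertible (M_mat f \<xi>)"
  by (auto simp: Xi_set_def B_exists_iff M_exists_def M_integrable)

text \<open>The quadratic form of D at \<open>z\<close> is that of B(\<xi>,\<xi>) at
  \<open>G *v z\<close>. This places D in the domain where \<open>matrix_differentiable\<close>
  provides a derivative.\<close>

lemma nonneg_def_D_mat:
  assumes pd: "kernel_pos_def X K" and \<xi>: "\<xi> \<in> Xi_set X K f"
  shows "nonneg_def (D_mat K f \<xi>)"
proof -
  define G where "G = matrix_inv (M_mat f \<xi>)"
  have d: "\<xi> \<in> designs X" "double_integrable K \<xi> \<xi>" "invertible (M_mat f \<xi>)"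
    using \<xi> by (auto simp: Xi_set_iff)
  have Gt: "transpose G = G" unfolding G_def by (rule transpose_matrix_inv[OF d(3) M_mat_transpose])
  have "transpose (D_mat K f \<xi>) = D_mat K f \<xi>"
    unfolding D_mat_def G_def[symmetric]
    by (simp add: matrix_transpose_mul Gt B_mat_transpose[OF d(1,1), symmetric] matrix_mul_assoc)
  moreover have "0 \<le> z \<bullet> (D_mat K f \<xi> *v z)" for z
  proof -
    have "z \<bullet> (D_mat K f \<xi> *v z) = z \<bullet> (transpose G *v (B_mat K f \<xi> \<xi> *v (G *v z)))"
      by (simp add: D_mat_def Gt G_def[symmetric] matrix_vector_mul_assoc matrix_mul_assoc)
    also have "\<dots> = (G *v z) \<bullet> (B_mat K f \<xi> \<xi> *v (G *v z))"
      by (metis dot_lmul_matrix vector_transpose_matrix transpose_transpose)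
    finally show ?thesis using B_mat_nonneg[OF pd d(1,2)] by simp
  qed
  ultimately show ?thesis by (simp add: nonneg_def_def sym_mats_def)
qed

end

section \<open>The variational inequality\<close>

context regression_kernel
begin

lemma B_mat_point_entry:
  assumes \<xi>: "\<xi> \<in> designs X" and x: "x \<in> X"
  shows "B_mat K f \<xi> (point_design X x) $ i $ j = (\<integral>u. real_of_ereal (K u x) * (f u $ i * f x $ j) \<partial>\<xi>)"
proof -
  let ?B = "restrict_space borel X"
  note [measurable] = K_meas f_meas
  have xs: "x \<in> space ?B" using x by (simp add: space_restrict_space)
  have m: "(\<lambda>u. (u, x)) \<in> measurable \<xi> (?B \<Otimes>\<^sub>M ?B)"
    using xs by (intro measurable_Pair measurable_const measurable_ident_sets sets_design \<xi>)
  show ?thesis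
    unfolding B_mat_entry point_design_def pair_return_right[OF prob_space_design[OF \<xi>] sets_design[OF \<xi>] xs]
    by (subst integral_distr[OF m]) auto
qed

lemma B_exists_point_iff:
  assumes \<xi>: "\<xi> \<in> designs X" and x: "x \<in> X"
  shows "B_exists K f \<xi> (point_design X x) \<longleftrightarrow> (\<integral>\<^sup>+ u. e2ennreal \<bar>K u x\<bar> \<partial>\<xi>) < \<infinity>"
proof -
  have "(\<integral>\<^sup>+ v. e2ennreal \<bar>K u v\<bar> \<partial>point_design X x) = e2ennreal \<bar>K u x\<bar>" if "u \<in> X" for u
  proof -
    have "K u \<in> borel_measurable (restrict_space borel X)"
      using measurable_Pair2[OF K_meas, of u] that by (simp add: space_restrict_space)
    then show ?thesis
      using x unfolding point_design_def
      by (subst nn_integral_return) (auto simp: space_restrict_space)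
  qed
  then have "(\<integral>\<^sup>+ u. \<integral>\<^sup>+ v. e2ennreal \<bar>K u v\<bar> \<partial>point_design X x \<partial>\<xi>) = (\<integral>\<^sup>+ u. e2ennreal \<bar>K u x\<bar> \<partial>\<xi>)"
    by (intro nn_integral_cong) (simp add: space_design[OF \<xi>])
  then show ?thesis
    unfolding B_exists_iff[OF \<xi> point_design_in[OF x]] double_integrable_iff[OF \<xi> point_design_in[OF x]]
    by simp
qed

text \<open>Finite mutual energy means that the potential of \<open>\<xi>\<close> has a finite
  integral against \<open>\<nu>\<close>, so by Tonelli it is finite at \<open>\<nu>\<close>-almost
  every point.\<close>

lemma AE_B_exists_point:
  assumes \<xi>: "\<xi> \<in> designs X" and \<nu>: "\<nu> \<in> designs X" and K: "double_integrable K \<xi> \<nu>"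
  shows "AE x in \<nu>. B_exists K f \<xi> (point_design X x)"
proof -
  interpret pair_sigma_finite \<nu> \<xi> using \<nu> \<xi> by (rule pair_sigma_finite_design)
  note [measurable] = K_meas_design[OF \<nu> \<xi>]
  have "double_integrable K \<nu> \<xi>" using K double_integrable_commute[OF \<xi> \<nu>] by simp
  then have "(\<integral>\<^sup>+ x. \<integral>\<^sup>+ u. e2ennreal \<bar>K x u\<bar> \<partial>\<xi> \<partial>\<nu>) \<noteq> \<infinity>"
    using double_integrable_iff[OF \<nu> \<xi>] by simp
  then have "AE x in \<nu>. (\<integral>\<^sup>+ u. e2ennreal \<bar>K x u\<bar> \<partial>\<xi>) \<noteq> \<infinity>"
    by (intro nn_integral_PInf_AE) measurable
  then show ?thesis
  proof (rule AE_mp, intro AE_I2 impI)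
    fix x assume "x \<in> space \<nu>" and fin: "(\<integral>\<^sup>+ u. e2ennreal \<bar>K x u\<bar> \<partial>\<xi>) \<noteq> \<infinity>"
    then have x: "x \<in> X" by (simp add: space_design[OF \<nu>])
    have "(\<integral>\<^sup>+ u. e2ennreal \<bar>K u x\<bar> \<partial>\<xi>) = (\<integral>\<^sup>+ u. e2ennreal \<bar>K x u\<bar> \<partial>\<xi>)"
      by (intro nn_integral_cong) (simp add: space_design[OF \<xi>] K_sym[OF _ x])
    then show "B_exists K f \<xi> (point_design X x)"
      using fin unfolding B_exists_point_iff[OF \<xi> x] by (simp add: less_top)
  qed
qed

end

section \<open>First-order conditions at an optimal design\<close>

locale optimal_design = regression_kernel X K f
  for X :: "(real ^ 'd) set" and K and f :: "real ^ 'd \<Rightarrow> real ^ 'm" +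
  fixes \<Phi> :: "real ^ 'm ^ 'm \<Rightarrow> real" and \<xi> :: "(real ^ 'd) measure"
  assumes K_pd: "kernel_pos_def X K"
    and \<Phi>_diff: "matrix_differentiable \<Phi>"
    and \<xi>_Xi: "\<xi> \<in> Xi_set X K f"
    and \<xi>_opt: "\<And>\<nu>. \<nu> \<in> Xi_set X K f \<Longrightarrow> \<Phi> (D_mat K f \<xi>) \<le> \<Phi> (D_mat K f \<nu>)"
begin

abbreviation (input) "G \<equiv> matrix_inv (M_mat f \<xi>)"
abbreviation (input) "D \<equiv> D_mat K f \<xi>"
abbreviation (input) "C \<equiv> C_mat \<Phi> K f \<xi>"

lemma \<xi>_design: "\<xi> \<in> designs X" and \<xi>_energy: "double_integrable K \<xi> \<xi>"
  and \<xi>_inv: "invertible (M_mat f \<xi>)"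
  using \<xi>_Xi by (auto simp: Xi_set_iff)

lemma C_derivative: "has_matrix_derivative \<Phi> C D"
  unfolding C_mat_def by (rule has_matrix_derivative_matrix_derivative[OF \<Phi>_diff nonneg_def_D_mat[OF K_pd \<xi>_Xi]])

text \<open>The competitors are the mixtures of \<open>\<xi>\<close> and \<open>\<nu>\<close> with
  invertible information matrix. The two energy conditions keep them in the admissible set, while
  M(\<nu>) itself may be singular, as for a point design.\<close>

lemma variational_inequality:
  assumes \<nu>: "\<nu> \<in> designs X" and K: "double_integrable K \<nu> \<nu>" "double_integrable K \<xi> \<nu>"
  shows "trace (D ** C ** G ** M_mat f \<nu>) \<le> trace (C ** G ** B_mat K f \<xi> \<nu> ** G)"
  unfolding D_mat_def
proof (rule first_order_condition[where \<Phi> = \<Phi> and ?B2.0 = "B_mat K f \<nu> \<nu>"])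
  show "has_matrix_derivative \<Phi> C (G ** B_mat K f \<xi> \<xi> ** G)"
    using C_derivative unfolding D_mat_def .
  show "invertible (M_mat f \<xi>)" by (rule \<xi>_inv)
  show "transpose (B_mat K f \<nu> \<nu>) = B_mat K f \<nu> \<nu>" using B_mat_transpose[OF \<nu> \<nu>] by simp
  show "transpose (B_mat K f \<xi> \<xi>) = B_mat K f \<xi> \<xi>" using B_mat_transpose[OF \<xi>_design \<xi>_design] by simp
  fix t :: real
  assume t: "0 \<le> t" "t \<le> 1" and inv: "invertible (M_mat f \<xi> + t *\<^sub>R (M_mat f \<nu> - M_mat f \<xi>))"
  note M = M_mat_mixture[OF \<xi>_design \<nu> t]
  have "mixture t \<xi> \<nu> \<in> Xi_set X K f"
    unfolding Xi_set_iff M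
    using mixture_in_designs[OF \<xi>_design \<nu> t] double_integrable_mixture[OF \<xi>_design \<nu> t \<xi>_energy K(2,1)] inv
    by blast
  from \<xi>_opt[OF this]
  show "\<Phi> (G ** B_mat K f \<xi> \<xi> ** G) \<le>
      \<Phi> (matrix_inv (M_mat f \<xi> + t *\<^sub>R (M_mat f \<nu> - M_mat f \<xi>)) **
         ((1 - t)\<^sup>2 *\<^sub>R B_mat K f \<xi> \<xi> + (t * (1 - t)) *\<^sub>R (B_mat K f \<xi> \<nu> + transpose (B_mat K f \<xi> \<nu>))
           + t\<^sup>2 *\<^sub>R B_mat K f \<nu> \<nu>) **
         matrix_inv (M_mat f \<xi> + t *\<^sub>R (M_mat f \<nu> - M_mat f \<xi>)))"
    unfolding D_mat_def M B_mat_mixture[OF \<xi>_design \<nu> t \<xi>_energy K(2,1)] .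
qed (rule M_mat_transpose)+

lemma phi_fun_eq_sum: "phi_fun \<Phi> K f x \<xi> = (\<Sum>i\<in>UNIV. \<Sum>j\<in>UNIV. (D ** C ** G) $ i $ j * (f x $ j * f x $ i))"
  unfolding phi_fun_def inner_vec_def matrix_vector_mult_def
  by (simp add: sum_distrib_left mult_ac)

lemma phi_integral:
  assumes \<nu>: "\<nu> \<in> designs X"
  shows "integrable \<nu> (\<lambda>x. phi_fun \<Phi> K f x \<xi>)"
    "(\<integral>x. phi_fun \<Phi> K f x \<xi> \<partial>\<nu>) = trace (D ** C ** G ** M_mat f \<nu>)"
proof -
  define P where "P = D ** C ** G"
  note i = M_integrable[OF \<nu>]
  show "integrable \<nu> (\<lambda>x. phi_fun \<Phi> K f x \<xi>)"
    unfolding phi_fun_eq_sum by (intro Bochner_Integration.integrable_sum integrable_mult_right i)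
  show "(\<integral>x. phi_fun \<Phi> K f x \<xi> \<partial>\<nu>) = trace (D ** C ** G ** M_mat f \<nu>)"
    unfolding phi_fun_eq_sum P_def[symmetric]
    by (simp add: i Bochner_Integration.integral_sum Bochner_Integration.integrable_sum)
       (simp add: trace_def matrix_matrix_mult_def M_mat_def)
qed

lemma phi_continuous: "continuous_on X (\<lambda>x. phi_fun \<Phi> K f x \<xi>)"
  unfolding phi_fun_eq_sum by (intro continuous_intros continuous_f)

lemma trace_b_eq:
  "trace (C ** G ** B ** G) = (\<Sum>i\<in>UNIV. \<Sum>j\<in>UNIV. (G ** C ** G) $ i $ j * B $ j $ i)"
proof -
  have "trace (C ** G ** B ** G) = trace (G ** (C ** G ** B))" by (rule trace_mul_sym)
  also have "\<dots> = trace ((G ** C ** G) ** B)" by (simp only: matrix_mul_assoc)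
  finally show ?thesis by (simp only: trace_def matrix_matrix_mult_def[of "G ** C ** G" B] vec_lambda_beta)
qed

lemma b_fun_eq_sum:
  assumes x: "x \<in> X"
  shows "b_fun X \<Phi> K f x \<xi> = (\<Sum>i\<in>UNIV. \<Sum>j\<in>UNIV. (G ** C ** G) $ i $ j *
    (\<integral>u. real_of_ereal (K u x) * (f u $ j * f x $ i) \<partial>\<xi>))"
  unfolding b_fun_def trace_b_eq B_mat_point_entry[OF \<xi>_design x] ..

lemma b_measurable: "(\<lambda>x. b_fun X \<Phi> K f x \<xi>) \<in> borel_measurable (restrict_space borel X)"
proof -
  let ?B = "restrict_space borel X"
  interpret prob_space \<xi> using \<xi>_design by (rule prob_space_design)
  have s: "sets (?B \<Otimes>\<^sub>M \<xi>) = sets (?B \<Otimes>\<^sub>M ?B)"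
    by (intro sets_pair_measure_cong sets_design \<xi>_design refl)
  have [measurable]: "(\<lambda>(x, u). K u x) \<in> borel_measurable (?B \<Otimes>\<^sub>M \<xi>)"
    using measurable_pair_swap[OF K_meas] by (simp add: measurable_cong_sets[OF s refl])
  note [measurable] = f_meas f_meas_design[OF \<xi>_design]
  have "(\<lambda>x. \<Sum>i\<in>UNIV. \<Sum>j\<in>UNIV. (G ** C ** G) $ i $ j *
    (\<integral>u. real_of_ereal (K u x) * (f u $ j * f x $ i) \<partial>\<xi>)) \<in> borel_measurable ?B"
    by measurable
  then show ?thesis
    by (subst measurable_cong[OF b_fun_eq_sum]) (auto simp: space_restrict_space)
qed

text \<open>By Fubini B(\<xi>,\<nu>) is the \<open>\<nu>\<close>-average of B(\<xi>,\<xi>_x), and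
  \<open>b_fun\<close> is linear in that matrix. An entry whose integral over \<open>u\<close> does
  not exist has the default value 0; finite mutual energy confines this to a
  \<open>\<nu>\<close>-null set.\<close>

lemma b_integral:
  assumes \<nu>: "\<nu> \<in> designs X" and K: "double_integrable K \<xi> \<nu>"
  shows "integrable \<nu> (\<lambda>x. b_fun X \<Phi> K f x \<xi>)"
    "(\<integral>x. b_fun X \<Phi> K f x \<xi> \<partial>\<nu>) = trace (C ** G ** B_mat K f \<xi> \<nu> ** G)"
proof -
  interpret pair_sigma_finite \<xi> \<nu> using \<xi>_design \<nu> by (rule pair_sigma_finite_design)
  define W where "W = G ** C ** G"
  note ki = kernel_weight_integrable[OF \<xi>_design \<nu> K]
  define w where "w = (\<lambda>i j x. \<integral>u. real_of_ereal (K u x) * (f u $ j * f x $ i) \<partial>\<xi>)"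
  have wi: "integrable \<nu> (w i j)" "(\<integral>x. w i j x \<partial>\<nu>) = B_mat K f \<xi> \<nu> $ j $ i" for i j
    using integrable_snd[OF ki, of j i] integral_snd[OF ki, of j i] unfolding w_def B_mat_entry by simp_all
  have b: "b_fun X \<Phi> K f x \<xi> = (\<Sum>i\<in>UNIV. \<Sum>j\<in>UNIV. W $ i $ j * w i j x)" if "x \<in> space \<nu>" for x
    using that unfolding w_def W_def space_design[OF \<nu>] by (rule b_fun_eq_sum)
  have "integrable \<nu> (\<lambda>x. \<Sum>i\<in>UNIV. \<Sum>j\<in>UNIV. W $ i $ j * w i j x)"
    by (intro Bochner_Integration.integrable_sum integrable_mult_right wi)
  then show "integrable \<nu> (\<lambda>x. b_fun X \<Phi> K f x \<xi>)"
    by (simp add: b cong: Bochner_Integration.integrable_cong)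
  have "(\<integral>x. b_fun X \<Phi> K f x \<xi> \<partial>\<nu>) = (\<integral>x. (\<Sum>i\<in>UNIV. \<Sum>j\<in>UNIV. W $ i $ j * w i j x) \<partial>\<nu>)"
    by (rule Bochner_Integration.integral_cong[OF refl b])
  also have "\<dots> = (\<Sum>i\<in>UNIV. \<Sum>j\<in>UNIV. W $ i $ j * B_mat K f \<xi> \<nu> $ j $ i)"
    by (simp add: wi Bochner_Integration.integral_sum Bochner_Integration.integrable_sum)
  finally show "(\<integral>x. b_fun X \<Phi> K f x \<xi> \<partial>\<nu>) = trace (C ** G ** B_mat K f \<xi> \<nu> ** G)"
    unfolding trace_b_eq W_def .
qed

lemma phi_le_b_integral:
  assumes "\<nu> \<in> designs X" "double_integrable K \<nu> \<nu>" "double_integrable K \<xi> \<nu>"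
  shows "(\<integral>x. phi_fun \<Phi> K f x \<xi> \<partial>\<nu>) \<le> (\<integral>x. b_fun X \<Phi> K f x \<xi> \<partial>\<nu>)"
  unfolding phi_integral[OF assms(1)] b_integral[OF assms(1,3)]
  by (rule variational_inequality[OF assms])

text \<open>Both integrals equal trace(D C): on the left G cancels against M(\<xi>), on the right G
  B(\<xi>,\<xi>) G is D up to a cyclic shift.\<close>

lemma phi_eq_b_integral: "(\<integral>x. phi_fun \<Phi> K f x \<xi> \<partial>\<xi>) = (\<integral>x. b_fun X \<Phi> K f x \<xi> \<partial>\<xi>)"
proof -
  have "trace (D ** C ** G ** M_mat f \<xi>) = trace (D ** C)"
    by (simp add: matrix_mul_assoc[symmetric] matrix_inv_mult[OF \<xi>_inv])
  also have "\<dots> = trace (C ** D)" by (rule trace_mul_sym)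
  also have "\<dots> = trace (C ** G ** B_mat K f \<xi> \<xi> ** G)" by (simp add: D_mat_def matrix_mul_assoc)
  finally show ?thesis
    unfolding phi_integral[OF \<xi>_design] b_integral[OF \<xi>_design \<xi>_energy] .
qed

lemma AE_phi_eq_b:
  assumes "AE x in \<xi>. phi_fun \<Phi> K f x \<xi> \<le> b_fun X \<Phi> K f x \<xi>"
  shows "AE x in \<xi>. phi_fun \<Phi> K f x \<xi> = b_fun X \<Phi> K f x \<xi>"
proof -
  note i = phi_integral(1)[OF \<xi>_design] b_integral(1)[OF \<xi>_design \<xi>_energy]
  have "AE x in \<xi>. 0 \<le> b_fun X \<Phi> K f x \<xi> - phi_fun \<Phi> K f x \<xi>"
    using assms by auto
  then have "AE x in \<xi>. b_fun X \<Phi> K f x \<xi> - phi_fun \<Phi> K f x \<xi> = 0"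
    using integral_nonneg_eq_0_iff_AE[of \<xi> "\<lambda>x. b_fun X \<Phi> K f x \<xi> - phi_fun \<Phi> K f x \<xi>"] i
    by (simp add: phi_eq_b_integral)
  then show ?thesis by auto
qed

lemma strict_set_null:
  assumes "AE x in \<xi>. phi_fun \<Phi> K f x \<xi> = b_fun X \<Phi> K f x \<xi>"
  shows "{x \<in> X. phi_fun \<Phi> K f x \<xi> < b_fun X \<Phi> K f x \<xi>} \<in> null_sets \<xi>"
proof -
  have m: "(\<lambda>x. b_fun X \<Phi> K f x \<xi>) \<in> borel_measurable \<xi>" "(\<lambda>x. phi_fun \<Phi> K f x \<xi>) \<in> borel_measurable \<xi>"
    using b_measurable borel_measurable_continuous_on_restrict[OF phi_continuous]
    by (simp_all add: measurable_design[OF \<xi>_design])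
  have s: "{x \<in> X. phi_fun \<Phi> K f x \<xi> < b_fun X \<Phi> K f x \<xi>} \<in> sets \<xi>"
    using borel_measurable_less[OF m(2,1)] by (simp add: space_design[OF \<xi>_design])
  have "AE x in \<xi>. x \<notin> {x \<in> X. phi_fun \<Phi> K f x \<xi> < b_fun X \<Phi> K f x \<xi>}"
    using assms by eventually_elim simp
  then show ?thesis using AE_iff_null_sets[OF s] by simp
qed

end

section \<open>Potentials of finite kernels\<close>

lemma nn_integral_point_design:
  assumes "x \<in> X" "h \<in> borel_measurable (restrict_space borel X)"
  shows "(\<integral>\<^sup>+ u. h u \<partial>point_design X x) = h x"
  unfolding point_design_def using assms by (intro nn_integral_return) (simp_all add: space_restrict_space)

lemma integral_point_design:
  fixes h :: "real ^ 'd \<Rightarrow> real"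
  assumes "x \<in> X" "h \<in> borel_measurable (restrict_space borel X)"
  shows "(\<integral>u. h u \<partial>point_design X x) = h x"
  unfolding point_design_def using assms by (intro integral_return) (simp_all add: space_restrict_space)

lemma pair_point_design:
  assumes "\<xi> \<in> designs X" "x \<in> X"
  shows "\<xi> \<Otimes>\<^sub>M point_design X x = distr \<xi> (restrict_space borel X \<Otimes>\<^sub>M restrict_space borel X) (\<lambda>u. (u, x))"
  unfolding point_design_def
  using assms by (intro pair_return_right) (simp_all add: sets_design prob_space_design space_restrict_space)

lemma measurable_pair_point:
  assumes "\<xi> \<in> designs X" "x \<in> X"
  shows "(\<lambda>u. (u, x)) \<in> measurable \<xi> (restrict_space borel X \<Otimes>\<^sub>M restrict_space borel X)"
  using assms by (intro measurable_Pair measurable_const measurable_ident_sets sets_design) (simp_all add: space_restrict_space)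

lemma nn_integral_pair_point_design:
  assumes "\<xi> \<in> designs X" "x \<in> X" "h \<in> borel_measurable (restrict_space borel X \<Otimes>\<^sub>M restrict_space borel X)"
  shows "(\<integral>\<^sup>+ z. h z \<partial>(\<xi> \<Otimes>\<^sub>M point_design X x)) = (\<integral>\<^sup>+ u. h (u, x) \<partial>\<xi>)"
  unfolding pair_point_design[OF assms(1,2)]
  by (rule nn_integral_distr[OF measurable_pair_point[OF assms(1,2)]]) (simp add: assms(3))

lemma integral_pair_point_design:
  fixes h :: "_ \<Rightarrow> real"
  assumes "\<xi> \<in> designs X" "x \<in> X" "h \<in> borel_measurable (restrict_space borel X \<Otimes>\<^sub>M restrict_space borel X)"
  shows "(\<integral>z. h z \<partial>(\<xi> \<Otimes>\<^sub>M point_design X x)) = (\<integral>u. h (u, x) \<partial>\<xi>)"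
  unfolding pair_point_design[OF assms(1,2)]
  by (rule integral_distr[OF measurable_pair_point[OF assms(1,2)] assms(3)])

lemma pair_swap_symmetric:
  fixes g :: "_ \<Rightarrow> real"
  assumes \<mu>: "\<mu> \<in> designs X" and \<nu>: "\<nu> \<in> designs X"
    and sym: "\<And>u v. u \<in> X \<Longrightarrow> v \<in> X \<Longrightarrow> g (u, v) = g (v, u)"
    and g: "integrable (\<mu> \<Otimes>\<^sub>M \<nu>) g"
  shows "integrable (\<nu> \<Otimes>\<^sub>M \<mu>) g" "(\<integral>z. g z \<partial>(\<nu> \<Otimes>\<^sub>M \<mu>)) = (\<integral>z. g z \<partial>(\<mu> \<Otimes>\<^sub>M \<nu>))"
proof -
  interpret pair_sigma_finite \<mu> \<nu> using \<mu> \<nu> by (rule pair_sigma_finite_design)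
  have eq: "(\<lambda>(x, y). g (y, x)) z = g z" if "z \<in> space (\<nu> \<Otimes>\<^sub>M \<mu>)" for z
    using that unfolding space_pair_design[OF \<nu> \<mu>] by (auto intro: sym)
  have "integrable (\<nu> \<Otimes>\<^sub>M \<mu>) (\<lambda>(x, y). g (y, x))"
    using g by (rule integrable_product_swap)
  moreover have "integrable (\<nu> \<Otimes>\<^sub>M \<mu>) (\<lambda>(x, y). g (y, x)) \<longleftrightarrow> integrable (\<nu> \<Otimes>\<^sub>M \<mu>) g"
    by (rule Bochner_Integration.integrable_cong[OF refl eq])
  ultimately show "integrable (\<nu> \<Otimes>\<^sub>M \<mu>) g" by blast
  have "(\<integral>z. g z \<partial>(\<nu> \<Otimes>\<^sub>M \<mu>)) = (\<integral>(x, y). g (y, x) \<partial>(\<nu> \<Otimes>\<^sub>M \<mu>))"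
    by (rule Bochner_Integration.integral_cong[OF refl eq[symmetric]])
  also have "\<dots> = (\<integral>z. g z \<partial>(\<mu> \<Otimes>\<^sub>M \<nu>))"
    by (rule integral_product_swap) (rule borel_measurable_integrable[OF g])
  finally show "(\<integral>z. g z \<partial>(\<nu> \<Otimes>\<^sub>M \<mu>)) = (\<integral>z. g z \<partial>(\<mu> \<Otimes>\<^sub>M \<nu>))" .
qed

text \<open>A converse to \<open>ext_integrable_imp_integrable\<close>. Finiteness of
  \<open>h\<close> is essential, since \<open>real_of_ereal\<close> would turn infinite values into
  0.\<close>

lemma ext_integrable_of_integrable:
  fixes h :: "'a \<Rightarrow> ereal"
  assumes "h \<in> borel_measurable M" "\<And>z. z \<in> space M \<Longrightarrow> \<bar>h z\<bar> \<noteq> \<infinity>"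
    and "integrable M (\<lambda>z. real_of_ereal (h z))"
  shows "ext_integrable M h"
proof -
  have "(\<integral>\<^sup>+ z. e2ennreal \<bar>h z\<bar> \<partial>M) = (\<integral>\<^sup>+ z. ennreal (norm (real_of_ereal (h z))) \<partial>M)"
  proof (rule nn_integral_cong)
    fix z assume "z \<in> space M"
    from assms(2)[OF this] show "e2ennreal \<bar>h z\<bar> = ennreal (norm (real_of_ereal (h z)))"
      by (cases "h z") auto
  qed
  then show ?thesis
    using assms(1,3) by (simp add: ext_integrable_def integrable_iff_bounded)
qed

context measurable_kernel
begin

lemma finite_borel_on_design: "\<mu> \<in> designs X \<Longrightarrow> finite_borel_on X \<mu>"
  by (simp add: finite_borel_on_def sets_design prob_space_design prob_space.finite_measure)

text \<open>Positive definiteness applied to the signed measure \<mu> - \<nu>, with the two mixed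
  terms identified by symmetry of \<open>K\<close>.\<close>

lemma mutual_energy:
  assumes pd: "kernel_pos_def X K" and \<mu>: "\<mu> \<in> designs X" and \<nu>: "\<nu> \<in> designs X"
    and K: "double_integrable K \<mu> \<mu>" "double_integrable K \<mu> \<nu>" "double_integrable K \<nu> \<nu>"
  shows "2 * double_integral K \<mu> \<nu> \<le> double_integral K \<mu> \<mu> + double_integral K \<nu> \<nu>"
proof -
  have K': "double_integrable K \<nu> \<mu>" using K(2) double_integrable_commute[OF \<mu> \<nu>] by simp
  have eq: "double_integral K \<nu> \<mu> = double_integral K \<mu> \<nu>"
    unfolding double_integral_def ext_integral_def
    using K(2)[unfolded double_integrable_def, THEN ext_integrable_imp_integrable]
    by (intro pair_swap_symmetric(2)[OF \<mu> \<nu>]) (simp_all add: K_sym)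
  have "0 \<le> double_integral K \<mu> \<mu> - double_integral K \<mu> \<nu> - double_integral K \<nu> \<mu> + double_integral K \<nu> \<nu>"
    using pd finite_borel_on_design[OF \<mu>] finite_borel_on_design[OF \<nu>] K K' unfolding kernel_pos_def_def by blast
  then show ?thesis by (simp add: eq)
qed

lemma double_point_design:
  assumes u: "u \<in> X" and v: "v \<in> X"
  shows "double_integral K (point_design X u) (point_design X v) = real_of_ereal (K u v)"
    and "double_integrable K (point_design X u) (point_design X v) \<longleftrightarrow> \<bar>K u v\<bar> \<noteq> \<infinity>"
proof -
  note [measurable] = K_meas
  note m1[measurable] = measurable_Pair1[OF K_meas, of v]
  have vs: "v \<in> space (restrict_space borel X)" using v by (simp add: space_restrict_space)
  have [measurable]: "(\<lambda>u. K u v) \<in> borel_measurable (restrict_space borel X)"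
    using m1[OF vs] by simp
  show "double_integral K (point_design X u) (point_design X v) = real_of_ereal (K u v)"
    unfolding double_integral_def ext_integral_def
    by (subst integral_pair_point_design[OF point_design_in[OF u] v])
       (auto simp: integral_point_design[OF u])
  have "(\<integral>\<^sup>+ z. e2ennreal \<bar>(\<lambda>(u, v). K u v) z\<bar> \<partial>(point_design X u \<Otimes>\<^sub>M point_design X v)) = e2ennreal \<bar>K u v\<bar>"
    by (subst nn_integral_pair_point_design[OF point_design_in[OF u] v])
       (auto simp: nn_integral_point_design[OF u])
  then show "double_integrable K (point_design X u) (point_design X v) \<longleftrightarrow> \<bar>K u v\<bar> \<noteq> \<infinity>"
    unfolding double_integrable_def ext_integrable_def
    using K_meas_design[OF point_design_in[OF u] point_design_in[OF v]]
    by (cases "K u v") auto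
qed

text \<open>The mutual energy inequality for two point masses. For a stationary kernel both diagonal
  values equal the value at 0, which therefore bounds the kernel from above.\<close>

lemma pos_def_two_points:
  assumes pd: "kernel_pos_def X K" and u: "u \<in> X" and v: "v \<in> X"
    and fin: "\<bar>K u u\<bar> \<noteq> \<infinity>" "\<bar>K u v\<bar> \<noteq> \<infinity>" "\<bar>K v v\<bar> \<noteq> \<infinity>"
  shows "2 * real_of_ereal (K u v) \<le> real_of_ereal (K u u) + real_of_ereal (K v v)"
  using mutual_energy[OF pd point_design_in[OF u] point_design_in[OF v]] fin
  by (simp add: double_point_design u v)

text \<open>
  With \<open>\<eta>\<close> the midpoint of \<open>\<xi>\<close> and the point design at \<open>x\<close>, positive definiteness is applied to the
  weight \<open>g\<close> that is \<open>1\<close> at \<open>x\<close> and \<open>- sgn (K u x)\<close> elsewhere, truncated to \<open>\<bar>K u x\<bar> \<le> n\<close>.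
\<close>

lemma potential_finite:
  assumes fin: "finite_kernel X K" and pd: "kernel_pos_def X K"
    and \<xi>: "\<xi> \<in> designs X" and E: "double_integrable K \<xi> \<xi>" and x: "x \<in> X"
  shows "(\<integral>\<^sup>+ u. e2ennreal \<bar>K u x\<bar> \<partial>\<xi>) < \<infinity>"
proof -
  let ?B = "restrict_space borel X"
  let ?\<delta> = "point_design X x"
  define h where "h = (\<lambda>u. real_of_ereal (K u x))"
  have Kfin: "\<bar>K u v\<bar> \<noteq> \<infinity>" if "u \<in> X" "v \<in> X" for u v
    using fin that by (simp add: finite_kernel_def)
  note [measurable] = K_meas
  have \<delta>: "?\<delta> \<in> designs X" by (rule point_design_in[OF x])
  have hmB[measurable]: "h \<in> borel_measurable ?B"
    using measurable_Pair1[OF K_meas, of x] x unfolding h_def by (simp add: space_restrict_space)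
  have hm[measurable]: "h \<in> borel_measurable \<xi>" using hmB by (simp add: measurable_design[OF \<xi>])
  interpret prob_space \<xi> using \<xi> by (rule prob_space_design)
  define e where "e = (\<integral>z. norm (real_of_ereal ((\<lambda>(u, v). K u v) z)) \<partial>(\<xi> \<Otimes>\<^sub>M \<xi>))"
  have ki: "integrable (\<xi> \<Otimes>\<^sub>M \<xi>) (\<lambda>z. real_of_ereal ((\<lambda>(u, v). K u v) z))"
    using E[unfolded double_integrable_def] by (rule ext_integrable_imp_integrable)
  \<comment> \<open>The first summand bounds minus the integral of \<open>h u * g u\<close>: the
    energy of the weighted midpoint is a quarter of (\<open>\<xi>\<close>-part + twice that integral
    + \<open>h x\<close>) and is nonnegative. The summand \<open>2 * \<bar>h x\<bar>\<close> makes
    up for the point \<open>u = x\<close>, where \<open>g\<close> is 1 and does not carry the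
    opposite sign of \<open>h\<close>.\<close>
  define R where "R = (e + h x) / 2 + 2 * \<bar>h x\<bar>"
  define r where "r = (\<lambda>n u. if \<bar>h u\<bar> \<le> real n then \<bar>h u\<bar> else 0)"
  have rm[measurable]: "r n \<in> borel_measurable \<xi>" for n unfolding r_def by measurable
  have bound: "(\<integral>\<^sup>+ u. ennreal (r n u) \<partial>\<xi>) \<le> ennreal R" for n
  proof -
    define g where "g = (\<lambda>u. if u = x then 1 else if \<bar>h u\<bar> \<le> real n then - sgn (h u) else 0)"
    have xX: "{u \<in> space ?B. u = x} \<in> sets ?B"
      unfolding sets_restrict_space
      using x by (intro image_eqI[of _ _ "{x}"]) (auto simp: space_restrict_space)
    have gmB[measurable]: "g \<in> borel_measurable ?B"
      unfolding g_def by (rule measurable_If[OF _ _ xX]) measurable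
    have gm[measurable]: "g \<in> borel_measurable \<xi>" using gmB by (simp add: measurable_design[OF \<xi>])
    have g1: "\<bar>g u\<bar> \<le> 1" for u by (auto simp: g_def sgn_if)
    define F where "F = (\<lambda>z. real_of_ereal (K (fst z) (snd z)) * (g (fst z) * g (snd z)))"
    have FmB[measurable]: "F \<in> borel_measurable (?B \<Otimes>\<^sub>M ?B)"
    proof -
      have "(\<lambda>z. real_of_ereal ((\<lambda>(u, v). K u v) z) * (g (fst z) * g (snd z))) \<in> borel_measurable (?B \<Otimes>\<^sub>M ?B)"
        by measurable
      then show ?thesis by (simp add: F_def split_beta')
    qed
    have Fsym: "F (u, v) = F (v, u)" if "u \<in> X" "v \<in> X" for u v
      using that by (simp add: F_def K_sym mult.commute)
    have F1: "integrable (\<xi> \<Otimes>\<^sub>M \<xi>) F" "\<bar>\<integral>z. F z \<partial>(\<xi> \<Otimes>\<^sub>M \<xi>)\<bar> \<le> e"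
    proof -
      have le: "norm (F z) \<le> norm (real_of_ereal ((\<lambda>(u, v). K u v) z))" for z
      proof -
        have "\<bar>g (fst z) * g (snd z)\<bar> \<le> 1"
          using g1[of "fst z"] g1[of "snd z"] by (simp add: abs_mult mult_le_one)
        from mult_left_le[OF this, of "\<bar>real_of_ereal (K (fst z) (snd z))\<bar>"]
        show ?thesis by (simp only: F_def real_norm_def abs_mult[of "real_of_ereal (K (fst z) (snd z))"] split_beta' abs_ge_zero)
      qed
      show i: "integrable (\<xi> \<Otimes>\<^sub>M \<xi>) F"
        using FmB le by (intro Bochner_Integration.integrable_bound[OF ki]) (auto simp: measurable_pair_design[OF \<xi> \<xi>])
      have "\<bar>\<integral>z. F z \<partial>(\<xi> \<Otimes>\<^sub>M \<xi>)\<bar> \<le> (\<integral>z. norm (F z) \<partial>(\<xi> \<Otimes>\<^sub>M \<xi>))"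
        using integral_norm_bound[of "\<xi> \<Otimes>\<^sub>M \<xi>" F] by simp
      also have "\<dots> \<le> e"
        unfolding e_def by (intro integral_mono integrable_norm i ki le)
      finally show "\<bar>\<integral>z. F z \<partial>(\<xi> \<Otimes>\<^sub>M \<xi>)\<bar> \<le> e" .
    qed
    have Fpt: "F (u, x) = h u * g u" for u by (simp add: F_def h_def g_def)
    \<comment> \<open>Here the truncation pays off: the mixed terms are bounded, hence integrable,
      although finiteness of the potential of \<open>\<xi>\<close> at \<open>x\<close> is still to
      be shown.\<close>
    have hg: "\<bar>h u * g u\<bar> \<le> max (real n) \<bar>h x\<bar>" for u
      by (auto simp: g_def abs_mult sgn_if)
    have hgi: "integrable \<xi> (\<lambda>u. h u * g u)"
      using hg by (intro integrable_const_bound[of _ "max (real n) \<bar>h x\<bar>"]) auto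
    have F2: "integrable (\<xi> \<Otimes>\<^sub>M ?\<delta>) F" "(\<integral>z. F z \<partial>(\<xi> \<Otimes>\<^sub>M ?\<delta>)) = (\<integral>u. h u * g u \<partial>\<xi>)"
    proof -
      show "integrable (\<xi> \<Otimes>\<^sub>M ?\<delta>) F"
        unfolding pair_point_design[OF \<xi> x]
        by (subst integrable_distr_eq[OF measurable_pair_point[OF \<xi> x] FmB]) (simp add: Fpt hgi)
      show "(\<integral>z. F z \<partial>(\<xi> \<Otimes>\<^sub>M ?\<delta>)) = (\<integral>u. h u * g u \<partial>\<xi>)"
        by (simp add: integral_pair_point_design[OF \<xi> x FmB] Fpt)
    qed
    have F4: "integrable (?\<delta> \<Otimes>\<^sub>M ?\<delta>) F" "(\<integral>z. F z \<partial>(?\<delta> \<Otimes>\<^sub>M ?\<delta>)) = h x"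
    proof -
      interpret \<delta>: prob_space ?\<delta> by (rule prob_space_design[OF \<delta>])
      have m: "(\<lambda>u. h u * g u) \<in> borel_measurable ?\<delta>"
        by (simp add: measurable_design[OF \<delta>])
      have "integrable ?\<delta> (\<lambda>u. h u * g u)"
        using hg m by (intro \<delta>.integrable_const_bound[of _ "max (real n) \<bar>h x\<bar>"]) auto
      then show "integrable (?\<delta> \<Otimes>\<^sub>M ?\<delta>) F"
        unfolding pair_point_design[OF \<delta> x]
        by (subst integrable_distr_eq[OF measurable_pair_point[OF \<delta> x] FmB]) (simp add: Fpt)
      have "(\<integral>z. F z \<partial>(?\<delta> \<Otimes>\<^sub>M ?\<delta>)) = (\<integral>u. h u * g u \<partial>?\<delta>)"
        by (simp add: integral_pair_point_design[OF \<delta> x FmB] Fpt)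
      also have "\<dots> = h x * g x" by (rule integral_point_design[OF x]) measurable
      finally show "(\<integral>z. F z \<partial>(?\<delta> \<Otimes>\<^sub>M ?\<delta>)) = h x" by (simp add: g_def)
    qed
    note F3 = pair_swap_symmetric[where g = F, OF \<xi> \<delta> Fsym F2(1)]
    have F3': "(\<integral>z. F z \<partial>(?\<delta> \<Otimes>\<^sub>M \<xi>)) = (\<integral>u. h u * g u \<partial>\<xi>)"
      using F3(2) F2(2) by simp
    define \<eta> where "\<eta> = mixture (1 / 2) \<xi> ?\<delta>"
    have \<eta>: "\<eta> \<in> designs X" unfolding \<eta>_def by (rule mixture_in_designs[OF \<xi> \<delta>]) auto
    have sd: "sets ?\<delta> = sets \<xi>" using sets_design[OF \<delta>] sets_design[OF \<xi>] by simp
    have F5: "integrable (\<eta> \<Otimes>\<^sub>M \<eta>) F" "(\<integral>z. F z \<partial>(\<eta> \<Otimes>\<^sub>M \<eta>)) =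
      (1 - 1/2) * ((1 - 1/2) * (\<integral>z. F z \<partial>(\<xi> \<Otimes>\<^sub>M \<xi>)) + (1/2) * (\<integral>u. h u * g u \<partial>\<xi>))
      + (1/2) * ((1 - 1/2) * (\<integral>u. h u * g u \<partial>\<xi>) + (1/2) * h x)"
      unfolding \<eta>_def
      using integral_mixture_square[OF prob_space_design[OF \<xi>] prob_space_design[OF \<delta>] sd, of "1/2",
        OF _ _ F1(1) F2(1) F3(1) F4(1)] unfolding F2(2) F3' F4(2) by auto
    have "ext_integrable (\<eta> \<Otimes>\<^sub>M \<eta>) (\<lambda>(u, v). K u v * ereal (g u * g v))"
    proof (rule ext_integrable_of_integrable)
      have "(\<lambda>z. (\<lambda>(u, v). K u v) z * ereal (g (fst z) * g (snd z))) \<in> borel_measurable (?B \<Otimes>\<^sub>M ?B)"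
        by measurable
      then show "(\<lambda>(u, v). K u v * ereal (g u * g v)) \<in> borel_measurable (\<eta> \<Otimes>\<^sub>M \<eta>)"
        by (simp add: measurable_pair_design[OF \<eta> \<eta>] split_beta')
      show "\<bar>(\<lambda>(u, v). K u v * ereal (g u * g v)) z\<bar> \<noteq> \<infinity>" if "z \<in> space (\<eta> \<Otimes>\<^sub>M \<eta>)" for z
      proof -
        have "\<bar>K (fst z) (snd z)\<bar> \<noteq> \<infinity>"
          using that unfolding space_pair_design[OF \<eta> \<eta>] by (intro Kfin) auto
        then show ?thesis by (cases "K (fst z) (snd z)") (auto simp: split_beta')
      qed
      show "integrable (\<eta> \<Otimes>\<^sub>M \<eta>) (\<lambda>z. real_of_ereal ((\<lambda>(u, v). K u v * ereal (g u * g v)) z))"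
        using F5(1) by (simp add: F_def split_beta')
    qed
    from pos_def_weighted[OF pd \<eta> gmB g1 this]
    have "0 \<le> (\<integral>z. F z \<partial>(\<eta> \<Otimes>\<^sub>M \<eta>))" by (simp add: F_def split_beta')
    then have J: "- (\<integral>u. h u * g u \<partial>\<xi>) \<le> (e + h x) / 2"
      unfolding F5(2) using F1(2) by (simp add: field_simps)
    have rle: "r n u \<le> 2 * \<bar>h x\<bar> - h u * g u" for u
      by (auto simp: r_def g_def abs_if sgn_if)
    have ri: "integrable \<xi> (r n)"
      by (intro integrable_const_bound[of _ "real n"]) (auto simp: r_def)
    have "(\<integral>u. r n u \<partial>\<xi>) \<le> (\<integral>u. 2 * \<bar>h x\<bar> - h u * g u \<partial>\<xi>)"
      using ri hgi rle by (intro integral_mono) auto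
    also have "\<dots> = 2 * \<bar>h x\<bar> - (\<integral>u. h u * g u \<partial>\<xi>)"
      using hgi by (simp add: prob_space)
    also have "\<dots> \<le> R" using J by (simp add: R_def)
    finally show ?thesis
      by (subst nn_integral_eq_integral[OF ri]) (auto simp: r_def intro: ennreal_leI)
  qed
  \<comment> \<open>\<open>r n\<close> increases with \<open>n\<close> and reaches |K u x| as soon
    as \<open>n\<close> exceeds it; the bound \<open>R\<close> is the same for all
    \<open>n\<close>.\<close>
  have "(\<integral>\<^sup>+ u. e2ennreal \<bar>K u x\<bar> \<partial>\<xi>) \<le> (\<integral>\<^sup>+ u. (SUP n. ennreal (r n u)) \<partial>\<xi>)"
  proof (rule nn_integral_mono)
    fix u assume "u \<in> space \<xi>"
    then have u: "\<bar>K u x\<bar> \<noteq> \<infinity>" using Kfin x by (simp add: space_design[OF \<xi>])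
    obtain n where n: "\<bar>h u\<bar> \<le> real n" using real_arch_simple by blast
    have "e2ennreal \<bar>K u x\<bar> = ennreal (r n u)"
      using u n by (cases "K u x") (auto simp: r_def h_def)
    then show "e2ennreal \<bar>K u x\<bar> \<le> (SUP n. ennreal (r n u))"
      by (auto intro: SUP_upper)
  qed
  also have "\<dots> = (SUP n. \<integral>\<^sup>+ u. ennreal (r n u) \<partial>\<xi>)"
    by (rule nn_integral_monotone_convergence_SUP_AE) (auto simp: r_def intro!: AE_I2)
  also have "\<dots> \<le> ennreal R" by (intro SUP_least bound)
  also have "\<dots> < \<infinity>" by simp
  finally show ?thesis .
qed

end

section \<open>Mutual energy for singular kernels\<close>

text \<open>On the diagonal a stationary kernel is the constant \<open>c 0\<close>. The diagonal is
  closed, so a function that is continuous off it and constant on it is Borel.\<close>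

lemma off_diagonal_continuous_measurable:
  fixes c :: "real ^ 'd \<Rightarrow> real"
  assumes X: "closed X"
    and cont: "\<And>u v. u \<in> X \<Longrightarrow> v \<in> X \<Longrightarrow> u \<noteq> v \<Longrightarrow>
      continuous (at (u, v) within X \<times> X) (\<lambda>(s, t). ereal (c (s - t)))"
  shows "(\<lambda>(u, v). c (u - v)) \<in> borel_measurable (restrict_space borel X \<Otimes>\<^sub>M restrict_space borel X)"
proof -
  let ?B = "restrict_space borel X"
  let ?A = "X \<times> X - {z. fst z = snd z}"
  let ?c = "\<lambda>z. c (fst z - snd z)"
  have cl: "closed {z :: (real ^ 'd) \<times> (real ^ 'd). fst z = snd z}"
    by (intro closed_Collect_eq continuous_intros)
  have A: "?A \<in> sets borel"
    by (intro sets.Diff borel_closed closed_Times X cl)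
  have "continuous_on ?A ?c"
    unfolding continuous_on_def
  proof
    fix z assume z: "z \<in> ?A"
    then have "continuous (at (fst z, snd z) within X \<times> X) (\<lambda>(s, t). ereal (c (s - t)))"
      by (intro cont) auto
    then have "((\<lambda>z. ereal (?c z)) \<longlongrightarrow> ereal (?c z)) (at z within X \<times> X)"
      by (simp add: continuous_within split_beta')
    then have "(?c \<longlongrightarrow> ?c z) (at z within X \<times> X)" by simp
    then show "(?c \<longlongrightarrow> ?c z) (at z within ?A)"
      by (rule tendsto_within_subset) auto
  qed
  then have m: "(\<lambda>z. indicator ?A z *\<^sub>R ?c z + indicator (- ?A) z *\<^sub>R c 0) \<in> borel_measurable borel"
    using A by (intro borel_measurable_add borel_measurable_continuous_on_indicator borel_measurable_scaleR
        borel_measurable_indicator borel_comp borel_measurable_const)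
  have inc: "(\<lambda>u. u) \<in> measurable ?B borel"
    by (rule measurable_restrict_space1) simp
  have "(\<lambda>z. (fst z, snd z)) \<in> measurable (?B \<Otimes>\<^sub>M ?B) (borel \<Otimes>\<^sub>M borel)"
    by (intro measurable_Pair measurable_compose[OF measurable_fst inc] measurable_compose[OF measurable_snd inc])
  then have "(\<lambda>z. z) \<in> measurable (?B \<Otimes>\<^sub>M ?B) borel" by (simp add: borel_prod)
  from measurable_compose[OF this m]
  have m': "(\<lambda>z. indicator ?A z *\<^sub>R ?c z + indicator (- ?A) z *\<^sub>R c 0) \<in> borel_measurable (?B \<Otimes>\<^sub>M ?B)" .
  show ?thesis
  proof (rule measurable_cong[THEN iffD1, OF _ m'])
    fix z assume "z \<in> space (?B \<Otimes>\<^sub>M ?B)"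
    then have "z \<in> X \<times> X" by (simp add: space_pair_measure space_restrict_space)
    then show "indicator ?A z *\<^sub>R ?c z + indicator (- ?A) z *\<^sub>R c 0 = (\<lambda>(u, v). c (u - v)) z"
      by (cases z) (auto simp: indicator_def)
  qed
qed

lemma double_integrable_bounded:
  assumes "measurable_kernel X K" and \<mu>: "\<mu> \<in> designs X" and \<nu>: "\<nu> \<in> designs X"
    and b: "\<And>u v. u \<in> X \<Longrightarrow> v \<in> X \<Longrightarrow> \<bar>K u v\<bar> \<le> ereal c"
  shows "double_integrable K \<mu> \<nu>"
proof -
  interpret measurable_kernel X K by fact
  interpret M: prob_space \<mu> using \<mu> by (rule prob_space_design)
  interpret N: prob_space \<nu> using \<nu> by (rule prob_space_design)
  interpret P: pair_prob_space \<mu> \<nu> ..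
  have "(\<integral>\<^sup>+ z. e2ennreal \<bar>(\<lambda>(u, v). K u v) z\<bar> \<partial>(\<mu> \<Otimes>\<^sub>M \<nu>)) \<le> (\<integral>\<^sup>+ z. ennreal c \<partial>(\<mu> \<Otimes>\<^sub>M \<nu>))"
  proof (rule nn_integral_mono)
    fix z assume "z \<in> space (\<mu> \<Otimes>\<^sub>M \<nu>)"
    then have "\<bar>(\<lambda>(u, v). K u v) z\<bar> \<le> ereal c"
      using b by (auto simp: space_pair_design[OF \<mu> \<nu>])
    from e2ennreal_mono[OF this] show "e2ennreal \<bar>(\<lambda>(u, v). K u v) z\<bar> \<le> ennreal c" by simp
  qed
  also have "\<dots> = ennreal c" by (simp add: P.emeasure_space_1)
  also have "\<dots> < \<infinity>" by simp
  finally show ?thesis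
    using K_meas_design[OF \<mu> \<nu>] by (simp add: double_integrable_def ext_integrable_def)
qed

lemma nn_integral_nonneg_kernel:
  assumes K: "double_integrable (\<lambda>u v. ereal (k u v)) \<mu> \<nu>" and nn: "\<And>z. z \<in> space (\<mu> \<Otimes>\<^sub>M \<nu>) \<Longrightarrow> 0 \<le> k (fst z) (snd z)"
  shows "(\<integral>\<^sup>+ z. ennreal (k (fst z) (snd z)) \<partial>(\<mu> \<Otimes>\<^sub>M \<nu>)) = ennreal (double_integral (\<lambda>u v. ereal (k u v)) \<mu> \<nu>)"
  using ext_integrable_imp_integrable[OF K[unfolded double_integrable_def]] nn
  unfolding double_integral_def ext_integral_def
  by (subst nn_integral_eq_integral) (auto simp: split_beta')

context measurable_kernel
begin

text \<open>
  The mutual energy inequality cannot be applied to \<open>K\<close> itself, since it presupposes that the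
  mutual energy is finite. It holds for the approximating kernels, which are bounded by their
  value on the diagonal.
\<close>

lemma singular_cross_energy:
  assumes sing: "singular_kernel X K" and X: "closed X"
    and \<mu>: "\<mu> \<in> designs X" and \<nu>: "\<nu> \<in> designs X"
    and E: "double_integrable K \<mu> \<mu>" "double_integrable K \<nu> \<nu>"
  shows "double_integrable K \<mu> \<nu>"
proof -
  obtain r c where r: "\<forall>u\<in>X. \<forall>v\<in>X. K u v = r (u - v)"
    and bk: "\<forall>N. basic_kernel X (\<lambda>u v. ereal (c N (u - v)))"
    and c: "\<forall>t\<in>{u - v | u v. u \<in> X \<and> v \<in> X}. (t \<noteq> 0 \<longrightarrow> 0 \<le> r t \<and> r t < \<infinity>) \<and>
       (\<forall>N. 0 \<le> c N t \<and> ereal (c N t) \<le> r t) \<and> incseq (\<lambda>N. c N t) \<and> (\<lambda>N. ereal (c N t)) \<longlonglongrightarrow> r t"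
    using sing unfolding singular_kernel_def by (elim exE conjE) (rule that)
  have nn: "0 \<le> c N (u - v)" and le: "ereal (c N (u - v)) \<le> K u v"
    and inc: "incseq (\<lambda>N. c N (u - v))" and lim: "(\<lambda>N. ereal (c N (u - v))) \<longlonglongrightarrow> K u v"
    if "u \<in> X" "v \<in> X" for N u v
  proof -
    have "u - v \<in> {u - v | u v. u \<in> X \<and> v \<in> X}" using that by blast
    note c[rule_format, OF this]
    moreover have "K u v = r (u - v)" using r that by blast
    ultimately show "0 \<le> c N (u - v)" "ereal (c N (u - v)) \<le> K u v"
      "incseq (\<lambda>N. c N (u - v))" "(\<lambda>N. ereal (c N (u - v))) \<longlonglongrightarrow> K u v"
      by simp_all
  qed
  define k where "k = (\<lambda>N u v. c N (u - v))"
  have mk: "measurable_kernel X (\<lambda>u v. ereal (k N u v))" for N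
  proof
    show "ereal (k N u v) = ereal (k N v u)" if "u \<in> X" "v \<in> X" for u v
      using spec[OF bk, of N] that unfolding basic_kernel_def k_def by blast
    have "(\<lambda>(u, v). c N (u - v)) \<in> borel_measurable (restrict_space borel X \<Otimes>\<^sub>M restrict_space borel X)"
      using spec[OF bk, of N] unfolding basic_kernel_def
      by (intro off_diagonal_continuous_measurable[OF X]) blast
    then show "(\<lambda>(u, v). ereal (k N u v)) \<in> borel_measurable (restrict_space borel X \<Otimes>\<^sub>M restrict_space borel X)"
      unfolding k_def split_beta' by (rule borel_measurable_ereal)
  qed
  have pd: "kernel_pos_def X (\<lambda>u v. ereal (k N u v))" for N
    using spec[OF bk, of N] unfolding basic_kernel_def k_def by blast
  have "k N u v \<le> c N 0" if "u \<in> X" "v \<in> X" for N u v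
    using measurable_kernel.pos_def_two_points[OF mk pd that] by (simp add: k_def)
  then have bnd: "double_integrable (\<lambda>u v. ereal (k N u v)) \<alpha> \<beta>"
    if "\<alpha> \<in> designs X" "\<beta> \<in> designs X" for N \<alpha> \<beta>
    using nn by (intro double_integrable_bounded[OF mk that, of _ "c N 0"]) (simp add: k_def)
  have kint: "(\<integral>\<^sup>+ z. ennreal (k N (fst z) (snd z)) \<partial>(\<alpha> \<Otimes>\<^sub>M \<beta>)) = ennreal (double_integral (\<lambda>u v. ereal (k N u v)) \<alpha> \<beta>)"
    if "\<alpha> \<in> designs X" "\<beta> \<in> designs X" for N \<alpha> \<beta>
    using nn by (intro nn_integral_nonneg_kernel bnd that) (auto simp: k_def space_pair_design[OF that])
  have leE: "double_integral (\<lambda>u v. ereal (k N u v)) \<alpha> \<alpha> \<le> double_integral K \<alpha> \<alpha>"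
    if \<alpha>: "\<alpha> \<in> designs X" and e: "double_integrable K \<alpha> \<alpha>" for N \<alpha>
  proof -
    have e': "ext_integrable (\<alpha> \<Otimes>\<^sub>M \<alpha>) (\<lambda>(u, v). K u v)" using e by (simp add: double_integrable_def)
    then have m: "(\<lambda>(u, v). K u v) \<in> borel_measurable (\<alpha> \<Otimes>\<^sub>M \<alpha>)"
      and fin: "(\<integral>\<^sup>+ z. e2ennreal \<bar>(\<lambda>(u, v). K u v) z\<bar> \<partial>(\<alpha> \<Otimes>\<^sub>M \<alpha>)) \<noteq> \<infinity>"
      by (auto simp: ext_integrable_def)
    \<comment> \<open>Where \<open>K\<close> is infinite, \<open>real_of_ereal\<close> gives 0 and
      the comparison with \<open>k N\<close> could fail. Finite energy makes these points a null
      set.\<close>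
    have "AE z in \<alpha> \<Otimes>\<^sub>M \<alpha>. e2ennreal \<bar>(\<lambda>(u, v). K u v) z\<bar> \<noteq> \<infinity>"
      by (rule nn_integral_PInf_AE[OF _ fin]) (use m in measurable)
    then have "AE z in \<alpha> \<Otimes>\<^sub>M \<alpha>. real_of_ereal ((\<lambda>(u, v). ereal (k N u v)) z) \<le> real_of_ereal ((\<lambda>(u, v). K u v) z)"
    proof (rule AE_mp, intro AE_I2 impI)
      fix z assume z: "z \<in> space (\<alpha> \<Otimes>\<^sub>M \<alpha>)" and f: "e2ennreal \<bar>(\<lambda>(u, v). K u v) z\<bar> \<noteq> \<infinity>"
      have "fst z \<in> X" "snd z \<in> X" using z unfolding space_pair_design[OF \<alpha> \<alpha>] by auto
      then have "ereal (k N (fst z) (snd z)) \<le> K (fst z) (snd z)" unfolding k_def by (rule le)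
      then show "real_of_ereal ((\<lambda>(u, v). ereal (k N u v)) z) \<le> real_of_ereal ((\<lambda>(u, v). K u v) z)"
        using f by (cases "K (fst z) (snd z)") (auto simp: split_beta')
    qed
    then show ?thesis
      unfolding double_integral_def ext_integral_def
      using bnd[OF \<alpha> \<alpha>] e' by (intro integral_mono_AE ext_integrable_imp_integrable) (auto simp: double_integrable_def)
  qed
  \<comment> \<open>Half the sum of the two energies of \<open>K\<close>, an upper bound for the
    mutual energy of every approximating kernel. Being independent of \<open>N\<close>, it passes to
    \<open>K\<close> by monotone convergence.\<close>
  define R where "R = (double_integral K \<mu> \<mu> + double_integral K \<nu> \<nu>) / 2"
  have kR: "double_integral (\<lambda>u v. ereal (k N u v)) \<mu> \<nu> \<le> R" for N
    using measurable_kernel.mutual_energy[OF mk pd \<mu> \<nu> bnd[OF \<mu> \<mu>] bnd[OF \<mu> \<nu>] bnd[OF \<nu> \<nu>], of N]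
      leE[OF \<mu> E(1), of N] leE[OF \<nu> E(2), of N] by (simp add: R_def)
  have km: "(\<lambda>z. ennreal (k N (fst z) (snd z))) \<in> borel_measurable (\<mu> \<Otimes>\<^sub>M \<nu>)" for N
  proof -
    have "(\<lambda>z. e2ennreal ((\<lambda>(u, v). ereal (k N u v)) z)) \<in> borel_measurable (\<mu> \<Otimes>\<^sub>M \<nu>)"
      using measurable_kernel.K_meas_design[OF mk \<mu> \<nu>] by measurable
    then show ?thesis by (simp add: split_beta')
  qed
  have "(\<integral>\<^sup>+ z. e2ennreal \<bar>(\<lambda>(u, v). K u v) z\<bar> \<partial>(\<mu> \<Otimes>\<^sub>M \<nu>)) \<le>
    (\<integral>\<^sup>+ z. (SUP N. ennreal (k N (fst z) (snd z))) \<partial>(\<mu> \<Otimes>\<^sub>M \<nu>))"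
  proof (rule nn_integral_mono)
    fix z assume "z \<in> space (\<mu> \<Otimes>\<^sub>M \<nu>)"
    then have z: "fst z \<in> X" "snd z \<in> X" unfolding space_pair_design[OF \<mu> \<nu>] by auto
    have "0 \<le> K (fst z) (snd z)"
      using nn[OF z, of 0] le[OF z, of 0] order_trans[of 0 "ereal (c 0 (fst z - snd z))"] by simp
    then have a: "\<bar>(\<lambda>(u, v). K u v) z\<bar> = K (fst z) (snd z)" by (simp add: split_beta')
    have "(\<lambda>N. e2ennreal (ereal (c N (fst z - snd z)))) \<longlonglongrightarrow> e2ennreal (K (fst z) (snd z))"
      by (intro tendsto_e2ennrealI lim z)
    then show "e2ennreal \<bar>(\<lambda>(u, v). K u v) z\<bar> \<le> (SUP N. ennreal (k N (fst z) (snd z)))"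
      unfolding a by (rule LIMSEQ_le_const2) (auto simp: k_def intro!: exI[of _ 0] SUP_upper)
  qed
  also have "\<dots> = (SUP N. \<integral>\<^sup>+ z. ennreal (k N (fst z) (snd z)) \<partial>(\<mu> \<Otimes>\<^sub>M \<nu>))"
  proof (rule nn_integral_monotone_convergence_SUP_AE[OF AE_I2 km])
    fix N z assume "z \<in> space (\<mu> \<Otimes>\<^sub>M \<nu>)"
    then have z: "fst z \<in> X" "snd z \<in> X" unfolding space_pair_design[OF \<mu> \<nu>] by auto
    show "ennreal (k N (fst z) (snd z)) \<le> ennreal (k (Suc N) (fst z) (snd z))"
      using incseq_SucD[OF inc[OF z]] by (simp add: k_def ennreal_leI)
  qed
  also have "\<dots> \<le> ennreal R"
    unfolding kint[OF \<mu> \<nu>] by (intro SUP_least ennreal_leI kR)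
  also have "\<dots> < \<infinity>" by simp
  finally show ?thesis
    using K_meas_design[OF \<mu> \<nu>] by (simp add: double_integrable_def ext_integrable_def)
qed

end

section \<open>The optimality inequality at points\<close>

text \<open>\<open>\<nu> n\<close> lives in the ball of radius 1/(n+1) about \<open>x\<close>, so
  only values of \<open>h\<close> near \<open>x\<close> matter. Away from \<open>x\<close> the
  function may be discontinuous or unbounded, which weak convergence would not tolerate; this is
  needed for \<open>K u v\<close> as a function of \<open>v\<close>.\<close>

lemma concentrating_integral_tendsto:
  fixes h :: "real ^ 'd \<Rightarrow> real"
  assumes \<nu>: "\<And>n. \<nu> n \<in> designs X"
    and conc: "\<And>n. AE v in \<nu> n. dist v x \<le> 1 / real (Suc n)"
    and int: "\<And>n. integrable (\<nu> n) h"
    and cont: "(h \<longlongrightarrow> h x) (at x within X)"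
  shows "(\<lambda>n. \<integral>v. h v \<partial>\<nu> n) \<longlonglongrightarrow> h x"
proof (rule LIMSEQ_I)
  fix e :: real assume e: "0 < e"
  then obtain d where d: "d > 0" "\<And>v. v \<in> X \<Longrightarrow> v \<noteq> x \<Longrightarrow> dist v x < d \<Longrightarrow> dist (h v) (h x) < e / 2"
    using cont half_gt_zero[OF e] unfolding Lim_within by (metis dist_nz)
  obtain N where N: "1 / real (Suc N) < d"
    using reals_Archimedean[OF d(1)] by (auto simp: inverse_eq_divide)
  show "\<exists>no. \<forall>n\<ge>no. norm ((\<integral>v. h v \<partial>\<nu> n) - h x) < e"
  proof (intro exI allI impI)
    fix n assume n: "N \<le> n"
    interpret prob_space "\<nu> n" by (rule prob_space_design[OF \<nu>])
    have small: "1 / real (Suc n) < d"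
      using N n frac_le[of 1 1 "real (Suc N)" "real (Suc n)"] by simp
    have i: "integrable (\<nu> n) (\<lambda>v. h v - h x)" using int[of n] by simp
    have "norm ((\<integral>v. h v \<partial>\<nu> n) - h x) = norm (\<integral>v. h v - h x \<partial>\<nu> n)"
      using int[of n] by (simp add: prob_space)
    also have "\<dots> \<le> (\<integral>v. norm (h v - h x) \<partial>\<nu> n)" by (rule integral_norm_bound)
    also have "\<dots> \<le> (\<integral>v. e / 2 \<partial>\<nu> n)"
    proof (rule integral_mono_AE)
      show "integrable (\<nu> n) (\<lambda>v. norm (h v - h x))" using i by (rule integrable_norm)
      show "AE v in \<nu> n. norm (h v - h x) \<le> e / 2"
        using conc[of n] AE_space
      proof eventually_elim
        case (elim v)
        then have "v \<in> X" "dist v x < d" using small space_design[OF \<nu>, of n] by auto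
        then show ?case using d(2)[of v] e by (cases "v = x") (auto simp: dist_real_def)
      qed
    qed simp
    also have "\<dots> = e / 2" by (simp add: prob_space)
    finally show "norm ((\<integral>v. h v \<partial>\<nu> n) - h x) < e" using e by simp
  qed
qed

context optimal_design
begin

lemma phi_le_b_point:
  assumes x: "x \<in> X" and fin: "\<bar>K x x\<bar> \<noteq> \<infinity>"
    and B: "B_exists K f \<xi> (point_design X x)"
  shows "phi_fun \<Phi> K f x \<xi> \<le> b_fun X \<Phi> K f x \<xi>"
proof -
  have "double_integrable K (point_design X x) (point_design X x)"
    using double_point_design(2)[OF x x] fin by simp
  moreover have "double_integrable K \<xi> (point_design X x)"
    using B B_exists_iff[OF \<xi>_design point_design_in[OF x]] by simp
  ultimately have "(\<integral>y. phi_fun \<Phi> K f y \<xi> \<partial>point_design X x) \<le> (\<integral>y. b_fun X \<Phi> K f y \<xi> \<partial>point_design X x)"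
    by (intro phi_le_b_integral point_design_in[OF x])
  then show ?thesis
    by (simp add: integral_point_design[OF x] b_measurable borel_measurable_continuous_on_restrict[OF phi_continuous])
qed

lemma AE_phi_le_b:
  assumes sing: "singular_kernel X K" and \<nu>: "\<nu> \<in> designs X" and E: "double_integrable K \<nu> \<nu>"
  shows "AE x in \<nu>. phi_fun \<Phi> K f x \<xi> \<le> b_fun X \<Phi> K f x \<xi>"
proof -
  define A where "A = {x \<in> X. b_fun X \<Phi> K f x \<xi> < phi_fun \<Phi> K f x \<xi>}"
  interpret prob_space \<nu> by (rule prob_space_design[OF \<nu>])
  have m: "(\<lambda>x. b_fun X \<Phi> K f x \<xi>) \<in> borel_measurable \<nu>" "(\<lambda>x. phi_fun \<Phi> K f x \<xi>) \<in> borel_measurable \<nu>"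
    using b_measurable borel_measurable_continuous_on_restrict[OF phi_continuous]
    by (simp_all add: measurable_design[OF \<nu>])
  have A: "A \<in> sets \<nu>"
    using borel_measurable_less[OF m] by (simp add: A_def space_design[OF \<nu>])
  have "measure \<nu> A = 0"
  proof (rule ccontr)
    assume "measure \<nu> A \<noteq> 0"
    then have pos: "measure \<nu> A > 0" by (simp add: zero_less_measure_iff)
    define p where "p = (\<lambda>x. indicator A x / measure \<nu> A)"
    have AB: "A \<in> sets (restrict_space borel X)" using A by (simp add: sets_design[OF \<nu>])
    have pm: "p \<in> borel_measurable (restrict_space borel X)" unfolding p_def using AB by measurable
    have [measurable]: "p \<in> borel_measurable \<nu>" using pm by (simp add: measurable_design[OF \<nu>])
    have p: "0 \<le> p x" "p x \<le> 1 / measure \<nu> A" for x using pos by (auto simp: p_def indicator_def)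
    let ?\<rho> = "density \<nu> (\<lambda>x. ennreal (p x))"
    have "emeasure ?\<rho> (space ?\<rho>) = (\<integral>\<^sup>+ x. ennreal (1 / measure \<nu> A) * indicator A x \<partial>\<nu>)"
    proof -
      have "emeasure ?\<rho> (space ?\<rho>) = (\<integral>\<^sup>+ x. ennreal (p x) * indicator (space \<nu>) x \<partial>\<nu>)"
        by (simp add: emeasure_density)
      also have "\<dots> = (\<integral>\<^sup>+ x. ennreal (1 / measure \<nu> A) * indicator A x \<partial>\<nu>)"
        by (rule nn_integral_cong) (auto simp: p_def indicator_def)
      finally show ?thesis .
    qed
    also have "\<dots> = ennreal (1 / measure \<nu> A) * ennreal (measure \<nu> A)"
      using A by (simp add: nn_integral_cmult_indicator emeasure_eq_measure)
    also have "\<dots> = 1" using pos by (simp add: ennreal_mult[symmetric])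
    finally have "prob_space ?\<rho>" by (rule prob_spaceI)
    then have \<rho>: "?\<rho> \<in> designs X" by (simp add: designs_def sets_design[OF \<nu>])
    \<comment> \<open>The density is at most 1 / measure of \<open>A\<close>, so the restriction
      inherits finite energy from \<open>\<nu>\<close>. Its mutual energy with \<open>\<xi>\<close>
      is then finite because the kernel is singular.\<close>
    have "ext_integrable (\<nu> \<Otimes>\<^sub>M \<nu>) (\<lambda>z. (\<lambda>(u, v). K u v) z * ereal (p (fst z) * p (snd z)))"
    proof (rule ext_integrable_mult)
      show "ext_integrable (\<nu> \<Otimes>\<^sub>M \<nu>) (\<lambda>(u, v). K u v)" using E by (simp add: double_integrable_def)
      show "(\<lambda>z. p (fst z) * p (snd z)) \<in> borel_measurable (\<nu> \<Otimes>\<^sub>M \<nu>)" by measurable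
      show "\<bar>p (fst z) * p (snd z)\<bar> \<le> 1 / measure \<nu> A * (1 / measure \<nu> A)" for z
        unfolding abs_of_nonneg[OF mult_nonneg_nonneg[OF p(1) p(1)]]
        using p pos by (intro mult_mono) auto
    qed
    then have "ext_integrable (\<nu> \<Otimes>\<^sub>M \<nu>) (\<lambda>(u, v). K u v * ereal (p u * p v))"
      by (simp add: split_beta')
    then have E\<rho>: "double_integrable K ?\<rho> ?\<rho>"
      by (rule double_density(2)[OF \<nu> \<nu> pm p pm p])
    have X: "closed X" by (rule compact_imp_closed[OF compact_X])
    have cross: "double_integrable K \<xi> ?\<rho>"
      by (rule singular_cross_energy[OF sing X \<xi>_design \<rho> \<xi>_energy E\<rho>])
    interpret \<rho>: prob_space ?\<rho> by (rule prob_space_design[OF \<rho>])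
    have "(\<lambda>x. ennreal (p x)) \<in> borel_measurable \<nu>" by measurable
    from AE_density[OF this] have AE: "AE x in ?\<rho>. x \<in> A"
      by (auto simp: p_def indicator_def)
    let ?d = "\<lambda>x. phi_fun \<Phi> K f x \<xi> - b_fun X \<Phi> K f x \<xi>"
    note i = phi_integral(1)[OF \<rho>] b_integral(1)[OF \<rho> cross]
    have di: "integrable ?\<rho> ?d" using i by simp
    have "AE x in ?\<rho>. 0 \<le> ?d x" using AE by eventually_elim (simp add: A_def)
    moreover have "(\<integral>x. ?d x \<partial>?\<rho>) \<le> 0"
      using phi_le_b_integral[OF \<rho> E\<rho> cross] i by simp
    ultimately have "AE x in ?\<rho>. ?d x = 0"
      using integral_nonneg_eq_0_iff_AE[OF di] integral_nonneg_AE[of ?d ?\<rho>] by simp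
    with AE have "AE x in ?\<rho>. False" by eventually_elim (simp add: A_def)
    then show False by simp
  qed
  then have "A \<in> null_sets \<nu>" using A by (simp add: null_sets_def emeasure_eq_measure)
  then have "AE x in \<nu>. x \<notin> A" by (rule AE_not_in)
  with AE_space[of \<nu>] show ?thesis
    by eventually_elim (auto simp: A_def space_design[OF \<nu>])
qed

text \<open>The integrated inequality for \<open>\<nu> n\<close> is passed to the limit. For fixed
  \<open>u\<close> different from \<open>x\<close> the inner integral concentrates at
  \<open>v = x\<close>; the outer integral over \<open>\<xi>\<close> converges by dominated
  convergence, the majorant coming from the domination of potentials.\<close>

lemma phi_le_b_approachable:
  assumes x: "x \<in> X" and appr: "approachable X K x"
    and off: "\<And>u. u \<in> X \<Longrightarrow> u \<noteq> x \<Longrightarrow> \<bar>K u x\<bar> \<noteq> \<infinity>"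
    and cont: "\<And>u. u \<in> X \<Longrightarrow> u \<noteq> x \<Longrightarrow> continuous (at (u, x) within X \<times> X) (\<lambda>(s, t). K s t)"
    and inf: "K x x = \<infinity>"
    and B: "B_exists K f \<xi> (point_design X x)"
  shows "phi_fun \<Phi> K f x \<xi> \<le> b_fun X \<Phi> K f x \<xi>"
proof -
  obtain \<nu> c where \<nu>0: "\<forall>n. \<nu> n \<in> designs X \<and> double_integrable K (\<nu> n) (\<nu> n) \<and>
        (AE v in \<nu> n. dist v x \<le> 1 / real (Suc n)) \<and>
        (\<forall>u\<in>X. (\<integral>\<^sup>+ v. e2ennreal \<bar>K u v\<bar> \<partial>\<nu> n) \<le> ennreal c * (1 + e2ennreal \<bar>K u x\<bar>))"
    using appr unfolding approachable_def by (elim exE) (rule that)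
  then have \<nu>: "\<nu> n \<in> designs X" and E: "double_integrable K (\<nu> n) (\<nu> n)"
    and conc: "AE v in \<nu> n. dist v x \<le> 1 / real (Suc n)"
    and dom: "u \<in> X \<Longrightarrow> (\<integral>\<^sup>+ v. e2ennreal \<bar>K u v\<bar> \<partial>\<nu> n) \<le> ennreal c * (1 + e2ennreal \<bar>K u x\<bar>)" for n u
    by blast+
  interpret prob_space \<xi> by (rule prob_space_design[OF \<xi>_design])
  have Kx_m: "(\<lambda>u. K u x) \<in> borel_measurable \<xi>" by (rule K_meas_section[OF \<xi>_design x])
  note [measurable] = Kx_m
  have pot: "(\<integral>\<^sup>+ u. e2ennreal \<bar>K u x\<bar> \<partial>\<xi>) < \<infinity>"
    using B B_exists_point_iff[OF \<xi>_design x] by simp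
  have cross: "double_integrable K \<xi> (\<nu> n)" for n
  proof -
    have "(\<integral>\<^sup>+ u. \<integral>\<^sup>+ v. e2ennreal \<bar>K u v\<bar> \<partial>\<nu> n \<partial>\<xi>) \<le> (\<integral>\<^sup>+ u. ennreal c * (1 + e2ennreal \<bar>K u x\<bar>) \<partial>\<xi>)"
      by (rule nn_integral_mono) (simp add: dom space_design[OF \<xi>_design])
    also have "\<dots> = ennreal c * (1 + (\<integral>\<^sup>+ u. e2ennreal \<bar>K u x\<bar> \<partial>\<xi>))"
      by (subst nn_integral_cmult, measurable) (subst nn_integral_add, simp_all add: emeasure_space_1)
    also have "\<dots> < \<infinity>" using pot by (simp add: ennreal_mult_less_top)
    finally show ?thesis unfolding double_integrable_iff[OF \<xi>_design \<nu>] .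
  qed
  \<comment> \<open>\<open>K x x\<close> is infinite but the potential at \<open>x\<close> is
    finite, so \<open>\<xi>\<close> has no atom at \<open>x\<close>. Convergence of the inner
    integrals is available only for the remaining \<open>u\<close>.\<close>
  have ne: "AE u in \<xi>. u \<in> X \<and> u \<noteq> x"
  proof -
    have "AE u in \<xi>. e2ennreal \<bar>K u x\<bar> \<noteq> \<infinity>"
      using pot by (intro nn_integral_PInf_AE) auto
    with AE_space[of \<xi>] show ?thesis
      by eventually_elim (auto simp: inf space_design[OF \<xi>_design])
  qed
  obtain b where b: "0 < b" "\<And>y i. y \<in> X \<Longrightarrow> \<bar>f y $ i\<bar> \<le> b" using f_bound by blast
  have entry: "(\<lambda>n. B_mat K f \<xi> (\<nu> n) $ j $ i) \<longlonglongrightarrow> (\<integral>u. real_of_ereal (K u x) * (f u $ j * f x $ i) \<partial>\<xi>)" for i j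
  proof -
    define w where "w = (\<lambda>n u. \<integral>v. real_of_ereal (K u v) * (f u $ j * f v $ i) \<partial>\<nu> n)"
    have Bw: "B_mat K f \<xi> (\<nu> n) $ j $ i = (\<integral>u. w n u \<partial>\<xi>)" and wm: "w n \<in> borel_measurable \<xi>" for n
    proof -
      interpret pair_sigma_finite \<xi> "\<nu> n" by (rule pair_sigma_finite_design[OF \<xi>_design \<nu>])
      note ki = kernel_weight_integrable[OF \<xi>_design \<nu> cross, of n j i]
      show "B_mat K f \<xi> (\<nu> n) $ j $ i = (\<integral>u. w n u \<partial>\<xi>)"
        unfolding w_def B_mat_entry by (rule integral_fst[OF ki, symmetric])
      show "w n \<in> borel_measurable \<xi>"
        unfolding w_def by (rule borel_measurable_integrable[OF integrable_fst[OF ki]])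
    qed
    have kn: "integrable (\<nu> n) (\<lambda>v. real_of_ereal (K u v) * (f u $ j * f v $ i)) \<and>
        \<bar>w n u\<bar> \<le> b * b * (\<bar>c\<bar> * (1 + \<bar>real_of_ereal (K u x)\<bar>))" if u: "u \<in> X" "u \<noteq> x" for n u
    proof -
      let ?g = "\<lambda>v. real_of_ereal (K u v) * (f u $ j * f v $ i)"
      have [measurable]: "(\<lambda>v. K u v) \<in> borel_measurable (\<nu> n)"
        using measurable_Pair2[OF K_meas, of u] u(1) by (simp add: measurable_design[OF \<nu>] space_restrict_space)
      note [measurable] = f_meas_design[OF \<nu>]
      have gm: "?g \<in> borel_measurable (\<nu> n)" by measurable
      have "(\<integral>\<^sup>+ v. ennreal (norm (?g v)) \<partial>\<nu> n) \<le> (\<integral>\<^sup>+ v. ennreal (b * b) * e2ennreal \<bar>K u v\<bar> \<partial>\<nu> n)"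
      proof (rule nn_integral_mono)
        fix v assume "v \<in> space (\<nu> n)"
        then have v: "v \<in> X" by (simp add: space_design[OF \<nu>])
        have fb: "\<bar>f u $ j * f v $ i\<bar> \<le> b * b"
          unfolding abs_mult by (intro mult_mono b u v order_less_imp_le[OF b(1)]) auto
        have "ennreal (norm (?g v)) = ennreal \<bar>f u $ j * f v $ i\<bar> * ennreal \<bar>real_of_ereal (K u v)\<bar>"
          by (subst ennreal_mult[symmetric]) (simp_all only: abs_ge_zero mult_nonneg_nonneg real_norm_def abs_mult mult_ac)
        also have "\<dots> \<le> ennreal (b * b) * e2ennreal \<bar>K u v\<bar>"
          using fb by (intro mult_mono ennreal_leI) (cases "K u v"; simp)+
        finally show "ennreal (norm (?g v)) \<le> ennreal (b * b) * e2ennreal \<bar>K u v\<bar>" .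
      qed
      also have "\<dots> = ennreal (b * b) * (\<integral>\<^sup>+ v. e2ennreal \<bar>K u v\<bar> \<partial>\<nu> n)"
        by (rule nn_integral_cmult) measurable
      also have "\<dots> \<le> ennreal (b * b) * (ennreal c * (1 + e2ennreal \<bar>K u x\<bar>))"
        by (intro mult_left_mono dom u) auto
      \<comment> \<open>\<open>ennreal\<close> cuts a negative \<open>c\<close> off at 0; the
        absolute value lets the bound be rewritten as a nonnegative real majorant.\<close>
      also have "\<dots> \<le> ennreal (b * b) * (ennreal \<bar>c\<bar> * (1 + e2ennreal \<bar>K u x\<bar>))"
        by (intro mult_left_mono mult_right_mono ennreal_leI) auto
      also have "\<dots> = ennreal (b * b * (\<bar>c\<bar> * (1 + \<bar>real_of_ereal (K u x)\<bar>)))"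
      proof -
        have "e2ennreal \<bar>K u x\<bar> = ennreal \<bar>real_of_ereal (K u x)\<bar>"
          using off[OF u] by (cases "K u x") auto
        then have eq: "1 + e2ennreal \<bar>K u x\<bar> = ennreal (1 + \<bar>real_of_ereal (K u x)\<bar>)"
          by (simp only: ennreal_plus[OF zero_le_one abs_ge_zero] ennreal_1)
        have nn: "0 \<le> b * b" "0 \<le> 1 + \<bar>real_of_ereal (K u x)\<bar>"
          using b(1) add_nonneg_nonneg[OF zero_le_one abs_ge_zero] by (simp_all only: mult_nonneg_nonneg order_less_imp_le)
        show ?thesis
          unfolding eq ennreal_mult[OF nn(1) mult_nonneg_nonneg[OF abs_ge_zero nn(2)]]
            ennreal_mult[OF abs_ge_zero nn(2)] ..
      qed
      finally have le: "(\<integral>\<^sup>+ v. ennreal (norm (?g v)) \<partial>\<nu> n) \<le> ennreal (b * b * (\<bar>c\<bar> * (1 + \<bar>real_of_ereal (K u x)\<bar>)))" .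
      have i: "integrable (\<nu> n) ?g"
        unfolding integrable_iff_bounded using gm le_less_trans[OF le] by simp
      have bound_nonneg: "0 \<le> b * b * (\<bar>c\<bar> * (1 + \<bar>real_of_ereal (K u x)\<bar>))"
        using b(1) by (intro mult_nonneg_nonneg add_nonneg_nonneg abs_ge_zero zero_le_one order_less_imp_le)
      have "ennreal (norm (\<integral>v. ?g v \<partial>\<nu> n)) \<le> ennreal (b * b * (\<bar>c\<bar> * (1 + \<bar>real_of_ereal (K u x)\<bar>)))"
        using integral_norm_bound_ennreal[OF i] le by (rule order_trans)
      then have "norm (\<integral>v. ?g v \<partial>\<nu> n) \<le> b * b * (\<bar>c\<bar> * (1 + \<bar>real_of_ereal (K u x)\<bar>))"
        unfolding ennreal_le_iff[OF bound_nonneg] .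
      then show ?thesis using i unfolding w_def by simp
    qed
    have wlim: "(\<lambda>n. w n u) \<longlonglongrightarrow> real_of_ereal (K u x) * (f u $ j * f x $ i)" if u: "u \<in> X" "u \<noteq> x" for u
      unfolding w_def
    proof (rule concentrating_integral_tendsto[OF \<nu> conc])
      show "integrable (\<nu> n) (\<lambda>v. real_of_ereal (K u v) * (f u $ j * f v $ i))" for n
        using kn[OF u] by blast
      \<comment> \<open>Joint continuity at the off-diagonal point \<open>(u, x)\<close> is
        restricted to the path from \<open>v\<close> to \<open>(u, v)\<close>, giving continuity in
        the second argument.\<close>
      have "((\<lambda>(s, t). K s t) \<longlongrightarrow> K u x) (at (u, x) within X \<times> X)"
        using cont[OF u] by (simp add: continuous_within)
      moreover have "filterlim (\<lambda>v. (u, v)) (at (u, x) within X \<times> X) (at x within X)"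
        unfolding filterlim_at
        using u by (auto intro!: tendsto_intros simp: eventually_at_filter)
      ultimately have "((\<lambda>v. K u v) \<longlongrightarrow> K u x) (at x within X)"
        using filterlim_compose[of "\<lambda>(s, t). K s t"] by fastforce
      moreover have "ereal (real_of_ereal (K u x)) = K u x"
        using off[OF u] by (simp add: ereal_real)
      ultimately have "((\<lambda>v. real_of_ereal (K u v)) \<longlongrightarrow> real_of_ereal (K u x)) (at x within X)"
        by (intro lim_real_of_ereal) simp
      moreover have "((\<lambda>v. f v $ i) \<longlongrightarrow> f x $ i) (at x within X)"
        using cont_f x by (simp add: continuous_on_def)
      ultimately show "((\<lambda>v. real_of_ereal (K u v) * (f u $ j * f v $ i)) \<longlongrightarrow>
          real_of_ereal (K u x) * (f u $ j * f x $ i)) (at x within X)"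
        by (intro tendsto_mult tendsto_const)
    qed
    have "(\<lambda>n. \<integral>u. w n u \<partial>\<xi>) \<longlonglongrightarrow> (\<integral>u. real_of_ereal (K u x) * (f u $ j * f x $ i) \<partial>\<xi>)"
    proof (rule integral_dominated_convergence)
      show "(\<lambda>u. real_of_ereal (K u x) * (f u $ j * f x $ i)) \<in> borel_measurable \<xi>"
        using f_meas_design[OF \<xi>_design] by measurable
      show "w n \<in> borel_measurable \<xi>" for n by (rule wm)
      have "ext_integrable \<xi> (\<lambda>u. K u x)" using pot Kx_m by (simp add: ext_integrable_def)
      then have "integrable \<xi> (\<lambda>u. \<bar>real_of_ereal (K u x)\<bar>)"
        by (intro integrable_abs ext_integrable_imp_integrable)
      then show "integrable \<xi> (\<lambda>u. b * b * (\<bar>c\<bar> * (1 + \<bar>real_of_ereal (K u x)\<bar>)))"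
        by (intro integrable_mult_right Bochner_Integration.integrable_add) simp_all
      show "AE u in \<xi>. (\<lambda>n. w n u) \<longlonglongrightarrow> real_of_ereal (K u x) * (f u $ j * f x $ i)"
        using ne by eventually_elim (simp add: wlim)
      show "AE u in \<xi>. norm (w n u) \<le> b * b * (\<bar>c\<bar> * (1 + \<bar>real_of_ereal (K u x)\<bar>))" for n
        unfolding real_norm_def using ne by eventually_elim (rule kn[THEN conjunct2]; simp)
    qed
    then show ?thesis unfolding Bw .
  qed
  have "(\<lambda>n. trace (C ** G ** B_mat K f \<xi> (\<nu> n) ** G)) \<longlonglongrightarrow> b_fun X \<Phi> K f x \<xi>"
    unfolding trace_b_eq b_fun_eq_sum[OF x] by (intro tendsto_intros entry)
  moreover have "(\<lambda>n. \<integral>y. phi_fun \<Phi> K f y \<xi> \<partial>\<nu> n) \<longlonglongrightarrow> phi_fun \<Phi> K f x \<xi>"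
    using phi_continuous x
    by (intro concentrating_integral_tendsto[OF \<nu> conc phi_integral(1)[OF \<nu>]]) (simp add: continuous_on_def)
  moreover have "(\<integral>y. phi_fun \<Phi> K f y \<xi> \<partial>\<nu> n) \<le> trace (C ** G ** B_mat K f \<xi> (\<nu> n) ** G)" for n
    using phi_le_b_integral[OF \<nu> E cross, of n] unfolding b_integral(2)[OF \<nu> cross] .
  ultimately show ?thesis
    by (intro LIMSEQ_le) auto
qed

end

text \<open>The \<open>B_exists\<close> clauses guard \<open>b_fun\<close>, whose integrals take
  default values where they do not exist. For a finite kernel existence is part of the conclusion at
  every point. For a singular kernel the pointwise claim concerns approachable points of finite
  potential, and elsewhere the exceptional points are null for every design of finite
  energy.\<close>

theorem theorem3p1:
  fixes X :: "(real ^ 'd) set"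
    and f :: "real ^ 'd \<Rightarrow> real ^ 'm"
    and K :: "real ^ 'd \<Rightarrow> real ^ 'd \<Rightarrow> ereal"
    and \<Phi> :: "real ^ 'm ^ 'm \<Rightarrow> real"
    and \<xi> :: "(real ^ 'd) measure"
  assumes "compact X"
    and "regression_functions X f"
    and "covariance_kernel X K"
    and "loewner_mono \<Phi>"
    and "matrix_differentiable \<Phi>"
    and "\<xi> \<in> Xi_set X K f"
    and "\<forall>\<nu>\<in>Xi_set X K f. \<Phi> (D_mat K f \<xi>) \<le> \<Phi> (D_mat K f \<nu>)"
  shows
    "(finite_kernel X K \<longrightarrow>
        (\<forall>x\<in>X. B_exists K f \<xi> (point_design X x) \<and> phi_fun \<Phi> K f x \<xi> \<le> b_fun X \<Phi> K f x \<xi>)) \<and>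
     (singular_kernel X K \<longrightarrow>
        (\<forall>x\<in>X. approachable X K x \<and> B_exists K f \<xi> (point_design X x) \<longrightarrow>
           phi_fun \<Phi> K f x \<xi> \<le> b_fun X \<Phi> K f x \<xi>) \<and>
        (\<forall>\<nu>\<in>designs X. B_exists K f \<nu> \<nu> \<longrightarrow>
           (AE x in \<nu>. B_exists K f \<xi> (point_design X x) \<and>
              phi_fun \<Phi> K f x \<xi> \<le> b_fun X \<Phi> K f x \<xi>))) \<and>
     (AE x in \<xi>. B_exists K f \<xi> (point_design X x) \<and>
        phi_fun \<Phi> K f x \<xi> = b_fun X \<Phi> K f x \<xi>) \<and>
     {x \<in> X. phi_fun \<Phi> K f x \<xi> < b_fun X \<Phi> K f x \<xi>} \<in> null_sets \<xi>"
proof -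
  have cf: "continuous_on X (\<lambda>x. f x $ i)" and nz: "x \<in> X \<Longrightarrow> f x \<noteq> 0" for i x
    using assms(2) by (auto simp: regression_functions_def)
  have bk: "basic_kernel X K" and K5: "finite_kernel X K \<or> singular_kernel X K"
    using assms(3) by (simp_all add: covariance_kernel_def)
  note bk' = bk[unfolded basic_kernel_def]
  have K1: "u \<in> X \<Longrightarrow> v \<in> X \<Longrightarrow> K u v = K v u" for u v
    by (rule conjunct1[OF bk', rule_format])
  have K2: "u \<in> X \<Longrightarrow> v \<in> X \<Longrightarrow> u \<noteq> v \<Longrightarrow> \<bar>K u v\<bar> \<noteq> \<infinity>" for u v
    by (rule bk'[THEN conjunct2, THEN conjunct1, rule_format])
  have K3: "u \<in> X \<Longrightarrow> v \<in> X \<Longrightarrow> u \<noteq> v \<Longrightarrow> continuous (at (u, v) within X \<times> X) (\<lambda>(s, t). K s t)" for u v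
    by (rule bk'[THEN conjunct2, THEN conjunct2, THEN conjunct1, rule_format])
  have K4: "kernel_pos_def X K"
    using bk'[THEN conjunct2, THEN conjunct2, THEN conjunct2] .
  have \<xi>: "\<xi> \<in> designs X" "B_exists K f \<xi> \<xi>" using assms(6) by (auto simp: Xi_set_def)
  let ?B = "restrict_space borel X"
  have fm[measurable]: "(\<lambda>x. f x $ i) \<in> borel_measurable ?B" for i
    by (rule borel_measurable_continuous_on_restrict[OF cf])
  \<comment> \<open>Existence of B(\<xi>,\<xi>) contains measurability of each product of
    \<open>K\<close> with f_i(u) f_j(v). As \<open>f\<close> has no zeros on \<open>X\<close>, some
    weight is nonzero at each pair, and \<open>K\<close> can be recovered. All designs share one
    sigma-algebra, so this serves every design.\<close>
  have Km: "(\<lambda>(u, v). K u v) \<in> borel_measurable (?B \<Otimes>\<^sub>M ?B)"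
  proof (rule borel_measurable_of_weighted[where I = UNIV and g = "\<lambda>p z. f (fst z) $ fst p * f (snd z) $ snd p"])
    fix p :: "'m \<times> 'm"
    have "(\<lambda>(u, v). K u v * ereal (f u $ fst p * f v $ snd p)) \<in> borel_measurable (\<xi> \<Otimes>\<^sub>M \<xi>)"
      using \<xi>(2) by (simp add: B_exists_def double_integrable_def ext_integrable_def)
    then show "(\<lambda>z. (\<lambda>(u, v). K u v) z * ereal (f (fst z) $ fst p * f (snd z) $ snd p)) \<in> borel_measurable (?B \<Otimes>\<^sub>M ?B)"
      by (simp add: measurable_pair_design[OF \<xi>(1,1)] split_beta')
    show "(\<lambda>z. f (fst z) $ fst p * f (snd z) $ snd p) \<in> borel_measurable (?B \<Otimes>\<^sub>M ?B)" by measurable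
  next
    fix z assume "z \<in> space (?B \<Otimes>\<^sub>M ?B)"
    then have "f (fst z) \<noteq> 0" "f (snd z) \<noteq> 0"
      by (auto simp: space_pair_measure space_restrict_space nz)
    then obtain i j where "f (fst z) $ i \<noteq> 0" "f (snd z) $ j \<noteq> 0" by (auto simp: vec_eq_iff)
    then show "\<exists>p\<in>UNIV. f (fst z) $ fst p * f (snd z) $ snd p \<noteq> 0"
      by (intro bexI[of _ "(i, j)"]) auto
  qed simp
  interpret optimal_design X K f \<Phi> \<xi>
    by unfold_locales (use assms K1 Km cf nz K4 in auto)
  have inf: "K x x = \<infinity>" if "singular_kernel X K" "x \<in> X" for x
    using that unfolding singular_kernel_def by force
  have X: "closed X" using assms(1) by (rule compact_imp_closed)
  have fin: "B_exists K f \<xi> (point_design X x) \<and> phi_fun \<Phi> K f x \<xi> \<le> b_fun X \<Phi> K f x \<xi>"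
    if f: "finite_kernel X K" and x: "x \<in> X" for x
  proof -
    have B: "B_exists K f \<xi> (point_design X x)"
      unfolding B_exists_point_iff[OF \<xi>(1) x] by (rule potential_finite[OF f K4 \<xi>(1) \<xi>_energy x])
    have "\<bar>K x x\<bar> \<noteq> \<infinity>" using f x by (simp add: finite_kernel_def)
    from B phi_le_b_point[OF x this B] show ?thesis by (rule conjI)
  qed
  have sing: "AE x in \<nu>. B_exists K f \<xi> (point_design X x) \<and> phi_fun \<Phi> K f x \<xi> \<le> b_fun X \<Phi> K f x \<xi>"
    if s: "singular_kernel X K" and \<nu>: "\<nu> \<in> designs X" "B_exists K f \<nu> \<nu>" for \<nu>
  proof -
    have E: "double_integrable K \<nu> \<nu>" using \<nu> B_exists_iff by blast
    from singular_cross_energy[OF s X \<xi>(1) \<nu>(1) \<xi>_energy E]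
    show ?thesis
      by (intro AE_conjI AE_B_exists_point AE_phi_le_b[OF s] \<xi>(1) \<nu>(1) E)
  qed
  \<comment> \<open>In the singular case \<open>\<xi>\<close> itself is taken as the design of
    finite energy.\<close>
  have "AE x in \<xi>. B_exists K f \<xi> (point_design X x) \<and> phi_fun \<Phi> K f x \<xi> \<le> b_fun X \<Phi> K f x \<xi>"
    using K5
  proof
    assume "finite_kernel X K"
    then show ?thesis using fin by (intro AE_I2) (simp add: space_design[OF \<xi>(1)])
  qed (rule sing[OF _ \<xi>])
  then have le: "AE x in \<xi>. B_exists K f \<xi> (point_design X x)" "AE x in \<xi>. phi_fun \<Phi> K f x \<xi> \<le> b_fun X \<Phi> K f x \<xi>"
    by auto
  note eq = AE_phi_eq_b[OF le(2)]
  show ?thesis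
  proof (intro conjI impI ballI)
    show "phi_fun \<Phi> K f x \<xi> \<le> b_fun X \<Phi> K f x \<xi>"
      if "singular_kernel X K" "x \<in> X" "approachable X K x \<and> B_exists K f \<xi> (point_design X x)" for x
      using that by (intro phi_le_b_approachable K2 K3 inf) auto
    show "AE x in \<xi>. B_exists K f \<xi> (point_design X x) \<and> phi_fun \<Phi> K f x \<xi> = b_fun X \<Phi> K f x \<xi>"
      using le(1) eq by (rule AE_conjI)
    show "{x \<in> X. phi_fun \<Phi> K f x \<xi> < b_fun X \<Phi> K f x \<xi>} \<in> null_sets \<xi>"
      by (rule strict_set_null[OF eq])
  qed (use fin sing in auto)
qed

end
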